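(* Let $S\subset\mathbb R^n$, the policy $\pi$, the coefficients $\mu,\sigma,\rho$ and the discount rate $\gamma>0$ satisfy Assumptions (1)–(5) listed in the context. Let $V^\pi\in H^1(S)$ be the unique weak solution of $(\gamma I-\mathcal L^\pi)V=\bar\rho$ in $S$ with the boundary condition $n\cdot(D\nabla V)=0$ on $\partial S$, i.e. the unique fixed point $TV^\pi=V^\pi$. Then there exists a constant $\lambda>0$ such that for every initial condition $V(0)\in L^2(S)$, the solution $V(t)$ of the continuous-time dynamics $$\frac{\partial V(t)}{\partial t}=TV(t)-V(t)$$ satisfies, for all $t\ge0$, $$\|V(t)-V^\pi\|_{L^2(S)}\le e^{-\lambda t}\,\|V(0)-V^\pi\|_{L^2(S)}.$$
   Context: Setting. $S\subset\mathbb R^n$ is the state space, $\mathcal A$ an action space, $\pi$ a stationary Markov policy assigning to each $s\in S$ a probability distribution $\pi(\cdot\mid s)$ on $\mathcal A$, $\mu:S\times\mathcal A\to\mathbb R^n$ the drift, $\sigma:S\times\mathcal A\to\mathbb R^{n\times m}$ the diffusion, $\rho:S\times\mathcal A\to\mathbb R$ the reward rate, and $\gamma>0$ the discount rate. $\mathbb E_\pi$ is expectation over $A\sim\pi(\cdot\mid s)$. Put $$\bar\rho(s)=\mathbb E_\pi[\rho(s,A)],\quad \bar\mu(s)=\mathbb E_\pi[\mu(s,A)],\quad D(s)=\mathbb E_\pi[\sigma(s,A)\sigma^\top(s,A)].$$ Operators. The infinitesimal generator is $$(\mathcal L^\pi V)(s)=\sum_{i=1}^n\bar\mu^i(s)\frac{\partial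 V}{\partial s^i}(s)+\frac12\sum_{i,j=1}^nD^{ij}(s)\frac{\partial^2V}{\partial s^i\partial s^j}(s),$$ and the HJB operator under the fixed policy is $TV=\frac1\gamma(\bar\rho+\mathcal L^\pi V)$. Thus $TV=V$ is equivalent to $(\gamma I-\mathcal L^\pi)V=\bar\rho$, and $TV-V=-\frac1\gamma\big((\gamma I-\mathcal L^\pi)V-\bar\rho\big)$. Weak formulation. The bilinear form associated with $\gamma I-\mathcal L^\pi$ (with the Neumann condition below) is, for $V,v\in H^1(S)$, $$B(V,v)=\int_S\gamma Vv+\frac12\int_S\sum_{i,j}D^{ij}\,\partial_jV\,\partial_iv-\int_S\sum_i\bar\mu^i\,\partial_iV\,v-\frac12\int_S\sum_{i,j}(\partial_iD^{ij})\,\partial_jV\,v .$$ A weak solution of $(\gamma I-\mathcal L^\pi)V=\bar\rho$ is $V\in H^1(S)$ with $B(V,v)=\int_S\bar\rho\,v$ for all $v\in H^1(S)$. The dynamics $\partial_tV=TV-V$ is understood in the corresponding weak sense with the same boundary condition: for every $\tau>0$, $V\in L^2(0,\tau;H^1(S))$ with $\partial_tV\in L^2(0,\tau;H^1(S)^* )$ (so $V\in C([0,\tau];L^2(S))$), with the prescribed initial value $V(0)$, and for a.e. $t$ and all $v\in H^1(S)$, $$\langle\partial_tV(t),v\rangle=-\frac1\gamma\Big(B(V(t),v)-\int_S\bar\rho\,v\Big).$$ Assumptions. (1) $S$ is a bounded, connected open subset of $\mathbb R^n$ with smooth boundary $\partial S$; the analysis is in the Sobolev space $H^1(S)$. (2)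 Reflecting (Neumann) boundary condition: $n(s)\cdot(D(s)\nabla V(s))=0$ for $s\in\partial S$, where $n(s)$ is the outward unit normal. (3) $\bar\rho$, $\bar\mu$, $D$ are bounded and Lipschitz continuous on $\bar S$. (4) $D(s)$ is symmetric and uniformly elliptic: there is $\alpha>0$ with $\xi^\top D(s)\xi\ge\alpha\|\xi\|^2$ for all $s\in\bar S$, $\xi\in\mathbb R^n$. (5) $\gamma>0$ is sufficiently large that $B$ is coercive on $H^1(S)$: there is $c>0$ with $B(V,V)\ge c\|V\|_{H^1(S)}^2$ for all $V\in H^1(S)$. *)

theory Defs
  imports "HOL-Probability.Probability"
begin

section \<open>Smooth functions, test functions and smooth domains\<close>

text \<open>Only meant for open \<open>U\<close>: derivatives are full derivatives at the points of \<open>U\<close>.\<close>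

primrec Ck_on :: "nat \<Rightarrow> 'a::euclidean_space set \<Rightarrow> ('a \<Rightarrow> real) \<Rightarrow> bool" where
  "Ck_on 0 U f \<longleftrightarrow> continuous_on U f"
| "Ck_on (Suc k) U f \<longleftrightarrow>
     (\<forall>x\<in>U. f differentiable (at x)) \<and>
     (\<forall>b\<in>Basis. Ck_on k U (\<lambda>x. frechet_derivative f (at x) b))"

definition smooth_on :: "'a::euclidean_space set \<Rightarrow> ('a \<Rightarrow> real) \<Rightarrow> bool" where
  "smooth_on U f \<longleftrightarrow> (\<forall>k. Ck_on k U f)"

definition test_function :: "'a::euclidean_space set \<Rightarrow> ('a \<Rightarrow> real) \<Rightarrow> bool" where
  "test_function S \<phi> \<longleftrightarrow>
     smooth_on UNIV \<phi> \<and> compact (closure {x. \<phi> x \<noteq> 0}) \<and> closure {x. \<phi> x \<noteq> 0} \<subseteq> S"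

text \<open>Near each boundary point, \<open>S\<close> is the side \<open>\<psi> < 0\<close> of a regular level set of a smooth
  function (so that the boundary is locally \<open>\<psi> = 0\<close> and \<open>S\<close> lies on one side of it).\<close>

definition smooth_boundary :: "'a::euclidean_space set \<Rightarrow> bool" where
  "smooth_boundary S \<longleftrightarrow>
     (\<forall>p\<in>frontier S. \<exists>U \<psi>. open U \<and> p \<in> U \<and> smooth_on U \<psi> \<and>
        (\<forall>x\<in>U. frechet_derivative \<psi> (at x) \<noteq> (\<lambda>h. 0)) \<and>
        S \<inter> U = {x\<in>U. \<psi> x < 0})"


section \<open>The spaces \<open>L\<^sup>2(S)\<close>, \<open>H\<^sup>1(S)\<close> and the dual of \<open>H\<^sup>1(S)\<close>\<close>

text \<open>Elements of \<open>L\<^sup>2(S)\<close> and \<open>H\<^sup>1(S)\<close> are represented by functions on the whole space. Values outside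
  \<open>S\<close> or on null sets are irrelevant: \<open>L2_norm\<close> and \<open>H1_norm\<close> are seminorms whose kernel consists of
  the functions vanishing almost everywhere on \<open>S\<close>.\<close>

definition L2 :: "(real^'n::finite) set \<Rightarrow> (real^'n \<Rightarrow> real) set" where
  "L2 S = {u. u \<in> borel_measurable (lebesgue_on S) \<and> integrable (lebesgue_on S) (\<lambda>x. (u x)\<^sup>2)}"

definition L2_inner :: "(real^'n::finite) set \<Rightarrow> (real^'n \<Rightarrow> real) \<Rightarrow> (real^'n \<Rightarrow> real) \<Rightarrow> real" where
  "L2_inner S u v = (\<integral>x. u x * v x \<partial>lebesgue_on S)"

definition L2_norm :: "(real^'n::finite) set \<Rightarrow> (real^'n \<Rightarrow> real) \<Rightarrow> real" where
  "L2_norm S u = sqrt (\<integral>x. (u x)\<^sup>2 \<partial>lebesgue_on S)"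

definition locally_integrable :: "(real^'n::finite) set \<Rightarrow> (real^'n \<Rightarrow> real) \<Rightarrow> bool" where
  "locally_integrable S u \<longleftrightarrow> (\<forall>K. compact K \<and> K \<subseteq> S \<longrightarrow> integrable (lebesgue_on K) u)"

definition has_weak_partial ::
    "(real^'n::finite) set \<Rightarrow> 'n \<Rightarrow> (real^'n \<Rightarrow> real) \<Rightarrow> (real^'n \<Rightarrow> real) \<Rightarrow> bool" where
  "has_weak_partial S i u g \<longleftrightarrow>
     locally_integrable S u \<and> locally_integrable S g \<and>
     (\<forall>\<phi>. test_function S \<phi> \<longrightarrow>
        (\<integral>x. u x * frechet_derivative \<phi> (at x) (axis i 1) \<partial>lebesgue_on S) =
        - (\<integral>x. g x * \<phi> x \<partial>lebesgue_on S))"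

text \<open>A weak derivative on an open set is determined up to a null set; one representative is chosen.\<close>

definition weak_partial ::
    "(real^'n::finite) set \<Rightarrow> 'n \<Rightarrow> (real^'n \<Rightarrow> real) \<Rightarrow> real^'n \<Rightarrow> real" where
  "weak_partial S i u = (SOME g. has_weak_partial S i u g)"

definition H1 :: "(real^'n::finite) set \<Rightarrow> (real^'n \<Rightarrow> real) set" where
  "H1 S = {u \<in> L2 S. \<forall>i. \<exists>g \<in> L2 S. has_weak_partial S i u g}"

definition H1_norm :: "(real^'n::finite) set \<Rightarrow> (real^'n \<Rightarrow> real) \<Rightarrow> real" where
  "H1_norm S u = sqrt ((L2_norm S u)\<^sup>2 + (\<Sum>i\<in>UNIV. (L2_norm S (weak_partial S i u))\<^sup>2))"

definition H1_dual :: "(real^'n::finite) set \<Rightarrow> ((real^'n \<Rightarrow> real) \<Rightarrow> real) set" where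
  "H1_dual S = {F.
     (\<forall>u\<in>H1 S. \<forall>v\<in>H1 S. F (\<lambda>x. u x + v x) = F u + F v) \<and>
     (\<forall>c. \<forall>v\<in>H1 S. F (\<lambda>x. c * v x) = c * F v) \<and>
     (\<exists>C. \<forall>v\<in>H1 S. \<bar>F v\<bar> \<le> C * H1_norm S v)}"

definition H1_dual_norm :: "(real^'n::finite) set \<Rightarrow> ((real^'n \<Rightarrow> real) \<Rightarrow> real) \<Rightarrow> real" where
  "H1_dual_norm S F = (SUP v\<in>{v\<in>H1 S. H1_norm S v \<le> 1}. \<bar>F v\<bar>)"


section \<open>Bochner spaces and weak time derivatives\<close>

text \<open>Strong measurability and square integrability of functions with values in a space \<open>X\<close> of
  real-valued functions seminormed by \<open>N\<close>. The library's Bochner integral needs a normed type, whereas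
  the spaces used here depend on the domain \<open>S\<close>.\<close>

definition strongly_measurable ::
    "'t measure \<Rightarrow> ('b \<Rightarrow> real) set \<Rightarrow> (('b \<Rightarrow> real) \<Rightarrow> real) \<Rightarrow> ('t \<Rightarrow> 'b \<Rightarrow> real) \<Rightarrow> bool" where
  "strongly_measurable M X N u \<longleftrightarrow>
     (AE t in M. u t \<in> X) \<and>
     (\<exists>s::nat \<Rightarrow> 't \<Rightarrow> 'b \<Rightarrow> real.
        (\<forall>k. simple_function M (s k) \<and> s k ` space M \<subseteq> X) \<and>
        (AE t in M. (\<lambda>k. N (\<lambda>x. s k t x - u t x)) \<longlonglongrightarrow> 0))"

definition bochner_L2 ::
    "'t measure \<Rightarrow> ('b \<Rightarrow> real) set \<Rightarrow> (('b \<Rightarrow> real) \<Rightarrow> real) \<Rightarrow> ('t \<Rightarrow> 'b \<Rightarrow> real) \<Rightarrow> bool" where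
  "bochner_L2 M X N u \<longleftrightarrow> strongly_measurable M X N u \<and> integrable M (\<lambda>t. (N (u t))\<^sup>2)"

text \<open>\<open>V'\<close> is the distributional derivative on \<open>(0,\<tau>)\<close> of \<open>V\<close>, where \<open>H\<^sup>1(S)\<close> is embedded into its dual
  through the inner product of \<open>L\<^sup>2(S)\<close>.\<close>

definition has_weak_time_derivative ::
    "(real^'n::finite) set \<Rightarrow> real \<Rightarrow> (real \<Rightarrow> real^'n \<Rightarrow> real) \<Rightarrow>
     (real \<Rightarrow> (real^'n \<Rightarrow> real) \<Rightarrow> real) \<Rightarrow> bool" where
  "has_weak_time_derivative S \<tau> V V' \<longleftrightarrow>
     (\<forall>\<psi>. test_function {0<..<\<tau>} \<psi> \<longrightarrow> (\<forall>v\<in>H1 S.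
        (\<integral>t. L2_inner S (V t) v * deriv \<psi> t \<partial>lebesgue_on {0<..<\<tau>}) =
        - (\<integral>t. V' t v * \<psi> t \<partial>lebesgue_on {0<..<\<tau>})))"


section \<open>Coefficients averaged over the policy\<close>

definition avg_reward ::
    "(real^'n::finite \<Rightarrow> 'a measure) \<Rightarrow> (real^'n \<Rightarrow> 'a \<Rightarrow> real) \<Rightarrow> real^'n \<Rightarrow> real" where
  "avg_reward \<pi> \<rho> s = (\<integral>a. \<rho> s a \<partial>\<pi> s)"

definition avg_drift ::
    "(real^'n::finite \<Rightarrow> 'a measure) \<Rightarrow> (real^'n \<Rightarrow> 'a \<Rightarrow> real^'n) \<Rightarrow> real^'n \<Rightarrow> real^'n" where
  "avg_drift \<pi> \<mu> s = (\<integral>a. \<mu> s a \<partial>\<pi> s)"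

definition avg_diffusion ::
    "(real^'n::finite \<Rightarrow> 'a measure) \<Rightarrow> (real^'n \<Rightarrow> 'a \<Rightarrow> real^'m::finite^'n) \<Rightarrow>
     real^'n \<Rightarrow> real^'n^'n" where
  "avg_diffusion \<pi> \<sigma> s = (\<integral>a. \<sigma> s a ** transpose (\<sigma> s a) \<partial>\<pi> s)"


section \<open>Weak formulation of the equation and of the dynamics\<close>

text \<open>In the last term the derivative of the Lipschitz coefficient \<open>D\<close> is its weak derivative (which
  agrees almost everywhere with the classical one).\<close>

definition hjb_form ::
    "(real^'n::finite) set \<Rightarrow> real \<Rightarrow> (real^'n \<Rightarrow> real^'n) \<Rightarrow> (real^'n \<Rightarrow> real^'n^'n) \<Rightarrow>
     (real^'n \<Rightarrow> real) \<Rightarrow> (real^'n \<Rightarrow> real) \<Rightarrow> real" where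
  "hjb_form S \<gamma> b D V v =
     (\<integral>x. \<gamma> * V x * v x \<partial>lebesgue_on S)
     + 1/2 * (\<integral>x. (\<Sum>i\<in>UNIV. \<Sum>j\<in>UNIV. D x $ i $ j * weak_partial S j V x * weak_partial S i v x)
          \<partial>lebesgue_on S)
     - (\<integral>x. (\<Sum>i\<in>UNIV. b x $ i * weak_partial S i V x * v x) \<partial>lebesgue_on S)
     - 1/2 * (\<integral>x. (\<Sum>i\<in>UNIV. \<Sum>j\<in>UNIV.
            weak_partial S i (\<lambda>y. D y $ i $ j) x * weak_partial S j V x * v x) \<partial>lebesgue_on S)"

definition coercive_on_H1 ::
    "(real^'n::finite) set \<Rightarrow> ((real^'n \<Rightarrow> real) \<Rightarrow> (real^'n \<Rightarrow> real) \<Rightarrow> real) \<Rightarrow> bool" where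
  "coercive_on_H1 S B \<longleftrightarrow> (\<exists>c>0. \<forall>V\<in>H1 S. c * (H1_norm S V)\<^sup>2 \<le> B V V)"

text \<open>Weak form of the fixed-point equation \<open>TV = V\<close>, where \<open>T\<close> is \<open>1/\<gamma>\<close> times (reward plus generator).
  The Neumann condition \<open>n \<bullet> (D \<nabla>V) = 0\<close> is the natural boundary condition: it is imposed by
  testing with all of \<open>H\<^sup>1(S)\<close>.\<close>

definition hjb_weak_solution ::
    "(real^'n::finite) set \<Rightarrow> real \<Rightarrow> (real^'n \<Rightarrow> real) \<Rightarrow> (real^'n \<Rightarrow> real^'n) \<Rightarrow>
     (real^'n \<Rightarrow> real^'n^'n) \<Rightarrow> (real^'n \<Rightarrow> real) \<Rightarrow> bool" where
  "hjb_weak_solution S \<gamma> r b D V \<longleftrightarrow>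
     V \<in> H1 S \<and> (\<forall>v\<in>H1 S. hjb_form S \<gamma> b D V v = L2_inner S r v)"

text \<open>The functional \<open>v \<mapsto> \<langle>TV - V, v\<rangle>\<close>, with the same boundary condition.\<close>

definition hjb_residual ::
    "(real^'n::finite) set \<Rightarrow> real \<Rightarrow> (real^'n \<Rightarrow> real) \<Rightarrow> (real^'n \<Rightarrow> real^'n) \<Rightarrow>
     (real^'n \<Rightarrow> real^'n^'n) \<Rightarrow> (real^'n \<Rightarrow> real) \<Rightarrow> (real^'n \<Rightarrow> real) \<Rightarrow> real" where
  "hjb_residual S \<gamma> r b D V v = - (1/\<gamma>) * (hjb_form S \<gamma> b D V v - L2_inner S r v)"

text \<open>Solutions of \<open>\<partial>\<^sub>tV = TV - V\<close> with initial value \<open>V0\<close>. A solution is identified with its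
  representative that is continuous in time with values in \<open>L\<^sup>2(S)\<close>, which gives a meaning to \<open>V t\<close>
  for every single \<open>t \<ge> 0\<close>.\<close>

definition hjb_flow ::
    "(real^'n::finite) set \<Rightarrow> real \<Rightarrow> (real^'n \<Rightarrow> real) \<Rightarrow> (real^'n \<Rightarrow> real^'n) \<Rightarrow>
     (real^'n \<Rightarrow> real^'n^'n) \<Rightarrow> (real^'n \<Rightarrow> real) \<Rightarrow> (real \<Rightarrow> real^'n \<Rightarrow> real) \<Rightarrow> bool" where
  "hjb_flow S \<gamma> r b D V0 V \<longleftrightarrow>
     (\<forall>t\<ge>0. V t \<in> L2 S \<and> ((\<lambda>s. L2_norm S (\<lambda>x. V s x - V t x)) \<longlongrightarrow> 0) (at t within {0..})) \<and>
     (AE x in lebesgue_on S. V 0 x = V0 x) \<and>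
     (\<forall>\<tau>>0.
        bochner_L2 (lebesgue_on {0<..<\<tau>}) (H1 S) (H1_norm S) V \<and>
        (\<exists>V'. bochner_L2 (lebesgue_on {0<..<\<tau>}) (H1_dual S) (H1_dual_norm S) V' \<and>
              has_weak_time_derivative S \<tau> V V' \<and>
              (AE t in lebesgue_on {0<..<\<tau>}. \<forall>v\<in>H1 S. V' t v = hjb_residual S \<gamma> r b D (V t) v)))"

end

theory Submission
  imports Defs "HOL-Computational_Algebra.Polynomial"
begin

text \<open>Let \<open>W = V - V\<^sub>\<pi>\<close> and \<open>B\<close> be the coercive form. The equation is linear and autonomous, so averaging
  \<open>W\<close> in time against a smooth kernel \<open>\<eta>\<close> gives a smooth function solving the same equation, whose
  energy \<open>\<Phi>(t) = \<integral>\<integral> \<langle>W s, W s'\<rangle> \<eta>(t - s) \<eta>(t - s') ds ds'\<close> satisfies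
  \<open>\<Phi>' = - (2/\<gamma>) \<integral>\<integral> B(W s, W s') \<eta>(t - s) \<eta>(t - s') ds ds' \<le> - (2c/\<gamma>) \<Phi>\<close>. Neither vector-valued
  integrals nor the Lions--Magenes lemma are needed: the equality is the weak time derivative tested
  with \<open>\<eta>(t - \<cdot>)\<close> and \<open>W s'\<close>, and the inequality says that the double integral of a positive form is
  nonnegative. Shrinking the kernel and using the continuity of \<open>W\<close> in \<open>L\<^sup>2(S)\<close> gives the claim with
  rate \<open>c/\<gamma>\<close>. Boundedness of \<open>B\<close> on \<open>H\<^sup>1(S)\<close> requires that the chosen weak derivatives of the Lipschitz
  diffusion matrix are essentially bounded.\<close>

section \<open>Smooth bump functions\<close>

text \<open>The usual energy argument tests the equation with \<open>W t\<close> itself. Here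
  \<open>has_weak_time_derivative\<close> pairs only with vectors that do not depend on time, and
  the product rule for the squared L2 norm of \<open>W t\<close> is precisely the Lions--Magenes
  lemma. The form whose double integral is nonnegative is B minus c times the L2 inner product,
  where c is the coercivity constant. It is nonnegative on the diagonal because the H1 norm
  dominates the L2 norm. B need not be symmetric: the sign enters only as \<open>Q y y\<close> for
  one time average \<open>y\<close>. The chosen weak derivatives are values of \<open>SOME\<close>,
  so nothing is known about them except through uniqueness almost everywhere. That is the purpose of
  the fundamental lemma. For a Lipschitz function the derivative itself comes from a Riesz
  representation, and its pointwise bound again from the fundamental lemma.\<close>

definition flat_exp :: "real poly \<Rightarrow> real \<Rightarrow> real" where
  "flat_exp p x = (if x > 0 then poly p (1/x) * exp (- (1/x)) else 0)"

lemma poly_times_exp_minus_tendsto_0: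
  "((\<lambda>x::real. poly p x * exp (- x)) \<longlongrightarrow> 0) at_top"
proof -
  have "((\<lambda>x::real. \<Sum>i\<le>degree p. coeff p i * (x ^ i / exp x)) \<longlongrightarrow> (\<Sum>i\<le>degree p. coeff p i * 0)) at_top"
    by (intro tendsto_sum tendsto_mult tendsto_const tendsto_power_div_exp_0)
  then show ?thesis
    by (simp add: poly_altdef sum_distrib_right sum_divide_distrib exp_minus field_simps)
qed

text \<open>For positive x the derivative of p(1/x) exp(-1/x) is (1/x)^2 (p - p')(1/x) exp(-1/x), so
  the family is closed under differentiation. This is why \<open>flat_exp\<close> carries a
  polynomial; \<open>monom 1 2\<close> is the factor (1/x)^2 coming from the chain rule.\<close>

lemma flat_exp_has_derivative:
  "(flat_exp p has_real_derivative flat_exp (monom 1 2 * (p - pderiv p)) x) (at x)"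
proof -
  consider "x > 0" | "x < 0" | "x = 0" by linarith
  then show ?thesis
  proof cases
    case 1
    have "((\<lambda>x. poly p (1/x) * exp (- (1/x))) has_real_derivative
            flat_exp (monom 1 2 * (p - pderiv p)) x) (at x)"
      using 1 by (auto intro!: derivative_eq_intros
          simp: flat_exp_def poly_monom field_simps power2_eq_square)
    moreover have "\<forall>\<^sub>F y in nhds x. y > 0"
      using 1 by (intro order_tendstoD(1)[OF filterlim_ident])
    then have "\<forall>\<^sub>F y in nhds x. poly p (1/y) * exp (- (1/y)) = flat_exp p y"
      by eventually_elim (simp add: flat_exp_def)
    ultimately show ?thesis
      by (simp add: DERIV_cong_ev)
  next
    case 2
    have "\<forall>\<^sub>F y in nhds x. y < 0"
      using 2 by (intro order_tendstoD(2)[OF filterlim_ident])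
    then have "\<forall>\<^sub>F y in nhds x. flat_exp p y = 0"
      by eventually_elim (simp add: flat_exp_def)
    then show ?thesis
      using 2 by (simp add: DERIV_cong_ev flat_exp_def)
  next
    case 3
    \<comment> \<open>The division by \<open>h\<close> in the difference quotient is one more factor
      \<open>inverse h\<close>, hence \<open>pCons 0 p\<close>. In the variable
      \<open>inverse h\<close> it becomes a polynomial times a decaying exponential at
      infinity.\<close>
    have "((\<lambda>h. poly (pCons 0 p) (inverse h) * exp (- inverse h)) \<longlongrightarrow> 0) (at_right (0::real))"
      by (rule filterlim_compose[OF poly_times_exp_minus_tendsto_0 filterlim_inverse_at_top_right])
    then have "((\<lambda>h. flat_exp p h / h) \<longlongrightarrow> 0) (at_right 0)"
      by (rule Lim_transform_eventually)
        (auto simp: eventually_at_filter flat_exp_def field_simps intro!: always_eventually)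
    moreover have "((\<lambda>h. flat_exp p h / h) \<longlongrightarrow> 0) (at_left 0)"
      by (rule Lim_transform_eventually[OF tendsto_const])
        (auto simp: eventually_at_filter flat_exp_def intro!: always_eventually)
    ultimately have "((\<lambda>h. flat_exp p h / h) \<longlongrightarrow> 0) (at 0)"
      by (simp add: filterlim_split_at)
    then show ?thesis
      using 3 by (simp add: DERIV_def flat_exp_def)
  qed
qed

text \<open>A class of explicit formulas that is closed under directional derivatives. Smoothness of
  all bump functions below then follows from a single induction on the order of
  differentiation.\<close>

inductive bump_algebra :: "('a::euclidean_space \<Rightarrow> real) \<Rightarrow> bool" where
  const: "bump_algebra (\<lambda>x. c)"
| inner: "bump_algebra (\<lambda>x. x \<bullet> v)"
| sq_norm: "bump_algebra (\<lambda>x. x \<bullet> x)"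
| add: "bump_algebra f \<Longrightarrow> bump_algebra g \<Longrightarrow> bump_algebra (\<lambda>x. f x + g x)"
| mult: "bump_algebra f \<Longrightarrow> bump_algebra g \<Longrightarrow> bump_algebra (\<lambda>x. f x * g x)"
| flat_exp: "bump_algebra f \<Longrightarrow> bump_algebra (\<lambda>x. flat_exp p (f x))"

text \<open>The derivative in a fixed direction \<open>h\<close>, as a function of the base point,
  is again in the class; this is the shape on which \<open>Ck_on\<close> recurses. The last case
  replaces the polynomial by another one, so the class must contain \<open>flat_exp p\<close> for
  every \<open>p\<close>.\<close>

lemma bump_algebra_derivative:
  "bump_algebra f \<Longrightarrow>
     \<exists>f'. (\<forall>x. (f has_derivative f' x) (at x)) \<and> (\<forall>h. bump_algebra (\<lambda>x. f' x h))"
proof (induction rule: bump_algebra.induct)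
  case (const c)
  show ?case
    by (rule exI[of _ "\<lambda>x h. 0"]) (auto intro: bump_algebra.intros)
next
  case (inner v)
  show ?case
    by (rule exI[of _ "\<lambda>x h. h \<bullet> v"])
      (auto intro!: bump_algebra.intros derivative_eq_intros)
next
  case sq_norm
  have "bump_algebra (\<lambda>x::'a. x \<bullet> h + x \<bullet> h)" for h
    by (intro bump_algebra.intros)
  then show ?case
    by (intro exI[of _ "\<lambda>x h. x \<bullet> h + x \<bullet> h"])
      (auto intro!: derivative_eq_intros simp: inner_commute)
next
  case (add f g)
  then obtain f' g' where *: "\<forall>x. (f has_derivative f' x) (at x)" "\<forall>h. bump_algebra (\<lambda>x. f' x h)"
    "\<forall>x. (g has_derivative g' x) (at x)" "\<forall>h. bump_algebra (\<lambda>x. g' x h)"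
    by blast
  then show ?case
    by (intro exI[of _ "\<lambda>x h. f' x h + g' x h"])
      (auto intro!: bump_algebra.intros has_derivative_add)
next
  case (mult f g)
  then obtain f' g' where *: "\<forall>x. (f has_derivative f' x) (at x)" "\<forall>h. bump_algebra (\<lambda>x. f' x h)"
    "\<forall>x. (g has_derivative g' x) (at x)" "\<forall>h. bump_algebra (\<lambda>x. g' x h)"
    by blast
  with mult show ?case
    by (intro exI[of _ "\<lambda>x h. f x * g' x h + f' x h * g x"])
      (auto intro!: bump_algebra.intros has_derivative_mult)
next
  case (flat_exp f p)
  then obtain f' where *: "\<forall>x. (f has_derivative f' x) (at x)" "\<forall>h. bump_algebra (\<lambda>x. f' x h)"
    by blast
  let ?q = "monom 1 2 * (p - pderiv p)"
  have "((\<lambda>x. flat_exp p (f x)) has_derivative (\<lambda>h. flat_exp ?q (f x) * f' x h)) (at x)" for x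
    using has_derivative_compose[OF *(1)[rule_format] flat_exp_has_derivative[unfolded has_field_derivative_def]]
    by simp
  with * flat_exp show ?case
    by (intro exI[of _ "\<lambda>x h. flat_exp ?q (f x) * f' x h"])
      (auto intro!: bump_algebra.intros)
qed

lemma bump_algebra_smooth: 
  assumes "bump_algebra f" shows "smooth_on UNIV f"
proof -
  have "Ck_on k UNIV f" for k
    using assms
  proof (induction k arbitrary: f)
    case 0
    then show ?case
      using bump_algebra_derivative[OF 0]
      by (auto intro: has_derivative_continuous continuous_at_imp_continuous_on)
  next
    case (Suc k)
    then obtain f' where *: "\<forall>x. (f has_derivative f' x) (at x)" "\<forall>h. bump_algebra (\<lambda>x. f' x h)"
      using bump_algebra_derivative by blast
    then have "frechet_derivative f (at x) = f' x" for x
      by (metis frechet_derivative_at)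
    with * Suc.IH show ?case
      by (auto simp: differentiable_def)
  qed
  then show ?thesis
    by (simp add: smooth_on_def)
qed

lemma bump_algebra_continuous: "bump_algebra f \<Longrightarrow> continuous_on T f"
  using bump_algebra_smooth[of f] Ck_on.simps(1)[of UNIV f] continuous_on_subset[of UNIV f T]
  by (simp add: smooth_on_def)

lemma flat_exp_1: "flat_exp 1 x = (if x > 0 then exp (- (1/x)) else 0)"
  by (simp add: flat_exp_def)

lemma flat_exp_1_nonneg: "0 \<le> flat_exp 1 x" and flat_exp_1_le: "flat_exp 1 x \<le> 1"
  and flat_exp_1_eq_0_iff: "flat_exp 1 x = 0 \<longleftrightarrow> x \<le> 0"
  by (auto simp: flat_exp_1)

text \<open>For positive \<open>e\<close> it is nonzero exactly on the open ball. It is left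
  unnormalised: its mass does not depend on the centre and cancels in the final estimate.\<close>

definition ball_bump :: "'a::euclidean_space \<Rightarrow> real \<Rightarrow> 'a \<Rightarrow> real" where
  "ball_bump c e x = flat_exp 1 (e\<^sup>2 - (x - c) \<bullet> (x - c))"

lemma ball_bump_bump_algebra: "bump_algebra (ball_bump c e)"
proof -
  have "bump_algebra (\<lambda>x. flat_exp 1 ((- 1) * (x \<bullet> x) + (x \<bullet> (2 *\<^sub>R c) + (e\<^sup>2 - c \<bullet> c))))"
    by (intro bump_algebra.intros)
  moreover have "ball_bump c e = (\<lambda>x. flat_exp 1 ((- 1) * (x \<bullet> x) + (x \<bullet> (2 *\<^sub>R c) + (e\<^sup>2 - c \<bullet> c))))"
    unfolding ball_bump_def by (rule ext, rule arg_cong[where f = "flat_exp 1"])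
      (simp add: inner_diff inner_commute)
  ultimately show ?thesis by simp
qed

lemma ball_bump_nonneg: "0 \<le> ball_bump c e x" and ball_bump_le: "ball_bump c e x \<le> 1"
  by (simp_all add: ball_bump_def flat_exp_1_nonneg flat_exp_1_le)

lemma ball_bump_eq_0_iff: "e > 0 \<Longrightarrow> ball_bump c e x = 0 \<longleftrightarrow> x \<notin> ball c e"
  using abs_le_square_iff[of e "norm (x - c)"]
  by (simp add: ball_bump_def flat_exp_1_eq_0_iff power2_norm_eq_inner[symmetric] dist_norm
      norm_minus_commute[of c] not_less)

lemma ball_bump_support: "e > 0 \<Longrightarrow> {x. ball_bump c e x \<noteq> 0} = ball c e"
  by (auto simp: ball_bump_eq_0_iff)

lemma Ck_on_add: "Ck_on k UNIV f \<Longrightarrow> Ck_on k UNIV g \<Longrightarrow> Ck_on k UNIV (\<lambda>x. f x + g x)"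
proof (induction k arbitrary: f g)
  case (Suc k)
  then have *: "frechet_derivative (\<lambda>x. f x + g x) (at x) =
      (\<lambda>h. frechet_derivative f (at x) h + frechet_derivative g (at x) h)" for x
    by (intro frechet_derivative_at[symmetric] has_derivative_add)
      (auto simp: frechet_derivative_works[symmetric])
  show ?case
    using Suc by (auto simp: * intro: differentiable_add)
qed (auto intro: continuous_on_add)

lemma Ck_on_cmult: "Ck_on k UNIV f \<Longrightarrow> Ck_on k UNIV (\<lambda>x. c * f x)"
proof (induction k arbitrary: f)
  case (Suc k)
  then have *: "frechet_derivative (\<lambda>x. c * f x) (at x) = (\<lambda>h. c * frechet_derivative f (at x) h)" for x
    by (intro frechet_derivative_at[symmetric] has_derivative_mult_right)
      (auto simp: frechet_derivative_works[symmetric])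
  show ?case
    using Suc by (auto simp: * intro: differentiable_mult)
qed (auto intro: continuous_on_mult_left)

lemma test_function_add:
  assumes "test_function S f" "test_function S g"
  shows "test_function S (\<lambda>x. f x + g x)"
proof -
  let ?F = "closure {x. f x \<noteq> 0}" and ?G = "closure {x. g x \<noteq> 0}"
  have "closure {x. f x + g x \<noteq> 0} \<subseteq> ?F \<union> ?G"
    unfolding closure_Un[symmetric] by (rule closure_mono) auto
  moreover have "compact (?F \<union> ?G)" "?F \<union> ?G \<subseteq> S"
    using assms by (auto simp: test_function_def)
  ultimately have "compact (closure {x. f x + g x \<noteq> 0})" "closure {x. f x + g x \<noteq> 0} \<subseteq> S"
    by (meson bounded_subset closed_closure compact_eq_bounded_closed subset_trans)+
  with assms show ?thesis
    by (auto simp: test_function_def smooth_on_def intro: Ck_on_add)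
qed

lemma test_function_cmult:
  assumes "test_function S f" shows "test_function S (\<lambda>x. c * f x)"
proof -
  have "closure {x. c * f x \<noteq> 0} \<subseteq> closure {x. f x \<noteq> 0}"
    by (rule closure_mono) auto
  with assms show ?thesis
    unfolding test_function_def smooth_on_def
    by (metis Ck_on_cmult bounded_closure_image bounded_subset closed_closure compact_eq_bounded_closed subset_trans)
qed

section \<open>The fundamental lemma of the calculus of variations\<close>

text \<open>Moves an integral between \<open>S\<close>, a compact subset and the whole space when
  the integrand vanishes off the smaller set.\<close>

lemma integral_lebesgue_on_support_cong:
  fixes f g :: "'a::euclidean_space \<Rightarrow> real"
  assumes "S \<in> sets lebesgue" "T \<in> sets lebesgue"
    and "\<And>x. (if x \<in> S then f x else 0) = (if x \<in> T then g x else 0)"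
  shows "integral\<^sup>L (lebesgue_on S) f = integral\<^sup>L (lebesgue_on T) g"
  using assms by (simp flip: Lebesgue_Measure.integral_restrict_UNIV)

lemma integrable_lebesgue_on_support_cong:
  fixes f g :: "'a::euclidean_space \<Rightarrow> real"
  assumes "S \<in> sets lebesgue" "T \<in> sets lebesgue"
    and "\<And>x. (if x \<in> S then f x else 0) = (if x \<in> T then g x else 0)"
  shows "integrable (lebesgue_on S) f \<longleftrightarrow> integrable (lebesgue_on T) g"
  using assms by (simp flip: Lebesgue_Measure.integrable_restrict_UNIV)

text \<open>The functions \<open>flat_exp 1\<close> of (m+1) \<theta> are test functions with values
  in [0,1]. They stay 0 where \<theta> is 0 and tend to 1 where \<theta> is positive. Dominated
  convergence takes place on \<open>K\<close>, because a locally integrable \<open>g\<close> need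
  not be integrable on \<open>S\<close>.\<close>

lemma integral_bump_support_nonneg:
  fixes g :: "real^'n::finite \<Rightarrow> real"
  assumes "open S" "locally_integrable S g"
    and pos: "\<And>\<phi>. test_function S \<phi> \<Longrightarrow> (\<And>x. 0 \<le> \<phi> x) \<Longrightarrow> 0 \<le> (\<integral>x. g x * \<phi> x \<partial>lebesgue_on S)"
    and "compact K" "K \<subseteq> S" "bump_algebra \<theta>" "\<And>x. 0 \<le> \<theta> x" "{x. \<theta> x \<noteq> 0} \<subseteq> K"
  shows "0 \<le> (\<integral>x. g x * indicator {x. \<theta> x \<noteq> 0} x \<partial>lebesgue_on K)"
proof -
  have meas: "S \<in> sets lebesgue" "K \<in> sets lebesgue"
    using assms by (auto simp: lmeasurable_compact fmeasurableD)
  have gK: "integrable (lebesgue_on K) g"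
    using assms by (auto simp: locally_integrable_def)
  have cont: "continuous_on UNIV \<theta>"
    by (rule bump_algebra_continuous[OF \<open>bump_algebra \<theta>\<close>])
  define \<phi> where "\<phi> m x = flat_exp 1 (real (Suc m) * \<theta> x)" for m x
  have bump: "bump_algebra (\<phi> m)" for m
    unfolding \<phi>_def by (intro bump_algebra.intros assms)
  have supp: "\<phi> m x \<noteq> 0 \<longleftrightarrow> \<theta> x \<noteq> 0" for m x
    using \<open>0 \<le> \<theta> x\<close> by (auto simp: \<phi>_def flat_exp_1_eq_0_iff mult_le_0_iff)
  have sub: "closure {x. \<theta> x \<noteq> 0} \<subseteq> K"
    using assms by (simp add: closure_minimal compact_imp_closed)
  have test: "test_function S (\<phi> m)" for m
    unfolding test_function_def using bump_algebra_smooth[OF bump] sub assms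
    by (auto simp: supp compact_closure intro: bounded_subset[OF compact_imp_bounded])
  have bound: "0 \<le> \<phi> m x" "\<phi> m x \<le> 1" for m x
    by (simp_all add: \<phi>_def flat_exp_1_nonneg flat_exp_1_le)
  have le: "0 \<le> (\<integral>x. g x * \<phi> m x \<partial>lebesgue_on K)" for m
  proof -
    have "(\<integral>x. g x * \<phi> m x \<partial>lebesgue_on S) = (\<integral>x. g x * \<phi> m x \<partial>lebesgue_on K)"
      using meas assms supp by (intro integral_lebesgue_on_support_cong) auto
    with pos[OF test[of m] bound(1)] show ?thesis by simp
  qed
  have lim: "(\<lambda>m. \<phi> m x) \<longlonglongrightarrow> indicator {x. \<theta> x \<noteq> 0} x" for x
  proof (cases "\<theta> x = 0")
    case True
    then show ?thesis by (simp add: \<phi>_def flat_exp_1)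
  next
    case False
    then have pos': "\<theta> x > 0" using \<open>0 \<le> \<theta> x\<close> by simp
    have "(\<lambda>m. inverse (real (Suc m)) * (1 / \<theta> x)) \<longlonglongrightarrow> 0 * (1 / \<theta> x)"
      by (intro tendsto_mult tendsto_const LIMSEQ_inverse_real_of_nat)
    then have "(\<lambda>m. exp (- (inverse (real (Suc m)) * (1 / \<theta> x)))) \<longlonglongrightarrow> exp (- (0 * (1 / \<theta> x)))"
      by (intro tendsto_exp tendsto_minus)
    moreover have "\<phi> m x = exp (- (inverse (real (Suc m)) * (1 / \<theta> x)))" for m
      using pos' by (simp add: \<phi>_def flat_exp_1 zero_less_mult_iff divide_inverse mult.commute)
    ultimately show ?thesis
      using False by simp
  qed
  have meas\<phi>: "\<phi> m \<in> borel_measurable (lebesgue_on K)" for m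
  proof -
    have "continuous_on UNIV (\<phi> m)"
      by (rule bump_algebra_continuous[OF bump])
    then show ?thesis
      by (meson continuous_imp_measurable_on_sets_lebesgue continuous_on_subset meas(2) subset_UNIV)
  qed
  have indmeas: "{x. \<theta> x \<noteq> 0} \<in> sets lebesgue"
    using open_Collect_neq[OF cont continuous_on_const[of UNIV 0]] by simp
  have "(\<lambda>m. \<integral>x. g x * \<phi> m x \<partial>lebesgue_on K) \<longlonglongrightarrow>
      (\<integral>x. g x * indicator {x. \<theta> x \<noteq> 0} x \<partial>lebesgue_on K)"
  proof (rule integral_dominated_convergence)
    have "indicat_real {x. \<theta> x \<noteq> 0} \<in> borel_measurable (lebesgue_on K)"
      using indmeas borel_measurable_indicator measurable_restrict_space1 by blast
    then show "(\<lambda>x. g x * indicator {x. \<theta> x \<noteq> 0} x) \<in> borel_measurable (lebesgue_on K)"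
      using gK by (intro borel_measurable_times) auto
    show "(\<lambda>x. g x * \<phi> m x) \<in> borel_measurable (lebesgue_on K)" for m
      using gK meas\<phi> by (intro borel_measurable_times) auto
    show "integrable (lebesgue_on K) (\<lambda>x. \<bar>g x\<bar>)"
      using gK by (rule integrable_abs)
    show "AE x in lebesgue_on K. norm (g x * \<phi> m x) \<le> \<bar>g x\<bar>" for m
      using bound by (intro AE_I2) (simp add: abs_mult mult_left_le)
    show "AE x in lebesgue_on K. (\<lambda>m. g x * \<phi> m x) \<longlonglongrightarrow> g x * indicator {x. \<theta> x \<noteq> 0} x"
      by (rule AE_I2, rule tendsto_mult_left, rule lim)
  qed
  then show ?thesis
    using le by (intro LIMSEQ_le_const) auto
qed

text \<open>By compactness \<open>K\<close> has arbitrarily thin neighbourhoods that are finite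
  unions of balls, and such a union is exactly the set where a sum of bumps is nonzero. The
  indicators of these sets converge pointwise to that of \<open>K\<close>, since \<open>K\<close> is
  closed.\<close>

lemma integral_compact_nonneg:
  fixes g :: "real^'n::finite \<Rightarrow> real"
  assumes "open S" "locally_integrable S g"
    and pos: "\<And>\<phi>. test_function S \<phi> \<Longrightarrow> (\<And>x. 0 \<le> \<phi> x) \<Longrightarrow> 0 \<le> (\<integral>x. g x * \<phi> x \<partial>lebesgue_on S)"
    and K: "compact K" "K \<subseteq> S"
  shows "0 \<le> integral\<^sup>L (lebesgue_on K) g"
proof (cases "K = {}")
  case False
  obtain d where d: "d > 0" "{x. infdist x K \<le> d} \<subseteq> S"
    using compact_in_open_separated[OF False \<open>compact K\<close> \<open>open S\<close> \<open>K \<subseteq> S\<close>] by metis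
  define C where "C = {x. infdist x K \<le> d}"
  have "compact C"
    unfolding C_def using compact_infdist_le[OF False \<open>compact K\<close> \<open>d > 0\<close>] .
  have "K \<subseteq> C"
    using d by (auto simp: C_def)
  have meas: "S \<in> sets lebesgue" "K \<in> sets lebesgue" "C \<in> sets lebesgue"
    using assms \<open>compact C\<close> by (auto simp: lmeasurable_compact fmeasurableD)
  have gC: "integrable (lebesgue_on C) g"
    using assms \<open>compact C\<close> d by (auto simp: locally_integrable_def C_def)
  \<comment> \<open>The radii never exceed \<open>d\<close>, so all the neighbourhoods lie in the
    one compact set \<open>C\<close>, where the absolute value of \<open>g\<close> is an integrable
    majorant.\<close>
  define e where "e n = d / real (Suc n)" for n
  have e: "0 < e n" "e n \<le> d" for n
    using d by (auto simp: e_def field_simps)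
  have "\<exists>F. finite F \<and> F \<subseteq> K \<and> K \<subseteq> (\<Union>c\<in>F. ball c (e n))" for n
    using compactE_image[OF \<open>compact K\<close>, of K "\<lambda>c. ball c (e n)"] e
    by (metis UN_I centre_in_ball open_ball subsetI)
  then obtain F where F: "finite (F n)" "F n \<subseteq> K" "K \<subseteq> (\<Union>c\<in>F n. ball c (e n))" for n
    by metis
  define \<theta> where "\<theta> n x = (\<Sum>c\<in>F n. ball_bump c (e n) x)" for n and x :: "real^'n"
  have bump: "bump_algebra (\<theta> n)" for n
    unfolding \<theta>_def using F(1)
    by (induction rule: finite_induct)
      (auto intro: bump_algebra.intros ball_bump_bump_algebra)
  have nonneg: "0 \<le> \<theta> n x" for n x
    by (auto simp: \<theta>_def ball_bump_nonneg sum_nonneg)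
  have supp: "{x. \<theta> n x \<noteq> 0} = (\<Union>c\<in>F n. ball c (e n))" for n
    using F(1) e by (auto simp: \<theta>_def sum_nonneg_eq_0_iff ball_bump_nonneg ball_bump_eq_0_iff)
  have near: "infdist x K < e n" if "\<theta> n x \<noteq> 0" for n x
  proof -
    have "x \<in> (\<Union>c\<in>F n. ball c (e n))"
      using that unfolding supp[symmetric] by simp
    then obtain c where "c \<in> F n" "dist c x < e n"
      by auto
    then show ?thesis
      using F(2)[of n] infdist_le[of c K x] by (auto simp: dist_commute)
  qed
  have sub: "{x. \<theta> n x \<noteq> 0} \<subseteq> C" for n
  proof
    fix x assume "x \<in> {x. \<theta> n x \<noteq> 0}"
    then show "x \<in> C"
      using near[of n x] e(2)[of n] by (simp add: C_def)
  qed
  have le: "0 \<le> (\<integral>x. g x * indicator {x. \<theta> n x \<noteq> 0} x \<partial>lebesgue_on C)" for n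
    using integral_bump_support_nonneg[OF assms(1,2) pos \<open>compact C\<close> _ bump nonneg sub] d
    by (auto simp: C_def)
  have "e \<longlonglongrightarrow> 0"
    unfolding e_def using tendsto_mult[OF tendsto_const[of d] LIMSEQ_inverse_real_of_nat]
    by (simp add: divide_inverse)
  have lim: "(\<lambda>n. indicator {x. \<theta> n x \<noteq> 0} x :: real) \<longlonglongrightarrow> indicator K x" for x
  proof (cases "x \<in> K")
    case True
    then have "\<theta> n x \<noteq> 0" for n
      using F(3)[of n] supp[of n] by blast
    then show ?thesis using True by simp
  next
    case False
    then have "infdist x K > 0"
      using \<open>K \<noteq> {}\<close> K in_closed_iff_infdist_zero[of K x] infdist_nonneg[of x K]
      by (auto simp: compact_imp_closed less_le)
    then have "\<forall>\<^sub>F n in sequentially. e n < infdist x K"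
      using \<open>e \<longlonglongrightarrow> 0\<close> by (intro order_tendstoD(2))
    then have "\<forall>\<^sub>F n in sequentially. indicator {x. \<theta> n x \<noteq> 0} x = (0::real)"
    proof eventually_elim
      case (elim n)
      then show ?case
        using near[of n x] by (auto simp: indicator_def)
    qed
    then show ?thesis
      using False by (simp add: tendsto_eventually)
  qed
  have meas_ind: "indicat_real A \<in> borel_measurable (lebesgue_on C)" if "A \<in> sets lebesgue" for A :: "(real^'n) set"
    using that borel_measurable_indicator measurable_restrict_space1 by blast
  have "(\<lambda>n. \<integral>x. g x * indicator {x. \<theta> n x \<noteq> 0} x \<partial>lebesgue_on C) \<longlonglongrightarrow>
      (\<integral>x. g x * indicator K x \<partial>lebesgue_on C)"
  proof (rule integral_dominated_convergence)
    show "(\<lambda>x. g x * indicator K x) \<in> borel_measurable (lebesgue_on C)"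
      using gC by (intro borel_measurable_times meas_ind meas) auto
    have "open {x. \<theta> n x \<noteq> 0}" for n
      unfolding supp by (intro open_UN ballI open_ball)
    then have "{x. \<theta> n x \<noteq> 0} \<in> sets lebesgue" for n
      by simp
    then show "(\<lambda>x. g x * indicator {x. \<theta> n x \<noteq> 0} x) \<in> borel_measurable (lebesgue_on C)" for n
      using gC by (intro borel_measurable_times meas_ind) auto
    show "integrable (lebesgue_on C) (\<lambda>x. \<bar>g x\<bar>)"
      using gC by (rule integrable_abs)
    show "AE x in lebesgue_on C. norm (g x * indicator {x. \<theta> n x \<noteq> 0} x) \<le> \<bar>g x\<bar>" for n
      by (rule AE_I2) (simp add: indicator_def)
    show "AE x in lebesgue_on C. (\<lambda>n. g x * indicator {x. \<theta> n x \<noteq> 0} x) \<longlonglongrightarrow> g x * indicator K x"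
      by (rule AE_I2, rule tendsto_mult_left, rule lim)
  qed
  then have "0 \<le> (\<integral>x. g x * indicator K x \<partial>lebesgue_on C)"
    using le by (intro LIMSEQ_le_const) auto
  also have "\<dots> = integral\<^sup>L (lebesgue_on K) g"
    using meas \<open>K \<subseteq> C\<close> by (intro integral_lebesgue_on_support_cong) (auto simp: indicator_def)
  finally show ?thesis .
next
  case True
  then show ?thesis
    using Lebesgue_Measure.integral_restrict_UNIV[of "{}" g] by simp
qed

text \<open>On a compact subset of the set where \<open>g\<close> is negative the integral of
  \<open>g\<close> is both nonnegative and nonpositive, so that subset is null. Inner regularity
  extends this to the whole negativity set inside a compact \<open>K\<close>, and countably many
  compact sets exhaust \<open>S\<close>.\<close>

lemma AE_nonneg_if_test_integrals_nonneg:
  fixes g :: "real^'n::finite \<Rightarrow> real"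
  assumes "open S" and g: "locally_integrable S g"
    and pos: "\<And>\<phi>. test_function S \<phi> \<Longrightarrow> (\<And>x. 0 \<le> \<phi> x) \<Longrightarrow> 0 \<le> (\<integral>x. g x * \<phi> x \<partial>lebesgue_on S)"
  shows "AE x in lebesgue_on S. 0 \<le> g x"
proof -
  have null: "{x\<in>K. g x < 0} \<in> null_sets lebesgue" if K: "compact K" "K \<subseteq> S" for K
  proof -
    define A where "A = {x\<in>K. g x < 0}"
    have gK: "integrable (lebesgue_on K) g"
      using K g by (simp add: locally_integrable_def)
    then have "{x \<in> space (lebesgue_on K). g x < 0} \<in> sets (lebesgue_on K)"
      by measurable
    moreover have Km: "K \<in> sets lebesgue"
      using K by (simp add: lmeasurable_compact fmeasurableD)
    ultimately have A: "A \<in> sets lebesgue"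
      by (simp add: A_def sets_restrict_space_iff)
    have small: "emeasure lebesgue A \<le> ennreal e" if "e > 0" for e
    proof -
      obtain T where T: "closed T" "T \<subseteq> A" "A - T \<in> lmeasurable" "emeasure lebesgue (A - T) < ennreal e"
        using sets_lebesgue_inner_closed[OF A \<open>e > 0\<close>] by blast
      have "T \<subseteq> K"
        using T by (auto simp: A_def)
      then have cT: "compact T"
        using K T by (meson closed_subset compact_eq_bounded_closed bounded_subset)
      then have Tm: "T \<in> sets lebesgue"
        by (simp add: lmeasurable_compact fmeasurableD)
      have gT: "integrable (lebesgue_on T) g"
        using cT \<open>T \<subseteq> K\<close> K g by (auto simp: locally_integrable_def)
      have "0 \<le> integral\<^sup>L (lebesgue_on T) g"
        using integral_compact_nonneg[OF assms(1,2) pos cT] \<open>T \<subseteq> K\<close> K by blast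
      moreover have "AE x in lebesgue_on T. 0 \<le> - g x"
        using T by (intro AE_I2) (auto simp: A_def)
      ultimately have "integral\<^sup>L (lebesgue_on T) (\<lambda>x. - g x) = 0"
        using gT integral_nonneg_AE[where M = "lebesgue_on T" and f = "\<lambda>x. - g x"] by simp
      then have "AE x in lebesgue_on T. - g x = 0"
        using integral_nonneg_eq_0_iff_AE[where M = "lebesgue_on T" and f = "\<lambda>x. - g x"] gT
          \<open>AE x in lebesgue_on T. 0 \<le> - g x\<close> by simp
      then have "AE x in lebesgue. x \<in> T \<longrightarrow> g x = 0"
        using Tm by (simp add: AE_restrict_space_iff)
      then have "AE x in lebesgue. x \<notin> T"
        by eventually_elim (use T in \<open>auto simp: A_def\<close>)
      then have "T \<in> null_sets lebesgue"
        using Tm by (simp add: AE_iff_null)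
      then have "emeasure lebesgue A = emeasure lebesgue (A - T)"
        by (simp add: A emeasure_Diff_null_set)
      with T show ?thesis by simp
    qed
    have "emeasure lebesgue A = 0"
      using small ennreal_le_epsilon[of 0 "emeasure lebesgue A"] by simp
    with A show ?thesis by (auto simp: A_def)
  qed
  obtain C :: "nat \<Rightarrow> (real^'n) set" where C: "\<And>n. compact (C n)" "\<And>n. C n \<subseteq> S" "\<Union>(range C) = S"
    using open_Union_compact_subsets[OF \<open>open S\<close>] by metis
  have "(\<Union>n. {x\<in>C n. g x < 0}) \<in> null_sets lebesgue"
    by (intro null_sets_UN null C)
  moreover have "{x. \<not> (x \<in> S \<longrightarrow> 0 \<le> g x)} \<subseteq> (\<Union>n. {x\<in>C n. g x < 0})"
    using C(3) by (auto simp: not_le)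
  ultimately have "AE x in lebesgue. x \<in> S \<longrightarrow> 0 \<le> g x"
    by (intro AE_I') auto
  then show ?thesis
    using \<open>open S\<close> by (simp add: AE_restrict_space_iff)
qed

lemma locally_integrable_add:
  "locally_integrable S f \<Longrightarrow> locally_integrable S g \<Longrightarrow> locally_integrable S (\<lambda>x. f x + g x)"
  and locally_integrable_cmult: "locally_integrable S f \<Longrightarrow> locally_integrable S (\<lambda>x. c * f x)"
  by (simp_all add: locally_integrable_def)

section \<open>Regularity and support of test functions\<close>

lemma test_function_Ck_on: "test_function S \<phi> \<Longrightarrow> Ck_on k UNIV \<phi>"
  by (simp add: test_function_def smooth_on_def)

lemma test_function_continuous: "test_function S \<phi> \<Longrightarrow> continuous_on UNIV \<phi>"
  using test_function_Ck_on[of S \<phi> 0] by simp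

lemma test_function_has_derivative:
  "test_function S \<phi> \<Longrightarrow> (\<phi> has_derivative frechet_derivative \<phi> (at x)) (at x)"
  using test_function_Ck_on[of S \<phi> "Suc 0"] by (simp add: frechet_derivative_works[symmetric])

lemma test_function_derivative_continuous:
  "test_function S \<phi> \<Longrightarrow> b \<in> Basis \<Longrightarrow> continuous_on UNIV (\<lambda>x. frechet_derivative \<phi> (at x) b)"
  using test_function_Ck_on[of S \<phi> "Suc 0"] by simp

lemma test_function_eq_0:
  "x \<notin> closure {x. \<phi> x \<noteq> 0} \<Longrightarrow> \<phi> x = 0"
  using closure_subset[of "{x. \<phi> x \<noteq> 0}"] by blast

lemma test_function_derivative_eq_0:
  assumes "x \<notin> closure {x. \<phi> x \<noteq> 0}"
  shows "frechet_derivative \<phi> (at x) h = 0"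
proof -
  let ?U = "- closure {x. \<phi> x \<noteq> 0}"
  have "(\<phi> has_derivative (\<lambda>h. 0)) (at x)"
  proof (rule has_derivative_transform_within_open[where f = "\<lambda>x. 0" and s = ?U])
    show "0 = \<phi> y" if "y \<in> ?U" for y
      using that test_function_eq_0[of y \<phi>] by simp
  qed (use assms in auto)
  from frechet_derivative_at[OF this] show ?thesis
    by metis
qed

section \<open>The space \<open>L\<^sup>2(S)\<close>\<close>

text \<open>Rests on the completeness of Lebesgue measure. It gives measurability of arbitrarily
  chosen representatives, such as \<open>weak_partial\<close>, and of almost-everywhere
  limits.\<close>

lemma borel_measurable_AE_lebesgue_on:
  fixes f g :: "'a::euclidean_space \<Rightarrow> real"
  assumes S: "S \<in> sets lebesgue" and "f \<in> borel_measurable (lebesgue_on S)"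
    and "AE x in lebesgue_on S. f x = g x"
  shows "g \<in> borel_measurable (lebesgue_on S)"
proof -
  have "AE x in lebesgue. x \<in> S \<longrightarrow> f x = g x"
    using assms by (simp add: AE_restrict_space_iff)
  then have "AE x in lebesgue. (if x \<in> S then f x else 0) = (if x \<in> S then g x else 0)"
    by eventually_elim simp
  with assms(2) show ?thesis
    unfolding borel_measurable_if[OF S, symmetric] by (rule borel_measurable_AE)
qed

lemma L2_measurable: "u \<in> L2 S \<Longrightarrow> u \<in> borel_measurable (lebesgue_on S)"
  and L2_square_integrable: "u \<in> L2 S \<Longrightarrow> integrable (lebesgue_on S) (\<lambda>x. (u x)\<^sup>2)"
  by (simp_all add: L2_def)

lemma L2_mult_integrable:
  assumes "u \<in> L2 S" "v \<in> L2 S"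
  shows "integrable (lebesgue_on S) (\<lambda>x. u x * v x)"
proof (rule Bochner_Integration.integrable_bound)
  show "integrable (lebesgue_on S) (\<lambda>x. (u x)\<^sup>2 + (v x)\<^sup>2)"
    using assms by (intro Bochner_Integration.integrable_add L2_square_integrable)
  show "(\<lambda>x. u x * v x) \<in> borel_measurable (lebesgue_on S)"
    using assms by (intro borel_measurable_times L2_measurable)
  have "\<bar>a * b\<bar> \<le> \<bar>a\<^sup>2 + b\<^sup>2\<bar>" for a b :: real
  proof -
    have "2 * \<bar>a * b\<bar> \<le> a\<^sup>2 + b\<^sup>2"
      using sum_squares_bound[of "\<bar>a\<bar>" "\<bar>b\<bar>"] by (simp add: abs_mult)
    then show ?thesis by linarith
  qed
  then show "AE x in lebesgue_on S. norm (u x * v x) \<le> norm ((u x)\<^sup>2 + (v x)\<^sup>2)"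
    by simp
qed

lemma L2_cmult: "u \<in> L2 S \<Longrightarrow> (\<lambda>x. c * u x) \<in> L2 S"
  unfolding L2_def by (auto simp: power_mult_distrib)

lemma L2_add:
  assumes "u \<in> L2 S" "v \<in> L2 S"
  shows "(\<lambda>x. u x + v x) \<in> L2 S"
proof -
  have "integrable (lebesgue_on S) (\<lambda>x. (u x)\<^sup>2 + (v x)\<^sup>2 + 2 * (u x * v x))"
    using assms by (intro Bochner_Integration.integrable_add integrable_mult_right
        L2_square_integrable L2_mult_integrable)
  then show ?thesis
    using assms unfolding L2_def by (auto simp: power2_sum mult.assoc)
qed

lemma L2_diff:
  assumes "u \<in> L2 S" "v \<in> L2 S"
  shows "(\<lambda>x. u x - v x) \<in> L2 S"
  using L2_add[OF assms(1) L2_cmult[OF assms(2), of "-1"]] by simp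

lemma L2_abs: "u \<in> L2 S \<Longrightarrow> (\<lambda>x. \<bar>u x\<bar>) \<in> L2 S"
  unfolding L2_def by auto

lemma L2_cong_AE:
  assumes "S \<in> sets lebesgue" "u \<in> L2 S" "AE x in lebesgue_on S. u x = v x"
  shows "v \<in> L2 S"
proof -
  have v: "v \<in> borel_measurable (lebesgue_on S)"
    using assms by (intro borel_measurable_AE_lebesgue_on[of S u v] L2_measurable)
  moreover have "integrable (lebesgue_on S) (\<lambda>x. (v x)\<^sup>2)"
    by (rule integrable_cong_AE_imp[OF L2_square_integrable[OF assms(2)]])
      (use v assms(3) in \<open>auto elim: eventually_mono\<close>)
  ultimately show ?thesis by (simp add: L2_def)
qed

lemma L2_norm_nonneg: "0 \<le> L2_norm S u"
  by (simp add: L2_norm_def)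

lemma L2_norm_power2: "(L2_norm S u)\<^sup>2 = (\<integral>x. (u x)\<^sup>2 \<partial>lebesgue_on S)"
  by (simp add: L2_norm_def)

lemma L2_norm_power2_inner: "(L2_norm S u)\<^sup>2 = L2_inner S u u"
  unfolding L2_norm_power2 by (simp add: L2_inner_def power2_eq_square)

lemma L2_inner_commute: "L2_inner S u v = L2_inner S v u"
  by (simp add: L2_inner_def mult.commute)

lemma L2_inner_add_left:
  "u \<in> L2 S \<Longrightarrow> v \<in> L2 S \<Longrightarrow> w \<in> L2 S \<Longrightarrow>
    L2_inner S (\<lambda>x. u x + v x) w = L2_inner S u w + L2_inner S v w"
  by (simp add: L2_inner_def distrib_right L2_mult_integrable)

lemma L2_inner_cmult_left: "L2_inner S (\<lambda>x. c * u x) w = c * L2_inner S u w"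
  by (simp add: L2_inner_def mult.assoc)

lemma L2_inner_diff_left:
  "u \<in> L2 S \<Longrightarrow> v \<in> L2 S \<Longrightarrow> w \<in> L2 S \<Longrightarrow>
    L2_inner S (\<lambda>x. u x - v x) w = L2_inner S u w - L2_inner S v w"
  by (simp add: L2_inner_def left_diff_distrib L2_mult_integrable)

lemma L2_inner_add_right:
  "u \<in> L2 S \<Longrightarrow> v \<in> L2 S \<Longrightarrow> w \<in> L2 S \<Longrightarrow>
    L2_inner S w (\<lambda>x. u x + v x) = L2_inner S w u + L2_inner S w v"
  by (simp add: L2_inner_def distrib_left L2_mult_integrable)

lemma L2_inner_cmult_right: "L2_inner S w (\<lambda>x. c * u x) = c * L2_inner S w u"
  using L2_inner_cmult_left[of S c u w] by (simp add: L2_inner_commute)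

lemma L2_inner_diff_right:
  "u \<in> L2 S \<Longrightarrow> v \<in> L2 S \<Longrightarrow> w \<in> L2 S \<Longrightarrow>
    L2_inner S w (\<lambda>x. u x - v x) = L2_inner S w u - L2_inner S w v"
  by (simp add: L2_inner_def right_diff_distrib L2_mult_integrable)

lemma L2_norm_cong_AE:
  assumes "S \<in> sets lebesgue" "u \<in> L2 S" "AE x in lebesgue_on S. u x = v x"
  shows "L2_norm S u = L2_norm S v"
proof -
  have "v \<in> L2 S"
    by (rule L2_cong_AE[OF assms])
  then have "(\<integral>x. (u x)\<^sup>2 \<partial>lebesgue_on S) = (\<integral>x. (v x)\<^sup>2 \<partial>lebesgue_on S)"
    using assms(2,3) L2_measurable[of u S] L2_measurable[of v S]
    by (intro integral_cong_AE) (auto elim: eventually_mono)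
  then show ?thesis by (simp add: L2_norm_def)
qed

lemma L2_norm_cmult: "L2_norm S (\<lambda>x. c * u x) = \<bar>c\<bar> * L2_norm S u"
  by (simp add: L2_norm_def power_mult_distrib real_sqrt_mult)

text \<open>Integrates Young's inequality with a weight \<open>t\<close> and optimises:
  \<open>t\<close> is the quotient of the two norms when both are positive. If one of them vanishes
  there is no optimal weight, and \<open>t\<close> is taken large or small enough to push the bound
  below any \<open>e\<close>.\<close>

lemma L2_Cauchy_Schwarz_abs:
  assumes "u \<in> L2 S" "v \<in> L2 S"
  shows "(\<integral>x. \<bar>u x * v x\<bar> \<partial>lebesgue_on S) \<le> L2_norm S u * L2_norm S v"
proof -
  let ?I = "\<integral>x. \<bar>u x * v x\<bar> \<partial>lebesgue_on S"
  have int: "integrable (lebesgue_on S) (\<lambda>x. \<bar>u x * v x\<bar>)"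
    using L2_mult_integrable[OF assms] by simp
  have young: "2 * ?I \<le> t * (L2_norm S u)\<^sup>2 + (L2_norm S v)\<^sup>2 / t" if "t > 0" for t
  proof -
    have "2 * \<bar>a * b\<bar> \<le> t * a\<^sup>2 + b\<^sup>2 / t" for a b :: real
    proof -
      have "0 \<le> (t * \<bar>a\<bar> - \<bar>b\<bar>)\<^sup>2 / t"
        using \<open>t > 0\<close> by simp
      also have "\<dots> = t * a\<^sup>2 + b\<^sup>2 / t - 2 * \<bar>a * b\<bar>"
        using \<open>t > 0\<close> by (simp add: power2_diff abs_mult field_simps power2_eq_square)
      finally show ?thesis by simp
    qed
    then have "(\<integral>x. 2 * \<bar>u x * v x\<bar> \<partial>lebesgue_on S) \<le> (\<integral>x. t * (u x)\<^sup>2 + (v x)\<^sup>2 / t \<partial>lebesgue_on S)"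
      using int assms
      by (intro integral_mono Bochner_Integration.integrable_add integrable_mult_right
          integrable_divide L2_square_integrable) auto
    then show ?thesis
      using assms by (simp add: L2_norm_power2 L2_square_integrable)
  qed
  show ?thesis
  proof (cases "L2_norm S u = 0 \<or> L2_norm S v = 0")
    case True
    have "?I \<le> 0"
    proof (rule field_le_epsilon)
      fix e :: real assume "e > 0"
      have aux: "n * e / (n + 1) \<le> e" if "n \<ge> 0" for n
        using that \<open>e > 0\<close> by (simp add: pos_divide_le_eq algebra_simps)
      show "?I \<le> 0 + e"
      proof (cases "L2_norm S u = 0")
        case True
        \<comment> \<open>With this weight the remaining term equals e n / (n + 1), where n is the
          squared norm of \<open>v\<close>. The added 1 keeps the weight positive when that norm
          vanishes as well.\<close>
        let ?t = "((L2_norm S v)\<^sup>2 + 1) / e"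
        have "?t > 0"
          using \<open>e > 0\<close> by (intro divide_pos_pos) (auto intro: add_nonneg_pos)
        from young[OF this] have "2 * ?I \<le> (L2_norm S v)\<^sup>2 / ?t"
          using True by simp
        also have "\<dots> \<le> e"
          using aux[OF zero_le_power2] by (simp add: mult.commute)
        finally show ?thesis
          using \<open>e > 0\<close> by simp
      next
        case False
        then have "L2_norm S v = 0"
          using True by simp
        let ?t = "e / ((L2_norm S u)\<^sup>2 + 1)"
        have "?t > 0"
          using \<open>e > 0\<close> by (intro divide_pos_pos) (auto intro: add_nonneg_pos)
        from young[OF this] have "2 * ?I \<le> ?t * (L2_norm S u)\<^sup>2"
          using \<open>L2_norm S v = 0\<close> by simp
        also have "\<dots> \<le> e"
          using aux[OF zero_le_power2] by (simp add: mult.commute)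
        finally show ?thesis
          using \<open>e > 0\<close> by simp
      qed
    qed
    then show ?thesis
      using L2_norm_nonneg[of S u] L2_norm_nonneg[of S v]
      by (metis mult_nonneg_nonneg order_trans)
  next
    case False
    then have "L2_norm S u > 0" "L2_norm S v > 0"
      using L2_norm_nonneg[of S u] L2_norm_nonneg[of S v] by auto
    then have "2 * ?I \<le> L2_norm S v / L2_norm S u * (L2_norm S u)\<^sup>2 + (L2_norm S v)\<^sup>2 / (L2_norm S v / L2_norm S u)"
      by (intro young) simp
    also have "\<dots> = 2 * (L2_norm S u * L2_norm S v)"
      using \<open>L2_norm S u > 0\<close> \<open>L2_norm S v > 0\<close> by (simp add: field_simps power2_eq_square)
    finally show ?thesis by simp
  qed
qed

text \<open>The estimate behind the continuity of every term of the HJB form. The coefficient is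
  bounded only almost everywhere because the weak derivatives of the diffusion matrix are.\<close>

lemma bounded_mult_L2_L2:
  assumes "u \<in> L2 S" "v \<in> L2 S" "c \<in> borel_measurable (lebesgue_on S)"
    and c: "AE x in lebesgue_on S. \<bar>c x\<bar> \<le> M" and "M \<ge> 0"
  shows "integrable (lebesgue_on S) (\<lambda>x. c x * u x * v x)"
    and "\<bar>\<integral>x. c x * u x * v x \<partial>lebesgue_on S\<bar> \<le> M * (L2_norm S u * L2_norm S v)"
proof -
  have int: "integrable (lebesgue_on S) (\<lambda>x. M * \<bar>u x * v x\<bar>)"
    using L2_mult_integrable[OF assms(1,2)] by simp
  have le: "AE x in lebesgue_on S. \<bar>c x * u x * v x\<bar> \<le> M * \<bar>u x * v x\<bar>"
    using c by eventually_elim (simp add: abs_mult mult.assoc mult_right_mono)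
  have meas: "(\<lambda>x. c x * u x * v x) \<in> borel_measurable (lebesgue_on S)"
    using assms(1,2) by (intro borel_measurable_times assms(3) L2_measurable)
  show *: "integrable (lebesgue_on S) (\<lambda>x. c x * u x * v x)"
    by (rule Bochner_Integration.integrable_bound[OF int meas]) (use le in \<open>auto elim: eventually_mono\<close>)
  have "\<bar>\<integral>x. c x * u x * v x \<partial>lebesgue_on S\<bar> \<le> (\<integral>x. \<bar>c x * u x * v x\<bar> \<partial>lebesgue_on S)"
    by (rule integral_abs_bound)
  also have "\<dots> \<le> (\<integral>x. M * \<bar>u x * v x\<bar> \<partial>lebesgue_on S)"
    by (rule integral_mono_AE) (use * int le in auto)
  also have "\<dots> \<le> M * (L2_norm S u * L2_norm S v)"
    using L2_Cauchy_Schwarz_abs[OF assms(1,2)] \<open>M \<ge> 0\<close> by (simp add: mult_left_mono)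
  finally show "\<bar>\<integral>x. c x * u x * v x \<partial>lebesgue_on S\<bar> \<le> M * (L2_norm S u * L2_norm S v)" .
qed

lemma L2_Cauchy_Schwarz:
  assumes "u \<in> L2 S" "v \<in> L2 S"
  shows "\<bar>L2_inner S u v\<bar> \<le> L2_norm S u * L2_norm S v"
  using bounded_mult_L2_L2(2)[OF assms, where c = "\<lambda>x. 1" and M = 1] by (simp add: L2_inner_def)

lemma L2_norm_triangle:
  assumes "u \<in> L2 S" "v \<in> L2 S"
  shows "L2_norm S (\<lambda>x. u x + v x) \<le> L2_norm S u + L2_norm S v"
proof (rule power2_le_imp_le)
  have "(L2_norm S (\<lambda>x. u x + v x))\<^sup>2 = (L2_norm S u)\<^sup>2 + 2 * L2_inner S u v + (L2_norm S v)\<^sup>2"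
    using assms
    by (simp add: L2_norm_power2_inner L2_inner_add_left L2_inner_add_right L2_add L2_inner_commute)
  also have "\<dots> \<le> (L2_norm S u + L2_norm S v)\<^sup>2"
    using L2_Cauchy_Schwarz[OF assms] by (simp add: power2_sum)
  finally show "(L2_norm S (\<lambda>x. u x + v x))\<^sup>2 \<le> (L2_norm S u + L2_norm S v)\<^sup>2" .
qed (simp add: L2_norm_nonneg)

text \<open>The Riesz--Fischer argument. Along a fast subsequence the increments are summable in L1,
  by Cauchy--Schwarz against the constant 1, which is square integrable by assumption. Hence the
  subsequence converges almost everywhere, and Fatou's lemma turns its pointwise limit into an L2
  limit of the whole sequence.\<close>

lemma L2_complete:
  assumes one: "(\<lambda>x. 1) \<in> L2 S" and u: "\<And>n. u n \<in> L2 S"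
    and Cauchy: "\<And>e. e > 0 \<Longrightarrow> \<exists>N. \<forall>m\<ge>N. \<forall>n\<ge>N. L2_norm S (\<lambda>x. u m x - u n x) \<le> e"
  obtains g where "g \<in> L2 S" "(\<lambda>n. L2_norm S (\<lambda>x. u n x - g x)) \<longlonglongrightarrow> 0"
proof -
  let ?M = "lebesgue_on S"
  have "\<exists>N. \<forall>m\<ge>N. \<forall>n\<ge>N. L2_norm S (\<lambda>x. u m x - u n x) \<le> (1/2) ^ k" for k
    by (rule Cauchy) simp
  then obtain N where N: "\<And>k m n. N k \<le> m \<Longrightarrow> N k \<le> n \<Longrightarrow> L2_norm S (\<lambda>x. u m x - u n x) \<le> (1/2) ^ k"
    by metis
  \<comment> \<open>A partial sum dominates each of its terms, so \<open>r k\<close> lies beyond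
    every \<open>N j\<close> with \<open>j\<close> at most \<open>k\<close>, although
    \<open>N\<close> need not be monotone.\<close>
  define r where "r k = (\<Sum>j\<le>k. N j)" for k
  have rN: "N j \<le> r k" if "j \<le> k" for j k
    unfolding r_def using that by (intro member_le_sum) auto
  define h where "h k x = \<bar>u (r (Suc k)) x - u (r k) x\<bar>" for k x
  have hL2: "h k \<in> L2 S" for k
    unfolding h_def by (intro L2_abs L2_diff u)
  have hint: "integrable ?M (h k)" for k
    using L2_mult_integrable[OF hL2 one] by simp
  have "integral\<^sup>L ?M (h k) \<le> (1/2) ^ k * L2_norm S (\<lambda>x. 1)" for k
  proof -
    have "integral\<^sup>L ?M (h k) \<le> L2_norm S (h k) * L2_norm S (\<lambda>x. 1)"
      using L2_Cauchy_Schwarz_abs[OF hL2[of k] one] by (simp add: h_def[abs_def])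
    also have "L2_norm S (h k) = L2_norm S (\<lambda>x. u (r (Suc k)) x - u (r k) x)"
      by (simp add: L2_norm_def h_def)
    also have "\<dots> \<le> (1/2) ^ k"
      by (rule N[OF rN rN]) auto
    finally show ?thesis
      by (simp add: L2_norm_nonneg mult_right_mono)
  qed
  then have hle: "(\<integral>\<^sup>+x. ennreal (h k x) \<partial>?M) \<le> ennreal ((1/2) ^ k * L2_norm S (\<lambda>x. 1))" for k
    using hint[of k] by (subst nn_integral_eq_integral) (auto simp: h_def intro: ennreal_leI)
  have geo: "(\<lambda>k. (1/2) ^ k * L2_norm S (\<lambda>x. 1)) sums (1 / (1 - 1/2) * L2_norm S (\<lambda>x. 1))"
    by (intro sums_mult2 geometric_sums) auto
  have "(\<integral>\<^sup>+x. (\<Sum>k. ennreal (h k x)) \<partial>?M) = (\<Sum>k. \<integral>\<^sup>+x. ennreal (h k x) \<partial>?M)"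
    using hint by (intro nn_integral_suminf) auto
  also have "\<dots> \<le> (\<Sum>k. ennreal ((1/2) ^ k * L2_norm S (\<lambda>x. 1)))"
    by (intro suminf_le hle) auto
  also have "\<dots> = ennreal (1 / (1 - 1/2) * L2_norm S (\<lambda>x. 1))"
    by (rule suminf_ennreal_eq[OF _ geo]) (simp add: L2_norm_nonneg)
  also have "\<dots> < \<infinity>" by simp
  finally have "AE x in ?M. (\<Sum>k. ennreal (h k x)) \<noteq> \<infinity>"
    using hint by (intro nn_integral_PInf_AE) auto
  then have conv: "AE x in ?M. (\<lambda>k. u (r k) x) \<longlonglongrightarrow> lim (\<lambda>k. u (r k) x)"
  proof eventually_elim
    case (elim x)
    then have "summable (\<lambda>k. h k x)"
      by (intro summable_suminf_not_top) (auto simp: h_def)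
    then have "summable (\<lambda>k. u (r (Suc k)) x - u (r k) x)"
      unfolding h_def by (rule summable_rabs_cancel)
    then have "(\<lambda>n. \<Sum>k<n. u (r (Suc k)) x - u (r k) x) \<longlonglongrightarrow> (\<Sum>k. u (r (Suc k)) x - u (r k) x)"
      by (rule summable_LIMSEQ)
    then have "(\<lambda>n. (\<Sum>k<n. u (r (Suc k)) x - u (r k) x) + u (r 0) x) \<longlonglongrightarrow>
        (\<Sum>k. u (r (Suc k)) x - u (r k) x) + u (r 0) x"
      by (intro tendsto_add tendsto_const)
    then have "convergent (\<lambda>n. u (r n) x)"
      using sum_lessThan_telescope[of "\<lambda>k. u (r k) x"] by (auto simp: convergent_def)
    then show ?case
      by (simp add: convergent_LIMSEQ_iff)
  qed
  define g where "g x = lim (\<lambda>k. u (r k) x)" for x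
  have gmeas: "g \<in> borel_measurable ?M"
    unfolding g_def using u by (intro borel_measurable_lim_metric L2_measurable)
  \<comment> \<open>Fatou's lemma in the index \<open>k\<close>, with \<open>m\<close> held fixed.
    It is stated for \<open>nn_integral\<close> because square integrability of the difference is
    only deduced from it afterwards.\<close>
  have bound: "(\<integral>\<^sup>+x. ennreal ((u m x - g x)\<^sup>2) \<partial>?M) \<le> ennreal (((1/2) ^ j)\<^sup>2)" if "N j \<le> m" for m j
  proof -
    have "(\<integral>\<^sup>+x. ennreal ((u m x - g x)\<^sup>2) \<partial>?M) = (\<integral>\<^sup>+x. liminf (\<lambda>k. ennreal ((u m x - u (r k) x)\<^sup>2)) \<partial>?M)"
    proof (rule nn_integral_cong_AE)
      show "AE x in ?M. ennreal ((u m x - g x)\<^sup>2) = liminf (\<lambda>k. ennreal ((u m x - u (r k) x)\<^sup>2))"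
        using conv
      proof eventually_elim
        case (elim x)
        then have "(\<lambda>k. ennreal ((u m x - u (r k) x)\<^sup>2)) \<longlonglongrightarrow> ennreal ((u m x - g x)\<^sup>2)"
          unfolding g_def by (intro tendsto_ennrealI tendsto_intros)
        then show ?case
          by (intro lim_imp_Liminf[symmetric]) auto
      qed
    qed
    also have "\<dots> \<le> liminf (\<lambda>k. \<integral>\<^sup>+x. ennreal ((u m x - u (r k) x)\<^sup>2) \<partial>?M)"
    proof (rule nn_integral_liminf)
      show "(\<lambda>x. ennreal ((u m x - u (r k) x)\<^sup>2)) \<in> borel_measurable ?M" for k
        using L2_measurable[OF L2_diff[OF u[of m] u[of "r k"]]] by simp
    qed
    also have "\<dots> \<le> ennreal (((1/2) ^ j)\<^sup>2)"
    proof (rule Liminf_le)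
      show "\<forall>\<^sub>F k in sequentially. (\<integral>\<^sup>+x. ennreal ((u m x - u (r k) x)\<^sup>2) \<partial>?M) \<le> ennreal (((1/2) ^ j)\<^sup>2)"
        using eventually_ge_at_top[of j]
      proof eventually_elim
        case (elim k)
        have "(\<integral>\<^sup>+x. ennreal ((u m x - u (r k) x)\<^sup>2) \<partial>?M) = ennreal ((L2_norm S (\<lambda>x. u m x - u (r k) x))\<^sup>2)"
          unfolding L2_norm_power2
          by (rule nn_integral_eq_integral) (auto intro: L2_square_integrable[OF L2_diff[OF u u]])
        also have "\<dots> \<le> ennreal (((1/2) ^ j)\<^sup>2)"
          using N[OF that rN[OF elim]] by (intro ennreal_leI power_mono L2_norm_nonneg) auto
        finally show ?case .
      qed
    qed simp
    finally show ?thesis .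
  qed
  have diff: "(\<lambda>x. u m x - g x) \<in> L2 S" if "N j \<le> m" for m j
  proof -
    have meas: "(\<lambda>x. u m x - g x) \<in> borel_measurable ?M"
      by (intro borel_measurable_diff gmeas L2_measurable[OF u])
    have "(\<integral>\<^sup>+x. ennreal ((u m x - g x)\<^sup>2) \<partial>?M) < \<infinity>"
      using bound[OF that] by (rule order.strict_trans1) simp
    then show ?thesis
      using meas unfolding L2_def by (auto simp: integrable_iff_bounded)
  qed
  have gL2: "g \<in> L2 S"
    using L2_diff[OF u[of "N 0"] diff[of 0 "N 0"]] by simp
  have le: "L2_norm S (\<lambda>x. u m x - g x) \<le> (1/2) ^ j" if "N j \<le> m" for m j
  proof -
    have "ennreal ((L2_norm S (\<lambda>x. u m x - g x))\<^sup>2) = (\<integral>\<^sup>+x. ennreal ((u m x - g x)\<^sup>2) \<partial>?M)"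
      unfolding L2_norm_power2
      by (rule nn_integral_eq_integral[symmetric]) (auto intro: L2_square_integrable[OF diff[OF that]])
    also note bound[OF that]
    finally have "(L2_norm S (\<lambda>x. u m x - g x))\<^sup>2 \<le> ((1/2) ^ j)\<^sup>2"
      by (subst (asm) ennreal_le_iff) auto
    then show ?thesis
      by (rule power2_le_imp_le) simp
  qed
  have "(\<lambda>n. L2_norm S (\<lambda>x. u n x - g x)) \<longlonglongrightarrow> 0"
  proof (rule LIMSEQ_I)
    fix e :: real assume "e > 0"
    obtain j where j: "(1/2) ^ j < e"
      using real_arch_pow_inv[OF \<open>e > 0\<close>, of "1/2"] by auto
    have "norm (L2_norm S (\<lambda>x. u n x - g x) - 0) < e" if "n \<ge> N j" for n
      using le[OF that] j L2_norm_nonneg[of S "\<lambda>x. u n x - g x"] by simp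
    then show "\<exists>no. \<forall>n\<ge>no. norm (L2_norm S (\<lambda>x. u n x - g x) - 0) < e"
      by blast
  qed
  with gL2 that show thesis by blast
qed

section \<open>Bounded functions and test functions as elements of L2\<close>

lemma L2_subset:
  assumes "S \<in> sets lebesgue" "T \<in> sets lebesgue" "T \<subseteq> S" "u \<in> L2 S"
  shows "u \<in> L2 T"
proof -
  have "set_integrable lebesgue S (\<lambda>x. (u x)\<^sup>2)"
    using L2_square_integrable[OF assms(4)] assms(1) by (simp add: set_integrable_def integrable_restrict_space)
  then have "set_integrable lebesgue T (\<lambda>x. (u x)\<^sup>2)"
    by (rule set_integrable_subset) (use assms in auto)
  then show ?thesis
    using assms(2) measurable_restrict_mono[OF L2_measurable[OF assms(4)] assms(3)]
    by (simp add: L2_def set_integrable_def integrable_restrict_space)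
qed

lemma bounded_imp_L2:
  assumes "S \<in> lmeasurable" "u \<in> borel_measurable (lebesgue_on S)" "\<And>x. x \<in> S \<Longrightarrow> \<bar>u x\<bar> \<le> C"
  shows "u \<in> L2 S"
proof -
  interpret finite_measure "lebesgue_on S"
    using assms(1) by (rule finite_measure_lebesgue_on)
  have "integrable (lebesgue_on S) (\<lambda>x. (u x)\<^sup>2)"
  proof (rule integrable_const_bound[where B = "C\<^sup>2"])
    show "AE x in lebesgue_on S. norm ((u x)\<^sup>2) \<le> C\<^sup>2"
      using assms(3) by (intro AE_I2) (simp add: abs_le_square_iff[symmetric] order_trans[OF _ abs_ge_self])
  qed (use assms(2) in simp)
  with assms(2) show ?thesis by (simp add: L2_def)
qed

lemma L2_const: "S \<in> lmeasurable \<Longrightarrow> (\<lambda>x. c) \<in> L2 S"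
  by (rule bounded_imp_L2[where C = "\<bar>c\<bar>"]) auto

lemma L2_locally_integrable:
  assumes "S \<in> sets lebesgue" "u \<in> L2 S"
  shows "locally_integrable S u"
  unfolding locally_integrable_def
proof (intro allI impI)
  fix K assume K: "compact K \<and> K \<subseteq> S"
  then have Km: "K \<in> lmeasurable" by (simp add: lmeasurable_compact)
  then have "u \<in> L2 K"
    using assms K by (intro L2_subset[of S K u]) (auto simp: fmeasurableD)
  from L2_mult_integrable[OF this L2_const[OF Km, of 1]]
  show "integrable (lebesgue_on K) u" by simp
qed

lemma test_function_bounded:
  assumes "test_function S \<phi>"
  obtains C where "\<And>x. \<bar>\<phi> x\<bar> \<le> C"
proof -
  let ?K = "closure {x. \<phi> x \<noteq> 0}"
  have "bounded (\<phi> ` ?K)"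
    by (intro compact_imp_bounded compact_continuous_image
        continuous_on_subset[OF test_function_continuous[OF assms] subset_UNIV])
      (use assms in \<open>simp add: test_function_def\<close>)
  then obtain C where C: "\<And>x. x \<in> ?K \<Longrightarrow> \<bar>\<phi> x\<bar> \<le> C"
    by (auto simp: bounded_iff)
  have "\<bar>\<phi> x\<bar> \<le> max C 0" for x
    using C[of x] test_function_eq_0[of x \<phi>] by (cases "x \<in> ?K") auto
  then show ?thesis by (rule that)
qed

lemma test_function_derivative_bounded:
  assumes "test_function S \<phi>" "b \<in> Basis"
  obtains C where "\<And>x. \<bar>frechet_derivative \<phi> (at x) b\<bar> \<le> C"
proof -
  let ?K = "closure {x. \<phi> x \<noteq> 0}" and ?f = "\<lambda>x. frechet_derivative \<phi> (at x) b"
  have "bounded (?f ` ?K)"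
    by (intro compact_imp_bounded compact_continuous_image
        continuous_on_subset[OF test_function_derivative_continuous[OF assms] subset_UNIV])
      (use assms in \<open>simp add: test_function_def\<close>)
  then obtain C where C: "\<And>x. x \<in> ?K \<Longrightarrow> \<bar>?f x\<bar> \<le> C"
    by (auto simp: bounded_iff)
  have "\<bar>?f x\<bar> \<le> max C 0" for x
    using C[of x] test_function_derivative_eq_0[of x \<phi>] by (cases "x \<in> ?K") auto
  then show ?thesis by (rule that)
qed

lemma continuous_UNIV_measurable_lebesgue_on:
  fixes f :: "'a::euclidean_space \<Rightarrow> real"
  assumes "continuous_on UNIV f" "S \<in> sets lebesgue"
  shows "f \<in> borel_measurable (lebesgue_on S)"
  using assms by (meson continuous_imp_measurable_on_sets_lebesgue continuous_on_subset subset_UNIV)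

lemma test_function_L2:
  assumes "S \<in> lmeasurable" "test_function T \<phi>"
  shows "\<phi> \<in> L2 S"
proof -
  obtain C where "\<And>x. \<bar>\<phi> x\<bar> \<le> C" by (rule test_function_bounded[OF assms(2)]) blast
  then show ?thesis
    using assms by (intro bounded_imp_L2[of S \<phi> C] continuous_UNIV_measurable_lebesgue_on
        test_function_continuous[OF assms(2)]) (auto simp: fmeasurableD)
qed

lemma test_function_derivative_L2:
  assumes "S \<in> lmeasurable" "test_function T \<phi>" "b \<in> Basis"
  shows "(\<lambda>x. frechet_derivative \<phi> (at x) b) \<in> L2 S"
proof -
  obtain C where "\<And>x. \<bar>frechet_derivative \<phi> (at x) b\<bar> \<le> C"
    by (rule test_function_derivative_bounded[OF assms(2,3)]) blast
  then show ?thesis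
    using assms by (intro bounded_imp_L2[where C = C] continuous_UNIV_measurable_lebesgue_on
        test_function_derivative_continuous[OF assms(2,3)]) (auto simp: fmeasurableD)
qed

text \<open>Serves two purposes: along a coordinate axis for spatial difference quotients, and with
  \<open>x = 0\<close> and \<open>b = 1\<close> to identify the Frechet derivative of a test
  function of time with \<open>deriv\<close>.\<close>

lemma test_function_line_derivative:
  assumes "test_function S \<phi>"
  shows "((\<lambda>s. \<phi> (x + s *\<^sub>R b)) has_real_derivative frechet_derivative \<phi> (at (x + s *\<^sub>R b)) b) (at s)"
proof -
  have "((\<lambda>s. x + s *\<^sub>R b) has_derivative (\<lambda>h. h *\<^sub>R b)) (at s)"
    by (auto intro!: derivative_eq_intros)
  from has_derivative_compose[OF this test_function_has_derivative[OF assms]]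
  have "((\<lambda>s. \<phi> (x + s *\<^sub>R b)) has_derivative (\<lambda>h. frechet_derivative \<phi> (at (x + s *\<^sub>R b)) (h *\<^sub>R b))) (at s)" .
  moreover have "linear (frechet_derivative \<phi> (at (x + s *\<^sub>R b)))"
    using test_function_has_derivative[OF assms] has_derivative_linear by blast
  ultimately show ?thesis
    by (simp add: has_field_derivative_def linear_cmul mult.commute[of _ "frechet_derivative \<phi> _ b"])
qed

text \<open>Riesz representation by minimising \<open>\<phi> \<mapsto> \<parallel>\<phi>\<parallel>\<^sup>2 / 2 - \<Lambda> \<phi>\<close>: by the parallelogram identity
  every minimising sequence is Cauchy, and its limit represents \<open>\<Lambda>\<close>.\<close>

lemma L2_Riesz_subspace:
  fixes \<Lambda> :: "(real^'n::finite \<Rightarrow> real) \<Rightarrow> real"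
  assumes S: "S \<in> lmeasurable" and T: "T \<subseteq> L2 S" "T \<noteq> {}"
    and T_add: "\<And>u v. u \<in> T \<Longrightarrow> v \<in> T \<Longrightarrow> (\<lambda>x. u x + v x) \<in> T"
    and T_cmult: "\<And>c u. u \<in> T \<Longrightarrow> (\<lambda>x. c * u x) \<in> T"
    and \<Lambda>_add: "\<And>u v. u \<in> T \<Longrightarrow> v \<in> T \<Longrightarrow> \<Lambda> (\<lambda>x. u x + v x) = \<Lambda> u + \<Lambda> v"
    and \<Lambda>_cmult: "\<And>c u. u \<in> T \<Longrightarrow> \<Lambda> (\<lambda>x. c * u x) = c * \<Lambda> u"
    and bound: "\<And>u. u \<in> T \<Longrightarrow> \<bar>\<Lambda> u\<bar> \<le> M * L2_norm S u"
  obtains g where "g \<in> L2 S" "\<And>u. u \<in> T \<Longrightarrow> L2_inner S g u = \<Lambda> u"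
proof -
  define J where "J u = L2_inner S u u / 2 - \<Lambda> u" for u
  have TL2: "u \<in> L2 S" if "u \<in> T" for u
    using T that by blast
  have J_lower: "- M\<^sup>2 / 2 \<le> J u" if "u \<in> T" for u
  proof -
    have "\<Lambda> u \<le> M * L2_norm S u"
      using bound[OF that] by simp
    moreover have "0 \<le> (L2_norm S u - M)\<^sup>2" by simp
    ultimately show ?thesis
      by (simp add: J_def L2_norm_power2_inner[symmetric] power2_diff algebra_simps)
  qed
  have bdd: "bdd_below (J ` T)"
    using J_lower by (intro bdd_belowI2)
  define m where "m = Inf (J ` T)"
  have m_le: "m \<le> J u" if "u \<in> T" for u
    unfolding m_def using bdd that by (intro cINF_lower)
  define \<delta> where "\<delta> n = inverse (real (Suc n))" for n
  have \<delta>: "\<delta> \<longlonglongrightarrow> 0"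
    unfolding \<delta>_def by (rule LIMSEQ_inverse_real_of_nat)
  have "\<exists>u\<in>T. J u < m + \<delta> n" for n
    using cInf_lessD[of "J ` T" "m + \<delta> n"] T(2) by (auto simp: m_def \<delta>_def)
  then obtain u where u: "\<And>n. u n \<in> T" "\<And>n. J (u n) < m + \<delta> n"
    by metis
  have J_combo: "J (\<lambda>x. v x + t * w x) = J v + t * (L2_inner S v w - \<Lambda> w) + t\<^sup>2 / 2 * L2_inner S w w"
    if "v \<in> T" "w \<in> T" for v w t
  proof -
    note vw = TL2[OF that(1)] TL2[OF that(2)] L2_cmult[OF TL2[OF that(2)], of t]
    have "L2_inner S (\<lambda>x. v x + t * w x) (\<lambda>x. v x + t * w x) =
        L2_inner S v v + 2 * t * L2_inner S v w + t\<^sup>2 * L2_inner S w w"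
      using vw by (simp add: L2_inner_add_left L2_inner_add_right L2_add L2_inner_cmult_left
          L2_inner_cmult_right L2_inner_commute[of S w v] power2_eq_square algebra_simps)
    then show ?thesis
      using that T_cmult[OF that(2), of t] by (simp add: J_def \<Lambda>_add \<Lambda>_cmult algebra_simps add_divide_distrib)
  qed
  \<comment> \<open>Comes from the lower bound \<open>m\<close> at the midpoint of \<open>v\<close>
    and \<open>w\<close>, which lies in \<open>T\<close>.\<close>
  have parallelogram: "(L2_norm S (\<lambda>x. v x - w x))\<^sup>2 \<le> 4 * (J v + J w - 2 * m)" if "v \<in> T" "w \<in> T" for v w
  proof -
    let ?z = "\<lambda>x. v x + w x"
    have vw: "v \<in> L2 S" "w \<in> L2 S" using that TL2 by auto
    have "J (\<lambda>x. c * ?z x) = c\<^sup>2 / 2 * L2_inner S ?z ?z - c * \<Lambda> ?z" for c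
      using \<Lambda>_cmult[OF T_add[OF that], of c]
      by (simp add: J_def L2_inner_cmult_left L2_inner_cmult_right power2_eq_square)
    from this[of "1/2"] m_le[OF T_cmult[OF T_add[OF that], of "1/2"]]
    have "m \<le> L2_inner S ?z ?z / 8 - \<Lambda> ?z / 2"
      by (simp add: power2_eq_square)
    moreover have "\<Lambda> ?z = \<Lambda> v + \<Lambda> w"
      by (rule \<Lambda>_add[OF that])
    moreover have "L2_inner S ?z ?z = L2_inner S v v + 2 * L2_inner S v w + L2_inner S w w"
      using vw by (simp add: L2_inner_add_left L2_inner_add_right L2_add L2_inner_commute[of S w v])
    moreover have "(L2_norm S (\<lambda>x. v x - w x))\<^sup>2 = L2_inner S v v - 2 * L2_inner S v w + L2_inner S w w"
      using vw by (simp add: L2_norm_power2_inner L2_inner_diff_left L2_inner_diff_right L2_diff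
          L2_inner_commute[of S w v])
    ultimately show ?thesis
      by (simp add: J_def field_simps)
  qed
  have Cauchy: "\<exists>N. \<forall>i\<ge>N. \<forall>j\<ge>N. L2_norm S (\<lambda>x. u i x - u j x) \<le> e" if "e > 0" for e
  proof -
    obtain N where N: "\<delta> N < e\<^sup>2 / 8"
      using reals_Archimedean[of "e\<^sup>2 / 8"] \<open>e > 0\<close> by (auto simp: \<delta>_def)
    have "L2_norm S (\<lambda>x. u i x - u j x) \<le> e" if "N \<le> i" "N \<le> j" for i j
    proof (rule power2_le_imp_le)
      have "\<delta> i \<le> \<delta> N" "\<delta> j \<le> \<delta> N"
        using that by (simp_all add: \<delta>_def le_imp_inverse_le)
      then have "4 * (J (u i) + J (u j) - 2 * m) \<le> 8 * \<delta> N"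
        using u(2)[of i] u(2)[of j] by argo
      with parallelogram[OF u(1) u(1), of i j] N
      show "(L2_norm S (\<lambda>x. u i x - u j x))\<^sup>2 \<le> e\<^sup>2"
        by argo
    qed (use \<open>e > 0\<close> in simp)
    then show ?thesis by blast
  qed
  obtain g where g: "g \<in> L2 S" "(\<lambda>n. L2_norm S (\<lambda>x. u n x - g x)) \<longlonglongrightarrow> 0"
    by (rule L2_complete[OF L2_const[OF S] TL2[OF u(1)] Cauchy]) blast+
  have "L2_inner S g w = \<Lambda> w" if "w \<in> T" for w
  proof -
    define d where "d = L2_inner S g w - \<Lambda> w"
    have w: "w \<in> L2 S" using TL2 that by blast
    have "(\<lambda>n. L2_inner S (u n) w - L2_inner S g w) \<longlonglongrightarrow> 0"
    proof (rule Lim_null_comparison)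
      show "\<forall>\<^sub>F n in sequentially. norm (L2_inner S (u n) w - L2_inner S g w) \<le>
          L2_norm S (\<lambda>x. u n x - g x) * L2_norm S w"
        using L2_Cauchy_Schwarz[OF L2_diff[OF TL2[OF u(1)] g(1)] w] TL2[OF u(1)] g w
        by (intro always_eventually) (simp add: L2_inner_diff_left)
      show "(\<lambda>n. L2_norm S (\<lambda>x. u n x - g x) * L2_norm S w) \<longlonglongrightarrow> 0"
        using tendsto_mult_right[OF g(2), of "L2_norm S w"] by simp
    qed
    then have lim: "(\<lambda>n. L2_inner S (u n) w) \<longlonglongrightarrow> L2_inner S g w"
      by (simp add: LIM_zero_iff)
    \<comment> \<open>First variation at the minimiser. The limit \<open>g\<close> need not lie in
      \<open>T\<close>, so \<open>J\<close> is perturbed around the minimising sequence, up to the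
      error \<open>\<delta> n\<close>, before passing to the limit.\<close>
    have quad: "0 \<le> t * d + t\<^sup>2 / 2 * L2_inner S w w" for t
    proof -
      have "0 \<le> \<delta> n + (t * (L2_inner S (u n) w - \<Lambda> w) + t\<^sup>2 / 2 * L2_inner S w w)" for n
        using m_le[OF T_add[OF u(1)[of n] T_cmult[OF that, of t]]] u(2)[of n] J_combo[OF u(1)[of n] that, of t]
        by simp
      moreover have "(\<lambda>n. \<delta> n + (t * (L2_inner S (u n) w - \<Lambda> w) + t\<^sup>2 / 2 * L2_inner S w w))
          \<longlonglongrightarrow> 0 + (t * (L2_inner S g w - \<Lambda> w) + t\<^sup>2 / 2 * L2_inner S w w)"
        by (intro tendsto_add tendsto_mult tendsto_diff tendsto_const lim \<delta>)
      ultimately have "0 \<le> 0 + (t * (L2_inner S g w - \<Lambda> w) + t\<^sup>2 / 2 * L2_inner S w w)"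
        by (intro LIMSEQ_le_const) auto
      then show ?thesis by (simp add: d_def)
    qed
    \<comment> \<open>For a direction of norm zero the inequality is linear in \<open>t\<close>, and
      \<open>t = -d\<close> decides it. Otherwise \<open>t\<close> is placed at the vertex of the
      parabola.\<close>
    have "d = 0"
    proof (cases "L2_inner S w w = 0")
      case True
      with quad[of "-d"] show ?thesis
        by (simp add: mult_le_0_iff flip: power2_eq_square)
    next
      case False
      then have pos: "L2_inner S w w > 0"
        by (metis L2_norm_power2_inner less_le zero_le_power2)
      have "- d / L2_inner S w w * d + (- d / L2_inner S w w)\<^sup>2 / 2 * L2_inner S w w =
          - (d\<^sup>2 / (2 * L2_inner S w w))"
        using pos by (simp add: field_simps power2_eq_square)
      with quad[of "- d / L2_inner S w w"] have "d\<^sup>2 / (2 * L2_inner S w w) \<le> 0"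
        by linarith
      with pos show ?thesis
        by (simp add: divide_le_0_iff)
    qed
    then show ?thesis by (simp add: d_def)
  qed
  with g(1) that show thesis by blast
qed

lemma integral_lebesgue_translation:
  fixes f :: "'a::euclidean_space \<Rightarrow> real"
  assumes "f \<in> borel_measurable lebesgue"
  shows "(\<integral>x. f (a + x) \<partial>lebesgue) = integral\<^sup>L lebesgue f"
proof -
  have T: "(\<lambda>x::'a. a + (\<Sum>j\<in>Basis. (1 * (x \<bullet> j)) *\<^sub>R j)) = (\<lambda>x. a + x)"
    by (simp add: euclidean_representation)
  have "lebesgue = density (distr lebesgue lebesgue (\<lambda>x::'a. a + x)) (\<lambda>_. 1)"
    using lebesgue_affine_euclidean[of "\<lambda>j::'a. 1" a] unfolding T by (simp add: one_ennreal_def)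
  then have eq: "distr lebesgue lebesgue (\<lambda>x::'a. a + x) = lebesgue"
    by (simp add: density_1)
  have "(\<lambda>x::'a. a + x) \<in> lebesgue \<rightarrow>\<^sub>M lebesgue"
    using lebesgue_affine_measurable[of "\<lambda>j::'a. 1" a] unfolding T by simp
  from integral_distr[OF this assms] show ?thesis
    by (simp add: eq)
qed

section \<open>Weak derivatives of Lipschitz functions\<close>

text \<open>Difference quotients of \<open>\<phi>\<close> are moved onto \<open>u\<close> by a translation, where the Lipschitz bound
  applies; this is uniform in the step, so it survives in the limit.\<close>

lemma lipschitz_integral_derivative_bound:
  fixes S :: "(real^'n::finite) set"
  assumes S: "open S" "bounded S" and lip: "L-lipschitz_on S u" and \<phi>: "test_function S \<phi>"
  shows "\<bar>\<integral>x. u x * frechet_derivative \<phi> (at x) (axis i 1) \<partial>lebesgue_on S\<bar> \<le>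
    L * (\<integral>x. \<bar>\<phi> x\<bar> \<partial>lebesgue_on S)"
proof -
  let ?e = "axis i 1 :: real^'n"
  let ?M = "lebesgue_on S"
  have Sm: "S \<in> lmeasurable" "S \<in> sets lebesgue"
    using S by (auto simp: bounded_set_imp_lmeasurable)
  have umeas: "u \<in> borel_measurable ?M"
    using lipschitz_on_continuous_on[OF lip] Sm by (intro continuous_imp_measurable_on_sets_lebesgue)
  have "bounded (u ` S)"
    using lipschitz_on_uniformly_continuous[OF lip] \<open>bounded S\<close>
    by (rule bounded_uniformly_continuous_image)
  then obtain B where B: "\<And>x. x \<in> S \<Longrightarrow> \<bar>u x\<bar> \<le> B"
    by (auto simp: bounded_iff)
  have uL2: "u \<in> L2 S"
    by (rule bounded_imp_L2[OF Sm(1) umeas B])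
  obtain C where C: "\<And>x. \<bar>frechet_derivative \<phi> (at x) ?e\<bar> \<le> C"
    by (rule test_function_derivative_bounded[OF \<phi>, of ?e]) auto
  define K where "K = closure {x. \<phi> x \<noteq> 0}"
  have K: "compact K" "K \<subseteq> S"
    using \<phi> by (auto simp: test_function_def K_def)
  \<comment> \<open>Shifts shorter than \<open>d\<close> keep the support of \<phi> inside
    \<open>S\<close>, so the Lipschitz bound may be used at both the point and its
    translate.\<close>
  obtain d where d: "d > 0" "(\<Union>x\<in>K. ball x d) \<subseteq> S"
    using compact_subset_open_imp_ball_epsilon_subset[OF K(1) \<open>open S\<close> K(2)] by blast
  define h where "h n = d / 2 * inverse (real (Suc n))" for n
  have h: "0 < h n" "h n < d" for n
  proof -
    have "inverse (real (Suc n)) \<le> 1"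
      by (simp add: inverse_le_1_iff)
    then have "h n \<le> d / 2 * 1"
      unfolding h_def using d by (intro mult_left_mono) auto
    then show "0 < h n" "h n < d"
      using d by (auto simp: h_def)
  qed
  have h0: "h \<longlonglongrightarrow> 0"
    unfolding h_def using tendsto_mult[OF tendsto_const[of "d/2"] LIMSEQ_inverse_real_of_nat] by simp
  define q where "q n x = u x * ((\<phi> (x + h n *\<^sub>R ?e) - \<phi> x) / h n)" for n x
  have \<phi>shift: "continuous_on UNIV (\<lambda>x. \<phi> (x + c *\<^sub>R ?e))" for c
    by (intro continuous_on_compose2[OF test_function_continuous[OF \<phi>]] continuous_intros) auto
  have \<phi>L2: "\<phi> \<in> L2 S"
    by (rule test_function_L2[OF Sm(1) \<phi>])
  obtain C0 where C0: "\<And>x. \<bar>\<phi> x\<bar> \<le> C0"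
    by (rule test_function_bounded[OF \<phi>]) blast
  have shiftL2: "(\<lambda>x. \<phi> (x + c *\<^sub>R ?e)) \<in> L2 S" for c
    by (rule bounded_imp_L2[OF Sm(1) continuous_UNIV_measurable_lebesgue_on[OF \<phi>shift Sm(2)] C0])
  have lim: "(\<lambda>n. integral\<^sup>L ?M (q n)) \<longlonglongrightarrow> (\<integral>x. u x * frechet_derivative \<phi> (at x) ?e \<partial>?M)"
  proof (rule integral_dominated_convergence[where w = "\<lambda>x. B * C"])
    show "(\<lambda>x. u x * frechet_derivative \<phi> (at x) ?e) \<in> borel_measurable ?M"
      by (intro borel_measurable_times umeas continuous_UNIV_measurable_lebesgue_on Sm
          test_function_derivative_continuous[OF \<phi>]) auto
    show "q n \<in> borel_measurable ?M" for n
      unfolding q_def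
      by (intro borel_measurable_times umeas borel_measurable_divide borel_measurable_diff
          borel_measurable_const L2_measurable shiftL2 \<phi>L2)
    show "integrable ?M (\<lambda>x. B * C)"
      using finite_measure.integrable_const[OF finite_measure_lebesgue_on[OF Sm(1)]] .
    show "AE x in ?M. (\<lambda>n. q n x) \<longlonglongrightarrow> u x * frechet_derivative \<phi> (at x) ?e"
    proof (rule AE_I2)
      fix x
      have "((\<lambda>s. (\<phi> (x + s *\<^sub>R ?e) - \<phi> x) / s) \<longlongrightarrow> frechet_derivative \<phi> (at x) ?e) (at 0)"
        using test_function_line_derivative[OF \<phi>, of x ?e 0] by (simp add: DERIV_def)
      moreover have "filterlim h (at 0) sequentially"
        using h0 h by (simp add: filterlim_at less_imp_neq[symmetric])
      ultimately have "(\<lambda>n. (\<phi> (x + h n *\<^sub>R ?e) - \<phi> x) / h n) \<longlonglongrightarrow> frechet_derivative \<phi> (at x) ?e"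
        by (rule filterlim_compose)
      then show "(\<lambda>n. q n x) \<longlonglongrightarrow> u x * frechet_derivative \<phi> (at x) ?e"
        unfolding q_def by (rule tendsto_mult_left)
    qed
    show "AE x in ?M. norm (q n x) \<le> B * C" for n
    proof (rule AE_I2)
      fix x assume "x \<in> space ?M"
      then have "\<bar>u x\<bar> \<le> B" using B by simp
      \<comment> \<open>The mean value theorem bounds all difference quotients of \<phi> by the
        supremum \<open>C\<close> of its derivative. This gives a constant majorant, integrable on
        the bounded set \<open>S\<close>.\<close>
      have "\<exists>z>0. z < h n \<and> \<phi> (x + h n *\<^sub>R ?e) - \<phi> (x + 0 *\<^sub>R ?e) =
          (h n - 0) * frechet_derivative \<phi> (at (x + z *\<^sub>R ?e)) ?e"
        by (rule MVT2[OF h(1)]) (rule test_function_line_derivative[OF \<phi>])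
      then obtain z where "\<phi> (x + h n *\<^sub>R ?e) - \<phi> x = h n * frechet_derivative \<phi> (at (x + z *\<^sub>R ?e)) ?e"
        by auto
      then have "\<bar>(\<phi> (x + h n *\<^sub>R ?e) - \<phi> x) / h n\<bar> \<le> C"
        using C[of "x + z *\<^sub>R ?e"] h(1)[of n] by simp
      with \<open>\<bar>u x\<bar> \<le> B\<close> show "norm (q n x) \<le> B * C"
        unfolding q_def real_norm_def abs_mult by (rule mult_mono') auto
    qed
  qed
  \<comment> \<open>Extension by zero, so that translation invariance on the whole space applies.
    The cut-off is invisible in the products, because \<phi> vanishes at every x for which the
    translate of x leaves \<open>S\<close>.\<close>
  define U where "U x = (if x \<in> S then u x else 0)" for x
  have Umeas: "U \<in> borel_measurable lebesgue"
    unfolding U_def[abs_def] using umeas Sm(2) by (rule borel_measurable_if_I)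
  have L: "0 \<le> L"
    using lip by (rule lipschitz_on_nonneg)
  have \<phi>int: "integrable ?M (\<lambda>x. \<bar>\<phi> x\<bar>)"
    using L2_mult_integrable[OF \<phi>L2 L2_const[OF Sm(1), of 1]] by simp
  have bound: "\<bar>integral\<^sup>L ?M (q n)\<bar> \<le> L * (\<integral>x. \<bar>\<phi> x\<bar> \<partial>?M)" for n
  proof -
    let ?a = "h n *\<^sub>R ?e"
    have inS: "x \<in> S \<and> x - ?a \<in> S \<and> \<bar>u (x - ?a) - u x\<bar> \<le> L * h n" if "\<phi> x \<noteq> 0" for x
    proof -
      have "x \<in> K" using that test_function_eq_0[of x \<phi>] by (auto simp: K_def)
      moreover have "dist x (x - ?a) = h n"
        using h(1)[of n] by (simp add: dist_norm)
      moreover from this have "x - ?a \<in> ball x d"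
        using h(2)[of n] by simp
      ultimately have *: "x \<in> S" "x - ?a \<in> S"
        using d(2) K by blast+
      with lipschitz_onD[OF lip *(2,1)] show ?thesis
        using \<open>dist x (x - ?a) = h n\<close> by (simp add: dist_commute dist_real_def)
    qed
    have T: "(\<lambda>x. -?a + (\<Sum>j\<in>Basis. (1 * (x \<bullet> j)) *\<^sub>R j)) = (\<lambda>x. x - ?a)"
      by (simp add: euclidean_representation)
    have "(\<lambda>x. x - ?a) \<in> lebesgue \<rightarrow>\<^sub>M lebesgue"
      using lebesgue_affine_measurable[of "\<lambda>j::real^'n. 1" "-?a"] unfolding T by simp
    from measurable_compose[OF this Umeas]
    have Ushift: "(\<lambda>x. U (x - ?a)) \<in> borel_measurable lebesgue" .
    have int1: "integrable ?M (\<lambda>x. u x * \<phi> (x + ?a))" and int2: "integrable ?M (\<lambda>x. u x * \<phi> x)"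
      by (intro L2_mult_integrable uL2 shiftL2 \<phi>L2)+
    have hq: "h n * q n x = u x * \<phi> (x + ?a) - u x * \<phi> x" for x
      using h(1)[of n] by (simp add: q_def field_simps)
    have "h n * integral\<^sup>L ?M (q n) = (\<integral>x. h n * q n x \<partial>?M)"
      by simp
    also have "\<dots> = (\<integral>x. u x * \<phi> (x + ?a) - u x * \<phi> x \<partial>?M)"
      unfolding hq ..
    also have "\<dots> = (\<integral>x. u x * \<phi> (x + ?a) \<partial>?M) - (\<integral>x. u x * \<phi> x \<partial>?M)"
      using int1 int2 by simp
    also have "(\<integral>x. u x * \<phi> (x + ?a) \<partial>?M) = (\<integral>x. U x * \<phi> (?a + x) \<partial>lebesgue)"
      using Sm(2) by (simp add: U_def add.commute if_distrib[where f = "\<lambda>y. y * _"]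
          flip: Lebesgue_Measure.integral_restrict_UNIV cong: if_cong)
    also have "\<dots> = (\<integral>x. U (?a + x - ?a) * \<phi> (?a + x) \<partial>lebesgue)"
      by simp
    also have "\<dots> = (\<integral>x. U (x - ?a) * \<phi> x \<partial>lebesgue)"
    proof (rule integral_lebesgue_translation)
      show "(\<lambda>x. U (x - ?a) * \<phi> x) \<in> borel_measurable lebesgue"
        using continuous_UNIV_measurable_lebesgue_on[OF test_function_continuous[OF \<phi>], of UNIV]
        by (intro borel_measurable_times Ushift) (simp add: lebesgue_on_UNIV_eq)
    qed
    also have "\<dots> = (\<integral>x. u (x - ?a) * \<phi> x \<partial>?M)"
    proof -
      have "(if x \<in> UNIV then U (x - ?a) * \<phi> x else 0) = (if x \<in> S then u (x - ?a) * \<phi> x else 0)" for x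
        using inS[of x] by (cases "\<phi> x = 0") (auto simp: U_def)
      from integral_lebesgue_on_support_cong[OF _ Sm(2) this] show ?thesis
        by (simp add: lebesgue_on_UNIV_eq)
    qed
    finally have eq: "h n * integral\<^sup>L ?M (q n) = (\<integral>x. u (x - ?a) * \<phi> x \<partial>?M) - (\<integral>x. u x * \<phi> x \<partial>?M)" .
    have le: "\<bar>(u (x - ?a) - u x) * \<phi> x\<bar> \<le> L * h n * \<bar>\<phi> x\<bar>" for x
      using inS[of x] by (cases "\<phi> x = 0") (auto simp: abs_mult intro: mult_right_mono)
    have m: "(\<lambda>x. U (x - ?a)) \<in> borel_measurable ?M"
      by (rule measurable_restrict_space1[OF Ushift])
    have "(\<lambda>x. U (x - ?a)) \<in> L2 S"
      using B by (intro bounded_imp_L2[OF Sm(1) m, of "max B 0"]) (auto simp: U_def le_max_iff_disj)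
    from L2_mult_integrable[OF this \<phi>L2] have "integrable ?M (\<lambda>x. U (x - ?a) * \<phi> x)" .
    moreover have "U (x - ?a) * \<phi> x = u (x - ?a) * \<phi> x" for x
      using inS[of x] by (cases "\<phi> x = 0") (auto simp: U_def)
    ultimately have int3: "integrable ?M (\<lambda>x. u (x - ?a) * \<phi> x)"
      by simp
    have "h n * integral\<^sup>L ?M (q n) = (\<integral>x. (u (x - ?a) - u x) * \<phi> x \<partial>?M)"
      using eq int3 int2 by (simp add: left_diff_distrib)
    moreover have "h n * \<bar>integral\<^sup>L ?M (q n)\<bar> = \<bar>h n * integral\<^sup>L ?M (q n)\<bar>"
      using h(1)[of n] by (simp add: abs_mult)
    ultimately have "h n * \<bar>integral\<^sup>L ?M (q n)\<bar> = \<bar>\<integral>x. (u (x - ?a) - u x) * \<phi> x \<partial>?M\<bar>"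
      by simp
    also have "\<dots> \<le> (\<integral>x. \<bar>(u (x - ?a) - u x) * \<phi> x\<bar> \<partial>?M)"
      by (rule integral_abs_bound)
    also have "\<dots> \<le> (\<integral>x. L * h n * \<bar>\<phi> x\<bar> \<partial>?M)"
    proof (rule integral_mono)
      show "integrable ?M (\<lambda>x. \<bar>(u (x - ?a) - u x) * \<phi> x\<bar>)"
        using int3 int2 by (simp add: left_diff_distrib)
    qed (use \<phi>int le in auto)
    finally have "h n * \<bar>integral\<^sup>L ?M (q n)\<bar> \<le> h n * (L * (\<integral>x. \<bar>\<phi> x\<bar> \<partial>?M))"
      by (simp add: mult_ac)
    then show ?thesis
      using h(1)[of n] by simp
  qed
  show ?thesis
    by (rule LIMSEQ_le_const2[OF tendsto_rabs[OF lim]]) (use bound in blast)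
qed

text \<open>The preceding bound controls \<open>\<Lambda>\<close> by the L1 norm of the test
  function. On a set of finite measure that is weaker than the L2 norm, so a Riesz representative
  \<open>g\<close> exists. The same L1 bound then shows that \<open>L + g\<close> and
  \<open>L - g\<close> have nonnegative integrals against nonnegative test functions, which bounds
  \<open>g\<close> pointwise.\<close>

lemma lipschitz_has_weak_partial:
  fixes S :: "(real^'n::finite) set"
  assumes S: "open S" "bounded S" and lip: "L-lipschitz_on S u"
  obtains g where "g \<in> L2 S" "has_weak_partial S i u g" "AE x in lebesgue_on S. \<bar>g x\<bar> \<le> L"
proof -
  let ?e = "axis i 1 :: real^'n"
  let ?M = "lebesgue_on S"
  define \<Lambda> where "\<Lambda> \<phi> = - (\<integral>x. u x * frechet_derivative \<phi> (at x) ?e \<partial>?M)" for \<phi>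
  have Sm: "S \<in> lmeasurable" "S \<in> sets lebesgue"
    using S by (auto simp: bounded_set_imp_lmeasurable)
  have umeas: "u \<in> borel_measurable ?M"
    using lipschitz_on_continuous_on[OF lip] Sm by (intro continuous_imp_measurable_on_sets_lebesgue)
  have "bounded (u ` S)"
    using lipschitz_on_uniformly_continuous[OF lip] \<open>bounded S\<close>
    by (rule bounded_uniformly_continuous_image)
  then obtain B where B: "\<And>x. x \<in> S \<Longrightarrow> \<bar>u x\<bar> \<le> B"
    by (auto simp: bounded_iff)
  have uL2: "u \<in> L2 S"
    by (rule bounded_imp_L2[OF Sm(1) umeas B])
  have one: "(\<lambda>x. 1) \<in> L2 S"
    by (rule L2_const[OF Sm(1)])
  have \<Lambda>_le: "\<bar>\<Lambda> \<phi>\<bar> \<le> L * (\<integral>x. \<bar>\<phi> x\<bar> \<partial>?M)" if "test_function S \<phi>" for \<phi>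
    unfolding \<Lambda>_def using lipschitz_integral_derivative_bound[OF S lip that, of i] by simp
  have L: "0 \<le> L"
    using lip by (rule lipschitz_on_nonneg)
  have deriv_add: "frechet_derivative (\<lambda>x. \<phi> x + \<psi> x) (at x) ?e =
      frechet_derivative \<phi> (at x) ?e + frechet_derivative \<psi> (at x) ?e"
    if "test_function S \<phi>" "test_function S \<psi>" for \<phi> \<psi> x
    using frechet_derivative_at[OF has_derivative_add[OF test_function_has_derivative[OF that(1)]
          test_function_has_derivative[OF that(2)]], of x]
    by (metis (no_types, lifting))
  have deriv_cmult: "frechet_derivative (\<lambda>x. c * \<phi> x) (at x) ?e = c * frechet_derivative \<phi> (at x) ?e"
    if "test_function S \<phi>" for \<phi> x c
    using frechet_derivative_at[OF has_derivative_mult_right[OF test_function_has_derivative[OF that]], of c x]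
    by (metis (no_types, lifting))
  have zero: "test_function S (\<lambda>x. 0)"
    unfolding test_function_def using bump_algebra_smooth[OF bump_algebra.const[of 0]] by simp
  obtain g where g: "g \<in> L2 S" "\<And>\<phi>. \<phi> \<in> {\<phi>. test_function S \<phi>} \<Longrightarrow> L2_inner S g \<phi> = \<Lambda> \<phi>"
  proof (rule L2_Riesz_subspace[OF Sm(1), of "{\<phi>. test_function S \<phi>}" \<Lambda> "L * L2_norm S (\<lambda>x. 1)"])
    show "{\<phi>. test_function S \<phi>} \<subseteq> L2 S"
      using test_function_L2[OF Sm(1)] by blast
    show "{\<phi>. test_function S \<phi>} \<noteq> {}"
      using zero by blast
    show "(\<lambda>x. \<phi> x + \<psi> x) \<in> {\<phi>. test_function S \<phi>}"
      if "\<phi> \<in> {\<phi>. test_function S \<phi>}" "\<psi> \<in> {\<phi>. test_function S \<phi>}" for \<phi> \<psi>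
      using that by (simp add: test_function_add)
    show "(\<lambda>x. c * \<phi> x) \<in> {\<phi>. test_function S \<phi>}" if "\<phi> \<in> {\<phi>. test_function S \<phi>}" for c \<phi>
      using that by (simp add: test_function_cmult)
    show "\<Lambda> (\<lambda>x. \<phi> x + \<psi> x) = \<Lambda> \<phi> + \<Lambda> \<psi>"
      if "\<phi> \<in> {\<phi>. test_function S \<phi>}" "\<psi> \<in> {\<phi>. test_function S \<phi>}" for \<phi> \<psi>
    proof -
      have "integrable ?M (\<lambda>x. u x * frechet_derivative \<phi> (at x) ?e)"
        if "test_function S \<phi>" for \<phi>
        by (intro L2_mult_integrable uL2 test_function_derivative_L2[OF Sm(1) that]) simp
      then show ?thesis
        using that by (simp add: \<Lambda>_def deriv_add distrib_left)
    qed
    show "\<Lambda> (\<lambda>x. c * \<phi> x) = c * \<Lambda> \<phi>" if "\<phi> \<in> {\<phi>. test_function S \<phi>}" for c \<phi>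
      using that by (simp add: \<Lambda>_def deriv_cmult mult.left_commute)
    show "\<bar>\<Lambda> \<phi>\<bar> \<le> L * L2_norm S (\<lambda>x. 1) * L2_norm S \<phi>" if "\<phi> \<in> {\<phi>. test_function S \<phi>}" for \<phi>
    proof -
      have "(\<integral>x. \<bar>\<phi> x\<bar> \<partial>?M) \<le> L2_norm S (\<lambda>x. 1) * L2_norm S \<phi>"
        using L2_Cauchy_Schwarz_abs[OF one test_function_L2[OF Sm(1)], of S \<phi>] that by simp
      from order_trans[OF \<Lambda>_le mult_left_mono[OF this L]] that show ?thesis
        by (simp add: mult.assoc)
    qed
  qed blast
  have gtest: "(\<integral>x. g x * \<phi> x \<partial>?M) = \<Lambda> \<phi>" if "test_function S \<phi>" for \<phi>
    using g(2) that by (simp add: L2_inner_def)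
  have weak: "has_weak_partial S i u g"
    unfolding has_weak_partial_def using gtest L2_locally_integrable[OF Sm(2)] uL2 g(1)
    by (simp add: \<Lambda>_def)
  have side: "AE x in ?M. 0 \<le> L + s * g x" if "\<bar>s\<bar> = 1" for s
  proof (rule AE_nonneg_if_test_integrals_nonneg[OF S(1)])
    show "locally_integrable S (\<lambda>x. L + s * g x)"
      by (intro L2_locally_integrable Sm L2_add L2_const L2_cmult g)
    show "0 \<le> (\<integral>x. (L + s * g x) * \<phi> x \<partial>?M)" if \<phi>: "test_function S \<phi>" "\<And>x. 0 \<le> \<phi> x" for \<phi>
    proof -
      have \<phi>L2: "\<phi> \<in> L2 S"
        by (rule test_function_L2[OF Sm(1) \<phi>(1)])
      have int: "integrable ?M (\<lambda>x. L * \<phi> x)" "integrable ?M (\<lambda>x. s * (g x * \<phi> x))"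
        using L2_mult_integrable[OF L2_const[OF Sm(1)] \<phi>L2] L2_mult_integrable[OF g(1) \<phi>L2] by auto
      have "(\<integral>x. (L + s * g x) * \<phi> x \<partial>?M) = (\<integral>x. L * \<phi> x + s * (g x * \<phi> x) \<partial>?M)"
        by (simp add: distrib_right mult.assoc)
      also have "\<dots> = L * (\<integral>x. \<phi> x \<partial>?M) + s * \<Lambda> \<phi>"
        using int gtest[OF \<phi>(1)] by simp
      finally have eq: "(\<integral>x. (L + s * g x) * \<phi> x \<partial>?M) = L * (\<integral>x. \<phi> x \<partial>?M) + s * \<Lambda> \<phi>" .
      have "\<bar>s * \<Lambda> \<phi>\<bar> \<le> L * (\<integral>x. \<phi> x \<partial>?M)"
        using \<Lambda>_le[OF \<phi>(1)] \<phi>(2) \<open>\<bar>s\<bar> = 1\<close> by (simp add: abs_mult)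
      then show ?thesis
        unfolding eq by linarith
    qed
  qed
  have "AE x in ?M. \<bar>g x\<bar> \<le> L"
    using side[of 1, simplified] side[of "-1", simplified] by eventually_elim linarith
  with g(1) weak show thesis by (rule that)
qed

section \<open>The Sobolev space \<open>H\<^sup>1(S)\<close> and the HJB form\<close>

text \<open>Bilinear and continuous for the seminorm \<open>N\<close>, without symmetry. It is
  relative to a carrier \<open>X\<close> since the function spaces are sets depending on the
  domain.\<close>

definition bounded_form ::
    "('b \<Rightarrow> real) set \<Rightarrow> (('b \<Rightarrow> real) \<Rightarrow> real) \<Rightarrow>
     (('b \<Rightarrow> real) \<Rightarrow> ('b \<Rightarrow> real) \<Rightarrow> real) \<Rightarrow> bool" where
  "bounded_form X N Q \<longleftrightarrow>
     (\<forall>u\<in>X. \<forall>v\<in>X. \<forall>w\<in>X. Q (\<lambda>x. u x + v x) w = Q u w + Q v w) \<and>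
     (\<forall>u\<in>X. \<forall>v\<in>X. \<forall>w\<in>X. Q w (\<lambda>x. u x + v x) = Q w u + Q w v) \<and>
     (\<forall>c. \<forall>u\<in>X. \<forall>w\<in>X. Q (\<lambda>x. c * u x) w = c * Q u w) \<and>
     (\<forall>c. \<forall>u\<in>X. \<forall>w\<in>X. Q w (\<lambda>x. c * u x) = c * Q w u) \<and>
     (\<exists>C\<ge>0. \<forall>u\<in>X. \<forall>v\<in>X. \<bar>Q u v\<bar> \<le> C * (N u * N v))"

lemma
  assumes "bounded_form X N Q" "u \<in> X" "v \<in> X" "w \<in> X"
  shows bounded_form_add_left: "Q (\<lambda>x. u x + v x) w = Q u w + Q v w"
    and bounded_form_add_right: "Q w (\<lambda>x. u x + v x) = Q w u + Q w v"
    and bounded_form_cmult_left: "Q (\<lambda>x. c * u x) w = c * Q u w"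
    and bounded_form_cmult_right: "Q w (\<lambda>x. c * u x) = c * Q w u"
  using assms by (simp_all add: bounded_form_def)

lemma bounded_form_bound:
  assumes "bounded_form X N Q"
  obtains C where "C \<ge> 0" "\<And>u v. u \<in> X \<Longrightarrow> v \<in> X \<Longrightarrow> \<bar>Q u v\<bar> \<le> C * (N u * N v)"
  using assms unfolding bounded_form_def by blast

text \<open>Needed because \<open>hjb_form\<close> agrees with a finite sum of simpler forms only on
  \<open>X\<close>, where all the integrals exist and may be split.\<close>

lemma bounded_form_cong:
  assumes Q: "bounded_form X N Q" and eq: "\<And>u v. u \<in> X \<Longrightarrow> v \<in> X \<Longrightarrow> Q' u v = Q u v"
    and "\<And>u v. u \<in> X \<Longrightarrow> v \<in> X \<Longrightarrow> (\<lambda>x. u x + v x) \<in> X"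
    and "\<And>c u. u \<in> X \<Longrightarrow> (\<lambda>x. c * u x) \<in> X"
  shows "bounded_form X N Q'"
  using Q assms(3,4) unfolding bounded_form_def by (simp add: eq)

lemma bounded_form_zero: "bounded_form X N (\<lambda>u v. 0)"
  by (auto simp: bounded_form_def)

lemma bounded_form_add:
  assumes Q: "bounded_form X N Q" and R: "bounded_form X N R"
  shows "bounded_form X N (\<lambda>u v. Q u v + R u v)"
proof -
  obtain C where C: "C \<ge> 0" "\<And>u v. u \<in> X \<Longrightarrow> v \<in> X \<Longrightarrow> \<bar>Q u v\<bar> \<le> C * (N u * N v)"
    using bounded_form_bound[OF Q] by blast
  obtain C' where C': "C' \<ge> 0" "\<And>u v. u \<in> X \<Longrightarrow> v \<in> X \<Longrightarrow> \<bar>R u v\<bar> \<le> C' * (N u * N v)"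
    using bounded_form_bound[OF R] by blast
  have "\<bar>Q u v + R u v\<bar> \<le> (C + C') * (N u * N v)" if "u \<in> X" "v \<in> X" for u v
    using C(2)[OF that] C'(2)[OF that] by (simp add: distrib_right)
  then have "\<exists>C\<ge>0. \<forall>u\<in>X. \<forall>v\<in>X. \<bar>Q u v + R u v\<bar> \<le> C * (N u * N v)"
    using C(1) C'(1) by (intro exI[of _ "C + C'"]) auto
  with Q R show ?thesis
    unfolding bounded_form_def by (simp add: algebra_simps)
qed

lemma bounded_form_cmult:
  assumes Q: "bounded_form X N Q"
  shows "bounded_form X N (\<lambda>u v. c * Q u v)"
proof -
  obtain C where C: "C \<ge> 0" "\<And>u v. u \<in> X \<Longrightarrow> v \<in> X \<Longrightarrow> \<bar>Q u v\<bar> \<le> C * (N u * N v)"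
    using bounded_form_bound[OF Q] by blast
  have "\<bar>c * Q u v\<bar> \<le> (\<bar>c\<bar> * C) * (N u * N v)" if "u \<in> X" "v \<in> X" for u v
    using mult_left_mono[OF C(2)[OF that], of "\<bar>c\<bar>"] by (simp add: abs_mult mult.assoc)
  then have "\<exists>C\<ge>0. \<forall>u\<in>X. \<forall>v\<in>X. \<bar>c * Q u v\<bar> \<le> C * (N u * N v)"
    using C(1) by (intro exI[of _ "\<bar>c\<bar> * C"]) auto
  with Q show ?thesis
    unfolding bounded_form_def by (simp add: algebra_simps)
qed

lemma bounded_form_diff:
  assumes "bounded_form X N Q" "bounded_form X N R"
  shows "bounded_form X N (\<lambda>u v. Q u v - R u v)"
  using bounded_form_add[OF assms(1) bounded_form_cmult[OF assms(2), of "-1"]] by simp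

lemma bounded_form_sum:
  assumes "\<And>i. i \<in> A \<Longrightarrow> bounded_form X N (Q i)"
  shows "bounded_form X N (\<lambda>u v. \<Sum>i\<in>A. Q i u v)"
  using assms
  by (induction A rule: infinite_finite_induct) (auto intro: bounded_form_zero bounded_form_add)

section \<open>Uniqueness and linearity of weak derivatives, and the H1 norm\<close>

lemma locally_integrable_test_integrable:
  assumes S: "S \<in> sets lebesgue" and g: "locally_integrable S g" and \<phi>: "test_function S \<phi>"
  shows "integrable (lebesgue_on S) (\<lambda>x. g x * \<phi> x)"
proof -
  define K where "K = closure {x. \<phi> x \<noteq> 0}"
  have K: "compact K" "K \<subseteq> S"
    using \<phi> by (auto simp: test_function_def K_def)
  then have Km: "K \<in> sets lebesgue"
    by (simp add: lmeasurable_compact fmeasurableD)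
  have gK: "integrable (lebesgue_on K) g"
    using g K by (simp add: locally_integrable_def)
  obtain C where C: "\<And>x. \<bar>\<phi> x\<bar> \<le> C"
    by (rule test_function_bounded[OF \<phi>]) blast
  have "integrable (lebesgue_on K) (\<lambda>x. g x * \<phi> x)"
  proof (rule Bochner_Integration.integrable_bound)
    show "integrable (lebesgue_on K) (\<lambda>x. g x * C)"
      using gK by simp
    show "(\<lambda>x. g x * \<phi> x) \<in> borel_measurable (lebesgue_on K)"
      using gK continuous_UNIV_measurable_lebesgue_on[OF test_function_continuous[OF \<phi>] Km]
      by (intro borel_measurable_times) auto
    show "AE x in lebesgue_on K. norm (g x * \<phi> x) \<le> norm (g x * C)"
      using order_trans[OF C abs_ge_self] by (intro AE_I2) (simp add: abs_mult mult_left_mono)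
  qed
  moreover have "(if x \<in> K then g x * \<phi> x else 0) = (if x \<in> S then g x * \<phi> x else 0)" for x
    using K(2) test_function_eq_0[of x \<phi>] by (auto simp: K_def)
  ultimately show ?thesis
    using integrable_lebesgue_on_support_cong[OF Km S, of "\<lambda>x. g x * \<phi> x" "\<lambda>x. g x * \<phi> x"] by blast
qed

text \<open>The fundamental lemma, applied to both differences of the two candidates.\<close>

lemma has_weak_partial_unique:
  assumes S: "open S" and g: "has_weak_partial S i u g" and h: "has_weak_partial S i u h"
  shows "AE x in lebesgue_on S. g x = h x"
proof -
  have Sm: "S \<in> sets lebesgue" using S by simp
  have loc: "locally_integrable S g" "locally_integrable S h"
    using g h by (auto simp: has_weak_partial_def)
  have one_side: "AE x in lebesgue_on S. 0 \<le> p x + -1 * q x"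
    if "has_weak_partial S i u p" "has_weak_partial S i u q" for p q
  proof (rule AE_nonneg_if_test_integrals_nonneg[OF S])
    have pq: "locally_integrable S p" "locally_integrable S q"
      using that by (auto simp: has_weak_partial_def)
    then show "locally_integrable S (\<lambda>x. p x + -1 * q x)"
      by (intro locally_integrable_add locally_integrable_cmult)
    fix \<phi> assume \<phi>: "test_function S \<phi>"
    have "(\<integral>x. p x * \<phi> x \<partial>lebesgue_on S) = (\<integral>x. q x * \<phi> x \<partial>lebesgue_on S)"
      using that \<phi> by (simp add: has_weak_partial_def)
    then show "0 \<le> (\<integral>x. (p x + -1 * q x) * \<phi> x \<partial>lebesgue_on S)"
      using locally_integrable_test_integrable[OF Sm pq(1) \<phi>] locally_integrable_test_integrable[OF Sm pq(2) \<phi>]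
      by (simp add: left_diff_distrib)
  qed
  show ?thesis
    using one_side[OF g h] one_side[OF h g] by eventually_elim simp
qed

text \<open>The only access to the function selected by \<open>SOME\<close>: every property of
  \<open>weak_partial\<close> is transferred from a known weak derivative through this
  equality.\<close>

lemma weak_partial_eq_AE:
  assumes "open S" "has_weak_partial S i u g"
  shows "AE x in lebesgue_on S. weak_partial S i u x = g x"
  using assms someI[of "has_weak_partial S i u" g]
  by (intro has_weak_partial_unique) (auto simp: weak_partial_def)

lemma has_weak_partial_add:
  assumes S: "S \<in> lmeasurable" and L2: "u \<in> L2 S" "v \<in> L2 S" "g \<in> L2 S" "h \<in> L2 S"
    and g: "has_weak_partial S i u g" and h: "has_weak_partial S i v h"
  shows "has_weak_partial S i (\<lambda>x. u x + v x) (\<lambda>x. g x + h x)"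
  unfolding has_weak_partial_def
proof (intro conjI allI impI)
  show "locally_integrable S (\<lambda>x. u x + v x)" "locally_integrable S (\<lambda>x. g x + h x)"
    by (rule L2_locally_integrable[OF fmeasurableD[OF S] L2_add[OF L2(1,2)]],
        rule L2_locally_integrable[OF fmeasurableD[OF S] L2_add[OF L2(3,4)]])
  fix \<phi> assume \<phi>: "test_function S \<phi>"
  have d: "(\<lambda>x. frechet_derivative \<phi> (at x) (axis i 1)) \<in> L2 S" "\<phi> \<in> L2 S"
    using test_function_derivative_L2[OF S \<phi>] test_function_L2[OF S \<phi>] by auto
  show "(\<integral>x. (u x + v x) * frechet_derivative \<phi> (at x) (axis i 1) \<partial>lebesgue_on S) =
      - (\<integral>x. (g x + h x) * \<phi> x \<partial>lebesgue_on S)"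
    using g h \<phi> L2_mult_integrable[OF _ d(1)] L2_mult_integrable[OF _ d(2)] L2
    by (simp add: has_weak_partial_def distrib_right)
qed

lemma has_weak_partial_cmult:
  assumes "has_weak_partial S i u g"
  shows "has_weak_partial S i (\<lambda>x. c * u x) (\<lambda>x. c * g x)"
  using assms by (simp add: has_weak_partial_def locally_integrable_cmult mult.assoc)

lemma H1_L2: "u \<in> H1 S \<Longrightarrow> u \<in> L2 S"
  by (simp add: H1_def)

lemma
  assumes "open S" "u \<in> H1 S"
  shows has_weak_partial_weak_partial: "has_weak_partial S i u (weak_partial S i u)"
    and weak_partial_L2: "weak_partial S i u \<in> L2 S"
proof -
  obtain g where g: "g \<in> L2 S" "has_weak_partial S i u g"
    using assms by (auto simp: H1_def)
  show "has_weak_partial S i u (weak_partial S i u)"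
    unfolding weak_partial_def by (rule someI[of "has_weak_partial S i u" g, OF g(2)])
  have "AE x in lebesgue_on S. g x = weak_partial S i u x"
    using weak_partial_eq_AE[OF assms(1) g(2)] by eventually_elim simp
  from L2_cong_AE[OF _ g(1) this] assms(1) show "weak_partial S i u \<in> L2 S"
    by simp
qed

text \<open>The derivatives of \<open>u\<close>, of \<open>v\<close> and of their sum are selected
  independently, so additivity can only hold almost everywhere.\<close>

lemma
  assumes S: "open S" "bounded S" and u: "u \<in> H1 S" and v: "v \<in> H1 S"
  shows H1_add: "(\<lambda>x. u x + v x) \<in> H1 S"
    and weak_partial_add:
      "AE x in lebesgue_on S. weak_partial S i (\<lambda>x. u x + v x) x = weak_partial S i u x + weak_partial S i v x"
proof -
  have Sm: "S \<in> lmeasurable"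
    using S by (simp add: bounded_set_imp_lmeasurable)
  have *: "has_weak_partial S i (\<lambda>x. u x + v x) (\<lambda>x. weak_partial S i u x + weak_partial S i v x)" for i
    using u v S
    by (intro has_weak_partial_add[OF Sm] has_weak_partial_weak_partial weak_partial_L2 H1_L2)
  have "(\<lambda>x. weak_partial S i u x + weak_partial S i v x) \<in> L2 S" for i
    using u v S by (intro L2_add weak_partial_L2)
  with * L2_add[OF H1_L2[OF u] H1_L2[OF v]] show "(\<lambda>x. u x + v x) \<in> H1 S"
    unfolding H1_def by blast
  show "AE x in lebesgue_on S. weak_partial S i (\<lambda>x. u x + v x) x = weak_partial S i u x + weak_partial S i v x"
    by (rule weak_partial_eq_AE[OF S(1) *])
qed

lemma
  assumes S: "open S" and u: "u \<in> H1 S"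
  shows H1_cmult: "(\<lambda>x. c * u x) \<in> H1 S"
    and weak_partial_cmult: "AE x in lebesgue_on S. weak_partial S i (\<lambda>x. c * u x) x = c * weak_partial S i u x"
proof -
  have *: "has_weak_partial S i (\<lambda>x. c * u x) (\<lambda>x. c * weak_partial S i u x)" for i
    by (rule has_weak_partial_cmult[OF has_weak_partial_weak_partial[OF S u]])
  have "\<exists>g\<in>L2 S. has_weak_partial S i (\<lambda>x. c * u x) g" for i
    by (intro bexI[of _ "\<lambda>x. c * weak_partial S i u x"] * L2_cmult weak_partial_L2 S u)
  with L2_cmult[OF H1_L2[OF u]] show "(\<lambda>x. c * u x) \<in> H1 S"
    by (simp add: H1_def)
  show "AE x in lebesgue_on S. weak_partial S i (\<lambda>x. c * u x) x = c * weak_partial S i u x"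
    by (rule weak_partial_eq_AE[OF S *])
qed

text \<open>Reads the norm as a Euclidean norm indexed by an option type: \<open>None\<close> stands
  for the function itself, \<open>Some i\<close> for its derivatives. Triangle inequality and
  homogeneity are then inherited from \<open>L2_set\<close>.\<close>

lemma H1_norm_eq_L2_set:
  "H1_norm S u = L2_set (case_option (L2_norm S u) (\<lambda>i. L2_norm S (weak_partial S i u))) UNIV"
proof -
  let ?f = "case_option (L2_norm S u) (\<lambda>i. L2_norm S (weak_partial S i u))"
  have "(\<Sum>k\<in>UNIV. (?f k)\<^sup>2) = (?f None)\<^sup>2 + (\<Sum>k\<in>range Some. (?f k)\<^sup>2)"
    unfolding UNIV_option_conv by (rule sum.insert) auto
  also have "(\<Sum>k\<in>range Some. (?f k)\<^sup>2) = (\<Sum>i\<in>UNIV. (L2_norm S (weak_partial S i u))\<^sup>2)"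
    by (simp add: sum.reindex)
  finally show ?thesis
    by (simp add: H1_norm_def L2_set_def)
qed

lemma H1_norm_nonneg: "0 \<le> H1_norm S u"
  by (simp add: H1_norm_eq_L2_set)

lemma L2_norm_le_H1_norm: "L2_norm S u \<le> H1_norm S u"
  using member_le_L2_set[of UNIV None "case_option (L2_norm S u) (\<lambda>i. L2_norm S (weak_partial S i u))"]
  by (simp add: H1_norm_eq_L2_set)

lemma L2_norm_weak_partial_le_H1_norm: "L2_norm S (weak_partial S i u) \<le> H1_norm S u"
  using member_le_L2_set[of UNIV "Some i" "case_option (L2_norm S u) (\<lambda>i. L2_norm S (weak_partial S i u))"]
  by (simp add: H1_norm_eq_L2_set)

lemma H1_norm_triangle:
  assumes S: "open S" "bounded S" and u: "u \<in> H1 S" and v: "v \<in> H1 S"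
  shows "H1_norm S (\<lambda>x. u x + v x) \<le> H1_norm S u + H1_norm S v"
proof -
  let ?f = "\<lambda>u. case_option (L2_norm S u) (\<lambda>i. L2_norm S (weak_partial S i u))"
  have "L2_norm S (weak_partial S i (\<lambda>x. u x + v x)) \<le> L2_norm S (weak_partial S i u) + L2_norm S (weak_partial S i v)" for i
  proof -
    have "L2_norm S (weak_partial S i (\<lambda>x. u x + v x)) = L2_norm S (\<lambda>x. weak_partial S i u x + weak_partial S i v x)"
      using S by (intro L2_norm_cong_AE weak_partial_add weak_partial_L2 H1_add u v) auto
    then show ?thesis
      using L2_norm_triangle[OF weak_partial_L2[OF S(1) u] weak_partial_L2[OF S(1) v], of i i] by simp
  qed
  then have "?f (\<lambda>x. u x + v x) k \<le> ?f u k + ?f v k" for k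
    using L2_norm_triangle[OF H1_L2[OF u] H1_L2[OF v]] by (cases k) auto
  then have "L2_set (?f (\<lambda>x. u x + v x)) UNIV \<le> L2_set (\<lambda>k. ?f u k + ?f v k) UNIV"
    by (intro L2_set_mono) (auto simp: L2_norm_nonneg split: option.split)
  also have "\<dots> \<le> L2_set (?f u) UNIV + L2_set (?f v) UNIV"
    by (rule L2_set_triangle_ineq)
  finally show ?thesis
    by (simp add: H1_norm_eq_L2_set)
qed

lemma H1_norm_cmult:
  assumes S: "open S" and u: "u \<in> H1 S"
  shows "H1_norm S (\<lambda>x. c * u x) = \<bar>c\<bar> * H1_norm S u"
proof -
  let ?f = "\<lambda>u. case_option (L2_norm S u) (\<lambda>i. L2_norm S (weak_partial S i u))"
  have "L2_norm S (weak_partial S i (\<lambda>x. c * u x)) = \<bar>c\<bar> * L2_norm S (weak_partial S i u)" for i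
  proof -
    have "L2_norm S (weak_partial S i (\<lambda>x. c * u x)) = L2_norm S (\<lambda>x. c * weak_partial S i u x)"
      using S by (intro L2_norm_cong_AE weak_partial_cmult weak_partial_L2 H1_cmult u) auto
    then show ?thesis by (simp add: L2_norm_cmult)
  qed
  then have "?f (\<lambda>x. c * u x) = (\<lambda>k. \<bar>c\<bar> * ?f u k)"
    by (auto simp: L2_norm_cmult split: option.split)
  then show ?thesis
    by (simp add: H1_norm_eq_L2_set L2_set_right_distrib)
qed

text \<open>The common properties of the identity and of the weak derivatives, the two kinds of
  factors occurring in the HJB form. Linearity holds almost everywhere, which is all that an
  integral sees.\<close>

definition H1_L2_operator ::
    "(real^'n::finite) set \<Rightarrow> ((real^'n \<Rightarrow> real) \<Rightarrow> real^'n \<Rightarrow> real) \<Rightarrow> bool" where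
  "H1_L2_operator S P \<longleftrightarrow>
     (\<forall>u\<in>H1 S. P u \<in> L2 S \<and> L2_norm S (P u) \<le> H1_norm S u) \<and>
     (\<forall>u\<in>H1 S. \<forall>v\<in>H1 S. AE x in lebesgue_on S. P (\<lambda>x. u x + v x) x = P u x + P v x) \<and>
     (\<forall>c. \<forall>u\<in>H1 S. AE x in lebesgue_on S. P (\<lambda>x. c * u x) x = c * P u x)"

lemma H1_L2_operator_id: "H1_L2_operator S (\<lambda>u. u)"
  by (simp add: H1_L2_operator_def H1_L2 L2_norm_le_H1_norm)

lemma H1_L2_operator_weak_partial:
  "open S \<Longrightarrow> bounded S \<Longrightarrow> H1_L2_operator S (weak_partial S i)"
  by (simp add: H1_L2_operator_def weak_partial_L2 L2_norm_weak_partial_le_H1_norm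
      weak_partial_add weak_partial_cmult)

text \<open>Covers all four groups of terms of the HJB form at once: each of their summands is a
  weighted integral of this shape for suitable \<open>P\<close>, \<open>R\<close> and coefficient
  \<open>c\<close>.\<close>

lemma bounded_form_weighted:
  assumes S: "open S" "bounded S" and P: "H1_L2_operator S P" and R: "H1_L2_operator S R"
    and c: "c \<in> borel_measurable (lebesgue_on S)" "AE x in lebesgue_on S. \<bar>c x\<bar> \<le> M" "M \<ge> 0"
  shows "bounded_form (H1 S) (H1_norm S) (\<lambda>u v. \<integral>x. c x * P u x * R v x \<partial>lebesgue_on S)"
proof -
  let ?I = "\<lambda>p q. \<integral>x. c x * p x * q x \<partial>lebesgue_on S"
  have PL2: "P u \<in> L2 S" and RL2: "R u \<in> L2 S" and PN: "L2_norm S (P u) \<le> H1_norm S u"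
    and RN: "L2_norm S (R u) \<le> H1_norm S u" if "u \<in> H1 S" for u
    using P R that by (auto simp: H1_L2_operator_def)
  have cong: "?I p q = ?I p' q'"
    if "p \<in> L2 S" "q \<in> L2 S" "p' \<in> L2 S" "q' \<in> L2 S"
      "AE x in lebesgue_on S. p x = p' x" "AE x in lebesgue_on S. q x = q' x" for p q p' q'
  proof (rule integral_cong_AE)
    show "AE x in lebesgue_on S. c x * p x * q x = c x * p' x * q' x"
      using that(5,6) by eventually_elim simp
  qed (intro borel_measurable_times c L2_measurable that)+
  have add: "?I (\<lambda>x. p x + p' x) q = ?I p q + ?I p' q" "?I q (\<lambda>x. p x + p' x) = ?I q p + ?I q p'"
    if "p \<in> L2 S" "q \<in> L2 S" "p' \<in> L2 S" for p q p'
    using bounded_mult_L2_L2(1)[OF that(1,2) c] bounded_mult_L2_L2(1)[OF that(3,2) c]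
      bounded_mult_L2_L2(1)[OF that(2,1) c] bounded_mult_L2_L2(1)[OF that(2,3) c]
    by (simp_all add: distrib_left distrib_right)
  have cmult: "?I (\<lambda>x. k * p x) q = k * ?I p q" "?I q (\<lambda>x. k * p x) = k * ?I q p" for k p q
    by (simp_all add: mult.left_commute mult.assoc)
  have "?I (P (\<lambda>x. u x + v x)) (R w) = ?I (P u) (R w) + ?I (P v) (R w)"
    "?I (P w) (R (\<lambda>x. u x + v x)) = ?I (P w) (R u) + ?I (P w) (R v)"
    if "u \<in> H1 S" "v \<in> H1 S" "w \<in> H1 S" for u v w
  proof -
    have "?I (P (\<lambda>x. u x + v x)) (R w) = ?I (\<lambda>x. P u x + P v x) (R w)"
      by (rule cong) (use P that S in \<open>auto intro!: PL2 RL2 L2_add H1_add simp: H1_L2_operator_def\<close>)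
    then show "?I (P (\<lambda>x. u x + v x)) (R w) = ?I (P u) (R w) + ?I (P v) (R w)"
      using add(1)[OF PL2[OF that(1)] RL2[OF that(3)] PL2[OF that(2)]] by simp
    have "?I (P w) (R (\<lambda>x. u x + v x)) = ?I (P w) (\<lambda>x. R u x + R v x)"
      by (rule cong) (use R that S in \<open>auto intro!: PL2 RL2 L2_add H1_add simp: H1_L2_operator_def\<close>)
    then show "?I (P w) (R (\<lambda>x. u x + v x)) = ?I (P w) (R u) + ?I (P w) (R v)"
      using add(2)[OF RL2[OF that(1)] PL2[OF that(3)] RL2[OF that(2)]] by simp
  qed
  moreover have "?I (P (\<lambda>x. k * u x)) (R w) = k * ?I (P u) (R w)"
    "?I (P w) (R (\<lambda>x. k * u x)) = k * ?I (P w) (R u)"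
    if "u \<in> H1 S" "w \<in> H1 S" for u w k
  proof -
    have "?I (P (\<lambda>x. k * u x)) (R w) = ?I (\<lambda>x. k * P u x) (R w)"
      by (rule cong) (use P that S in \<open>auto intro!: PL2 RL2 L2_cmult H1_cmult simp: H1_L2_operator_def\<close>)
    then show "?I (P (\<lambda>x. k * u x)) (R w) = k * ?I (P u) (R w)"
      by (simp only: cmult)
    have "?I (P w) (R (\<lambda>x. k * u x)) = ?I (P w) (\<lambda>x. k * R u x)"
      by (rule cong) (use R that S in \<open>auto intro!: PL2 RL2 L2_cmult H1_cmult simp: H1_L2_operator_def\<close>)
    then show "?I (P w) (R (\<lambda>x. k * u x)) = k * ?I (P w) (R u)"
      by (simp only: cmult)
  qed
  moreover have "\<bar>?I (P u) (R v)\<bar> \<le> M * (H1_norm S u * H1_norm S v)" if "u \<in> H1 S" "v \<in> H1 S" for u v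
  proof -
    have "\<bar>?I (P u) (R v)\<bar> \<le> M * (L2_norm S (P u) * L2_norm S (R v))"
      by (rule bounded_mult_L2_L2(2)[OF PL2[OF that(1)] RL2[OF that(2)] c])
    also have "\<dots> \<le> M * (H1_norm S u * H1_norm S v)"
      using PN[OF that(1)] RN[OF that(2)] \<open>M \<ge> 0\<close>
      by (intro mult_left_mono mult_mono) (auto simp: L2_norm_nonneg H1_norm_nonneg)
    finally show ?thesis .
  qed
  ultimately show ?thesis
    unfolding bounded_form_def using \<open>M \<ge> 0\<close> by (intro conjI ballI allI exI[of _ M]) auto
qed

lemma bounded_form_L2_inner:
  "open S \<Longrightarrow> bounded S \<Longrightarrow> bounded_form (H1 S) (H1_norm S) (L2_inner S)"
  using bounded_form_weighted[OF _ _ H1_L2_operator_id H1_L2_operator_id, of S "\<lambda>x. 1" 1]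
  by (simp add: L2_inner_def[abs_def])

text \<open>On a bounded domain a Lipschitz bound makes the coefficients bounded and their weak
  derivatives essentially bounded. These are the two kinds of weights that
  \<open>bounded_form_weighted\<close> has to deal with.\<close>

lemma bounded_form_hjb_form:
  fixes S :: "(real^'n::finite) set" and b :: "real^'n \<Rightarrow> real^'n" and D :: "real^'n \<Rightarrow> real^'n^'n"
  assumes S: "open S" "bounded S" and b: "L-lipschitz_on S b" and D: "L'-lipschitz_on S D"
  shows "bounded_form (H1 S) (H1_norm S) (hjb_form S \<gamma> b D)"
proof -
  let ?M = "lebesgue_on S"
  have Sm: "S \<in> sets lebesgue" using S by simp
  have comp_b: "L-lipschitz_on S (\<lambda>x. b x $ i)" for i
    using order_trans[OF dist_vec_nth_le lipschitz_onD[OF b]] lipschitz_on_nonneg[OF b]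
    by (intro lipschitz_onI)
  have comp_D: "L'-lipschitz_on S (\<lambda>x. D x $ i $ j)" for i j
    using order_trans[OF dist_vec_nth_le order_trans[OF dist_vec_nth_le lipschitz_onD[OF D]]]
      lipschitz_on_nonneg[OF D]
    by (intro lipschitz_onI)
  have lip_coeff: "\<exists>B\<ge>0. c \<in> borel_measurable ?M \<and> (AE x in ?M. \<bar>c x\<bar> \<le> B)"
    if c: "K-lipschitz_on S c" for c :: "real^'n \<Rightarrow> real" and K
  proof -
    have "bounded (c ` S)"
      using lipschitz_on_uniformly_continuous[OF c] S(2) by (rule bounded_uniformly_continuous_image)
    then obtain B where "\<And>x. x \<in> S \<Longrightarrow> \<bar>c x\<bar> \<le> B"
      by (auto simp: bounded_iff)
    then have "AE x in ?M. \<bar>c x\<bar> \<le> max B 0"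
      by (intro AE_I2) (simp add: le_max_iff_disj)
    moreover have "c \<in> borel_measurable ?M"
      using lipschitz_on_continuous_on[OF c] Sm by (intro continuous_imp_measurable_on_sets_lebesgue)
    ultimately show ?thesis
      by (intro exI[of _ "max B 0"]) simp
  qed
  have deriv_coeff: "\<exists>B\<ge>0. weak_partial S i c \<in> borel_measurable ?M \<and> (AE x in ?M. \<bar>weak_partial S i c x\<bar> \<le> B)"
    if c: "K-lipschitz_on S c" for c :: "real^'n \<Rightarrow> real" and K i
  proof -
    obtain g where g: "g \<in> L2 S" "has_weak_partial S i c g" "AE x in ?M. \<bar>g x\<bar> \<le> K"
      using lipschitz_has_weak_partial[OF S c] by blast
    have eq: "AE x in ?M. weak_partial S i c x = g x"
      by (rule weak_partial_eq_AE[OF S(1) g(2)])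
    then have "AE x in ?M. g x = weak_partial S i c x"
      by eventually_elim simp
    then have "weak_partial S i c \<in> borel_measurable ?M"
      by (rule borel_measurable_AE_lebesgue_on[OF Sm L2_measurable[OF g(1)]])
    moreover have "AE x in ?M. \<bar>weak_partial S i c x\<bar> \<le> K"
      using eq g(3) by eventually_elim simp
    ultimately show ?thesis
      using lipschitz_on_nonneg[OF c] by blast
  qed
  note ops = H1_L2_operator_id H1_L2_operator_weak_partial[OF S]
  have form: "bounded_form (H1 S) (H1_norm S) (\<lambda>u v. \<integral>x. c x * P u x * R v x \<partial>?M)"
    and int: "u \<in> H1 S \<Longrightarrow> v \<in> H1 S \<Longrightarrow> integrable ?M (\<lambda>x. c x * P u x * R v x)"
    if "\<exists>B\<ge>0. c \<in> borel_measurable ?M \<and> (AE x in ?M. \<bar>c x\<bar> \<le> B)" "H1_L2_operator S P" "H1_L2_operator S R"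
    for c P R u v
  proof -
    from that(1) obtain B where "0 \<le> B \<and> c \<in> borel_measurable ?M \<and> (AE x in ?M. \<bar>c x\<bar> \<le> B)" ..
    then have B: "B \<ge> 0" "c \<in> borel_measurable ?M" "AE x in ?M. \<bar>c x\<bar> \<le> B"
      by simp_all
    show "bounded_form (H1 S) (H1_norm S) (\<lambda>u v. \<integral>x. c x * P u x * R v x \<partial>?M)"
      by (rule bounded_form_weighted[OF S that(2,3) B(2,3,1)])
    show "integrable ?M (\<lambda>x. c x * P u x * R v x)" if "u \<in> H1 S" "v \<in> H1 S"
      using that \<open>H1_L2_operator S P\<close> \<open>H1_L2_operator S R\<close>
      by (intro bounded_mult_L2_L2(1)[OF _ _ B(2,3,1)]) (auto simp: H1_L2_operator_def)
  qed
  have const: "\<exists>B\<ge>0. (\<lambda>x. \<gamma>) \<in> borel_measurable ?M \<and> (AE x in ?M. \<bar>\<gamma>\<bar> \<le> B)"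
    by (intro exI[of _ "\<bar>\<gamma>\<bar>"]) simp
  note coeffs = const lip_coeff[OF comp_b] lip_coeff[OF comp_D] deriv_coeff[OF comp_D]
  \<comment> \<open>The HJB form with the sums outside the integrals, i.e. as a finite combination
    of weighted forms. The exchange is justified only for arguments in \<open>H1 S\<close>.\<close>
  define Q where "Q u v =
      (\<integral>x. \<gamma> * u x * v x \<partial>?M)
      + 1/2 * (\<Sum>i\<in>UNIV. \<Sum>j\<in>UNIV. \<integral>x. D x $ i $ j * weak_partial S j u x * weak_partial S i v x \<partial>?M)
      - (\<Sum>i\<in>UNIV. \<integral>x. b x $ i * weak_partial S i u x * v x \<partial>?M)
      - 1/2 * (\<Sum>i\<in>UNIV. \<Sum>j\<in>UNIV. \<integral>x. weak_partial S i (\<lambda>y. D y $ i $ j) x * weak_partial S j u x * v x \<partial>?M)"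
    for u v
  have "bounded_form (H1 S) (H1_norm S) Q"
    unfolding Q_def[abs_def]
    by (intro bounded_form_add bounded_form_diff bounded_form_cmult bounded_form_sum form coeffs ops)
  moreover have "hjb_form S \<gamma> b D u v = Q u v" if "u \<in> H1 S" "v \<in> H1 S" for u v
    using that int[OF coeffs(2) ops(2) ops(1)] int[OF coeffs(3) ops(2) ops(2)] int[OF coeffs(4) ops(2) ops(1)]
    by (simp add: hjb_form_def Q_def)
  ultimately show ?thesis
    by (rule bounded_form_cong) (use S in \<open>auto intro: H1_add H1_cmult\<close>)
qed

section \<open>Positivity of double time integrals\<close>

text \<open>The vectors themselves index the sum, as they do when a simple function is integrated:
  \<open>R\<close> is its finite range and \<open>a y\<close> the weight collected by the value
  \<open>y\<close>.\<close>

lemma bounded_form_sum_left: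
  assumes Q: "bounded_form X N Q" and zero: "(\<lambda>x. 0) \<in> X"
    and add: "\<And>u v. u \<in> X \<Longrightarrow> v \<in> X \<Longrightarrow> (\<lambda>x. u x + v x) \<in> X"
    and cmult: "\<And>c u. u \<in> X \<Longrightarrow> (\<lambda>x. c * u x) \<in> X"
    and R: "finite R" "R \<subseteq> X" and v: "v \<in> X"
  shows "(\<lambda>x. \<Sum>y\<in>R. a y * y x) \<in> X \<and> Q (\<lambda>x. \<Sum>y\<in>R. a y * y x) v = (\<Sum>y\<in>R. a y * Q y v)
    \<and> Q v (\<lambda>x. \<Sum>y\<in>R. a y * y x) = (\<Sum>y\<in>R. a y * Q v y)"
  using R
proof (induction R rule: finite_induct)
  case empty
  then show ?case
    using zero bounded_form_cmult_left[OF Q zero zero v, of 0] bounded_form_cmult_right[OF Q zero zero v, of 0]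
    by simp
next
  case (insert y R)
  then have y: "y \<in> X" and IH: "(\<lambda>x. \<Sum>y\<in>R. a y * y x) \<in> X"
      "Q (\<lambda>x. \<Sum>y\<in>R. a y * y x) v = (\<Sum>y\<in>R. a y * Q y v)"
      "Q v (\<lambda>x. \<Sum>y\<in>R. a y * y x) = (\<Sum>y\<in>R. a y * Q v y)"
    by auto
  note ay = cmult[OF y, of "a y"]
  show ?case
    using insert.hyps add[OF ay IH(1)] bounded_form_add_left[OF Q ay IH(1) v]
      bounded_form_add_right[OF Q ay IH(1) v] bounded_form_cmult_left[OF Q y y v, of "a y"]
      bounded_form_cmult_right[OF Q y y v, of "a y"] IH(2,3)
    by simp
qed

text \<open>Scalar functions built from a strongly measurable path get their measurability here, as
  almost-everywhere limits of the same expressions for simple functions.\<close>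

lemma borel_measurable_AE_LIMSEQ_lebesgue_on:
  fixes f :: "nat \<Rightarrow> 'a::euclidean_space \<Rightarrow> real"
  assumes "I \<in> sets lebesgue" "\<And>k. f k \<in> borel_measurable (lebesgue_on I)"
    and "AE x in lebesgue_on I. (\<lambda>k. f k x) \<longlonglongrightarrow> g x"
  shows "g \<in> borel_measurable (lebesgue_on I)"
proof (rule borel_measurable_AE_lebesgue_on[OF assms(1) borel_measurable_lim_metric[OF assms(2)]])
  show "AE x in lebesgue_on I. lim (\<lambda>k. f k x) = g x"
    using assms(3) by eventually_elim (rule limI)
qed

text \<open>A seminorm suffices, so both L2 and H1, whose elements are functions and not classes,
  are instances.\<close>

locale normed_function_space =
  fixes X :: "('b \<Rightarrow> real) set" and N :: "('b \<Rightarrow> real) \<Rightarrow> real"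
  assumes zero_in: "(\<lambda>x. 0) \<in> X"
    and add_in: "u \<in> X \<Longrightarrow> v \<in> X \<Longrightarrow> (\<lambda>x. u x + v x) \<in> X"
    and cmult_in: "u \<in> X \<Longrightarrow> (\<lambda>x. c * u x) \<in> X"
    and N_nonneg: "0 \<le> N u"
    and N_triangle: "u \<in> X \<Longrightarrow> v \<in> X \<Longrightarrow> N (\<lambda>x. u x + v x) \<le> N u + N v"
    and N_cmult: "u \<in> X \<Longrightarrow> N (\<lambda>x. c * u x) = \<bar>c\<bar> * N u"
begin

lemma diff_in: "u \<in> X \<Longrightarrow> v \<in> X \<Longrightarrow> (\<lambda>x. u x - v x) \<in> X"
  using add_in[OF _ cmult_in[of v "-1"], of u] by simp

lemma N_zero: "N (\<lambda>x. 0) = 0"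
  using N_cmult[OF zero_in, of 0] by simp

lemma N_diff_le: "u \<in> X \<Longrightarrow> v \<in> X \<Longrightarrow> N (\<lambda>x. u x - v x) \<le> N u + N v"
  using N_triangle[OF _ cmult_in[of v "-1"], of u] N_cmult[of v "-1"] by simp

lemma N_le_diff: "u \<in> X \<Longrightarrow> v \<in> X \<Longrightarrow> N u \<le> N v + N (\<lambda>x. u x - v x)"
  using N_triangle[of v "\<lambda>x. u x - v x"] diff_in[of u v] by simp

lemma bounded_form_diff_left:
  assumes "bounded_form X N Q" "u \<in> X" "v \<in> X" "w \<in> X"
  shows "Q (\<lambda>x. u x - v x) w = Q u w - Q v w"
  using bounded_form_add_left[OF assms(1,2) cmult_in[OF assms(3)] assms(4), of "-1"]
    bounded_form_cmult_left[OF assms(1,3,3,4), of "-1"] by simp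

lemma bounded_form_diff_right:
  assumes "bounded_form X N Q" "u \<in> X" "v \<in> X" "w \<in> X"
  shows "Q w (\<lambda>x. u x - v x) = Q w u - Q w v"
  using bounded_form_add_right[OF assms(1,2) cmult_in[OF assms(3)] assms(4), of "-1"]
    bounded_form_cmult_right[OF assms(1,3,3,4), of "-1"] by simp

text \<open>The first slot is replaced while the second still holds \<open>z' k\<close>, hence the
  assumed bound on the norms of \<open>z' k\<close>. The truncated approximations supply it.\<close>

lemma bounded_form_LIMSEQ:
  assumes Q: "bounded_form X N Q" and X: "\<And>k. z k \<in> X" "\<And>k. z' k \<in> X" "u \<in> X" "v \<in> X"
    and lim: "(\<lambda>k. N (\<lambda>x. z k x - u x)) \<longlonglongrightarrow> 0" "(\<lambda>k. N (\<lambda>x. z' k x - v x)) \<longlonglongrightarrow> 0"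
    and bound: "\<And>k. N (z' k) \<le> B"
  shows "(\<lambda>k. Q (z k) (z' k)) \<longlonglongrightarrow> Q u v"
proof -
  obtain C where C: "C \<ge> 0" "\<And>u v. u \<in> X \<Longrightarrow> v \<in> X \<Longrightarrow> \<bar>Q u v\<bar> \<le> C * (N u * N v)"
    using bounded_form_bound[OF Q] by blast
  have "(\<lambda>k. Q (z k) (z' k) - Q u v) \<longlonglongrightarrow> 0"
  proof (rule Lim_null_comparison)
    show "\<forall>\<^sub>F k in sequentially. norm (Q (z k) (z' k) - Q u v) \<le>
        C * (N (\<lambda>x. z k x - u x) * B) + C * (N u * N (\<lambda>x. z' k x - v x))"
    proof (intro always_eventually allI)
      fix k
      have "Q (z k) (z' k) - Q u v = Q (\<lambda>x. z k x - u x) (z' k) + Q u (\<lambda>x. z' k x - v x)"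
        using bounded_form_diff_left[OF Q X(1,3,2), of k k] bounded_form_diff_right[OF Q X(2,4,3), of k]
        by simp
      moreover have "\<bar>Q (\<lambda>x. z k x - u x) (z' k)\<bar> \<le> C * (N (\<lambda>x. z k x - u x) * N (z' k))"
        by (intro C diff_in X)
      moreover have "C * (N (\<lambda>x. z k x - u x) * N (z' k)) \<le> C * (N (\<lambda>x. z k x - u x) * B)"
        using bound by (intro mult_left_mono C N_nonneg)
      moreover have "\<bar>Q u (\<lambda>x. z' k x - v x)\<bar> \<le> C * (N u * N (\<lambda>x. z' k x - v x))"
        by (intro C diff_in X)
      ultimately show "norm (Q (z k) (z' k) - Q u v) \<le>
          C * (N (\<lambda>x. z k x - u x) * B) + C * (N u * N (\<lambda>x. z' k x - v x))"
        by simp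
    qed
    have "(\<lambda>k. C * (N (\<lambda>x. z k x - u x) * B) + C * (N u * N (\<lambda>x. z' k x - v x)))
        \<longlonglongrightarrow> C * (0 * B) + C * (N u * 0)"
      by (intro tendsto_intros lim)
    then show "(\<lambda>k. C * (N (\<lambda>x. z k x - u x) * B) + C * (N u * N (\<lambda>x. z' k x - v x))) \<longlonglongrightarrow> 0"
      by simp
  qed
  then show ?thesis
    by (simp add: LIM_zero_iff)
qed

text \<open>Truncating the approximating simple functions where they exceed twice the norm of the limit
  makes them dominated.\<close>

lemma bochner_L2_simple_approximation:
  fixes I :: "real set"
  assumes I: "I \<in> lmeasurable" and w: "bochner_L2 (lebesgue_on I) X N w"
  obtains z where "\<And>k. simple_function (lebesgue_on I) (z k)" "\<And>k t. t \<in> I \<Longrightarrow> z k t \<in> X"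
    "\<And>k t. N (z k t) \<le> 2 * N (w t)"
    "AE t in lebesgue_on I. (\<lambda>k. N (\<lambda>x. z k t x - w t x)) \<longlonglongrightarrow> 0"
    "AE t in lebesgue_on I. w t \<in> X"
    "integrable (lebesgue_on I) (\<lambda>t. N (w t))"
proof -
  let ?M = "lebesgue_on I"
  interpret finite_measure ?M
    using I by (rule finite_measure_lebesgue_on)
  obtain s where s: "\<And>k. simple_function ?M (s k)" "\<And>k. s k ` space ?M \<subseteq> X"
      "AE t in ?M. (\<lambda>k. N (\<lambda>x. s k t x - w t x)) \<longlonglongrightarrow> 0"
    and wX: "AE t in ?M. w t \<in> X" and sq: "integrable ?M (\<lambda>t. (N (w t))\<^sup>2)"
    using w unfolding bochner_L2_def strongly_measurable_def by blast
  have "(\<lambda>t. sqrt ((N (w t))\<^sup>2)) \<in> borel_measurable ?M"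
    using sq by measurable
  then have nmeas[measurable]: "(\<lambda>t. N (w t)) \<in> borel_measurable ?M"
    by (simp add: N_nonneg)
  have nint: "integrable ?M (\<lambda>t. N (w t))"
  proof (rule Bochner_Integration.integrable_bound[OF Bochner_Integration.integrable_add[OF integrable_const[of 1] sq] nmeas])
    have "a \<le> 1 + a\<^sup>2" for a :: real
      using zero_le_power2[of "a - 1/2"] by (simp add: power2_diff power_divide)
    then have "\<bar>N (w t)\<bar> \<le> \<bar>1 + (N (w t))\<^sup>2\<bar>" for t
      by (simp add: N_nonneg)
    then show "AE t in ?M. norm (N (w t)) \<le> norm (1 + (N (w t))\<^sup>2)"
      by simp
  qed
  define z where "z k t = (if N (s k t) \<le> 2 * N (w t) then s k t else (\<lambda>x. 0))" for k t
  have z_simple: "simple_function ?M (z k)" for k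
    unfolding z_def
  proof (rule simple_function_If)
    have "(\<lambda>t. N (s k t)) \<in> borel_measurable ?M"
      using simple_function_compose[OF s(1)[of k], of N]
      by (intro borel_measurable_simple_function) (simp add: comp_def)
    then show "{t \<in> space ?M. N (s k t) \<le> 2 * N (w t)} \<in> sets ?M"
      by measurable
  qed (use s in auto)
  have zX: "z k t \<in> X" if "t \<in> I" for k t
    using s(2)[of k] that zero_in by (auto simp: z_def)
  have zN: "N (z k t) \<le> 2 * N (w t)" for k t
    by (simp add: z_def N_zero N_nonneg)
  have "AE t in ?M. t \<in> space ?M" by (rule AE_space)
  then have "AE t in ?M. (\<lambda>k. N (\<lambda>x. z k t x - w t x)) \<longlonglongrightarrow> 0"
    using s(3) wX
  proof eventually_elim
    case (elim t)
    then have t: "t \<in> I" "w t \<in> X" by simp_all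
    have sX: "s k t \<in> X" for k
      using s(2)[of k] elim(1) by auto
    show ?case
    \<comment> \<open>Where the limit has seminorm zero, the truncated functions have seminorm zero
      too. Elsewhere the truncation is eventually inactive.\<close>
    proof (cases "N (w t) = 0")
      case True
      have "N (\<lambda>x. z k t x - w t x) = 0" for k
        using N_diff_le[OF zX[OF t(1)] t(2), of k] zN[of k t] True N_nonneg[of "\<lambda>x. z k t x - w t x"]
        by simp
      then show ?thesis by simp
    next
      case False
      then have "N (w t) > 0"
        using N_nonneg[of "w t"] by simp
      \<comment> \<open>An error below \<open>N (w t)\<close> keeps \<open>N (s k t)\<close> below
        twice that value. This is the origin of the threshold 2.\<close>
      then have "\<forall>\<^sub>F k in sequentially. N (\<lambda>x. s k t x - w t x) < N (w t)"
        using elim(2) by (intro order_tendstoD(2))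
      then have "\<forall>\<^sub>F k in sequentially. N (\<lambda>x. s k t x - w t x) = N (\<lambda>x. z k t x - w t x)"
      proof eventually_elim
        case (elim k)
        then have "N (s k t) \<le> 2 * N (w t)"
          using N_le_diff[OF sX t(2), of k] by simp
        then show ?case by (simp add: z_def)
      qed
      with elim(2) show ?thesis
        by (rule Lim_transform_eventually)
    qed
  qed
  from that[OF z_simple zX zN this wX nint] show thesis .
qed

text \<open>The vector \<open>y\<close> is the integral of \<open>z\<close> against \<psi>, here a
  finite sum. It is one and the same for all \<open>v\<close> and for both slots, so integrating in
  both variables yields \<open>Q y y\<close>.\<close>

lemma bounded_form_integral_simple:
  assumes Q: "bounded_form X N Q" and I: "I \<in> lmeasurable"
    and z: "simple_function (lebesgue_on I) z" "z ` I \<subseteq> X"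
    and \<psi>: "integrable (lebesgue_on I) \<psi>"
  obtains y where "y \<in> X"
    "\<And>v. v \<in> X \<Longrightarrow> (\<integral>t. Q (z t) v * \<psi> t \<partial>lebesgue_on I) = Q y v"
    "\<And>v. v \<in> X \<Longrightarrow> (\<integral>t. Q v (z t) * \<psi> t \<partial>lebesgue_on I) = Q v y"
proof -
  let ?M = "lebesgue_on I"
  define R where "R = z ` I"
  have fin: "finite R"
    using simple_functionD(1)[OF z(1)] by (simp add: R_def)
  define a where "a r = (\<integral>t. indicator {t\<in>I. z t = r} t * \<psi> t \<partial>?M)" for r
  have meas: "{t\<in>I. z t = r} \<in> sets ?M" for r
    using simple_functionD(2)[OF z(1), of "{r}"] by (simp add: vimage_def Int_def conj_commute)
  have int: "integrable ?M (\<lambda>t. indicator {t\<in>I. z t = r} t * \<psi> t)" for r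
    using integrable_real_mult_indicator[OF meas \<psi>] by (simp add: mult.commute)
  have expand: "(\<integral>t. G (z t) * \<psi> t \<partial>?M) = (\<Sum>r\<in>R. a r * G r)" for G :: "_ \<Rightarrow> real"
  proof -
    have "(\<integral>t. G (z t) * \<psi> t \<partial>?M) = (\<integral>t. (\<Sum>r\<in>R. G r * (indicator {t\<in>I. z t = r} t * \<psi> t)) \<partial>?M)"
    proof (rule Bochner_Integration.integral_cong[OF refl])
      fix t assume "t \<in> space ?M"
      then have "t \<in> I" "z t \<in> R" by (auto simp: R_def)
      then have "(\<Sum>r\<in>R. G r * (indicator {t\<in>I. z t = r} t * \<psi> t)) = (\<Sum>r\<in>R. if z t = r then G r * \<psi> t else 0)"
        by (intro sum.cong) (auto simp: indicator_def)
      then show "G (z t) * \<psi> t = (\<Sum>r\<in>R. G r * (indicator {t\<in>I. z t = r} t * \<psi> t))"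
        using fin \<open>z t \<in> R\<close> by simp
    qed
    also have "\<dots> = (\<Sum>r\<in>R. a r * G r)"
      using int by (simp add: a_def mult.commute)
    finally show ?thesis .
  qed
  let ?y = "\<lambda>x. \<Sum>r\<in>R. a r * r x"
  have y: "?y \<in> X \<and> Q ?y v = (\<Sum>r\<in>R. a r * Q r v) \<and> Q v ?y = (\<Sum>r\<in>R. a r * Q v r)" if "v \<in> X" for v
    using z(2) by (intro bounded_form_sum_left[OF Q zero_in add_in cmult_in fin _ that]) (auto simp: R_def)
  show thesis
  proof (rule that[of ?y])
    show "?y \<in> X" using y[OF zero_in] by blast
    show "(\<integral>t. Q (z t) v * \<psi> t \<partial>?M) = Q ?y v" if "v \<in> X" for v
      using expand[of "\<lambda>r. Q r v"] y[OF that] by simp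
    show "(\<integral>t. Q v (z t) * \<psi> t \<partial>?M) = Q v ?y" if "v \<in> X" for v
      using expand[of "\<lambda>r. Q v r"] y[OF that] by simp
  qed
qed

text \<open>For simple functions the double integral is \<open>Q y y\<close> with a single
  \<open>y\<close>. The general case follows by dominated convergence, in the inner variable for
  almost every s' and then in the outer one. The first conclusion supplies the integrability
  required when the weak equation is tested with \<open>w s'\<close>.\<close>

theorem bounded_form_double_integral_nonneg:
  fixes I :: "real set"
  assumes Q: "bounded_form X N Q" and Q_pos: "\<And>u. u \<in> X \<Longrightarrow> 0 \<le> Q u u"
    and I: "I \<in> lmeasurable" and w: "bochner_L2 (lebesgue_on I) X N w"
    and \<psi>: "\<psi> \<in> borel_measurable (lebesgue_on I)" "\<And>t. \<bar>\<psi> t\<bar> \<le> c"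
  shows "AE s' in lebesgue_on I. integrable (lebesgue_on I) (\<lambda>s. Q (w s) (w s') * \<psi> s)"
    and "0 \<le> (\<integral>s'. (\<integral>s. Q (w s) (w s') * \<psi> s \<partial>lebesgue_on I) * \<psi> s' \<partial>lebesgue_on I)"
proof -
  let ?M = "lebesgue_on I"
  interpret finite_measure ?M
    using I by (rule finite_measure_lebesgue_on)
  have Im: "I \<in> sets lebesgue" using I by (rule fmeasurableD)
  obtain C where C: "C \<ge> 0" "\<And>u v. u \<in> X \<Longrightarrow> v \<in> X \<Longrightarrow> \<bar>Q u v\<bar> \<le> C * (N u * N v)"
    using bounded_form_bound[OF Q] by blast
  have c: "c \<ge> 0" using \<psi>(2)[of 0] by simp
  have \<psi>int: "integrable ?M \<psi>"
    using \<psi> by (intro integrable_const_bound[where B = c]) auto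
  obtain z where z: "\<And>k. simple_function ?M (z k)" "\<And>k t. t \<in> I \<Longrightarrow> z k t \<in> X"
      "\<And>k t. N (z k t) \<le> 2 * N (w t)"
      "AE t in ?M. (\<lambda>k. N (\<lambda>x. z k t x - w t x)) \<longlonglongrightarrow> 0"
    and wX: "AE t in ?M. w t \<in> X" and nint: "integrable ?M (\<lambda>t. N (w t))"
    using bochner_L2_simple_approximation[OF I w] by blast
  have zmeas: "(\<lambda>t. G (z k t)) \<in> borel_measurable ?M" for G :: "_ \<Rightarrow> real" and k
    using simple_function_compose[OF z(1)[of k], of G]
    by (intro borel_measurable_simple_function) (simp add: comp_def)
  define F where "F k s' = (\<integral>s. Q (z k s) (z k s') * \<psi> s \<partial>?M)" for k s'
  define G where "G s' = (\<integral>s. Q (w s) (w s') * \<psi> s \<partial>?M)" for s'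
  \<comment> \<open>Each slot is truncated at twice the norm of \<open>w\<close>, which gives the 4;
    \<open>c\<close> bounds \<psi>. The bound does not depend on \<open>k\<close> and serves as the
    majorant.\<close>
  have Qbound: "\<bar>Q (z k s) (z k s') * \<psi> s\<bar> \<le> 4 * C * c * N (w s') * N (w s)" if "s \<in> I" "s' \<in> I" for k s s'
  proof -
    have "\<bar>Q (z k s) (z k s')\<bar> \<le> C * (N (z k s) * N (z k s'))"
      by (intro C z that)
    also have "\<dots> \<le> C * ((2 * N (w s)) * (2 * N (w s')))"
      by (intro mult_left_mono mult_mono C z) (simp_all add: N_nonneg)
    finally have "\<bar>Q (z k s) (z k s')\<bar> * \<bar>\<psi> s\<bar> \<le> C * ((2 * N (w s)) * (2 * N (w s'))) * c"
      using \<psi>(2)[of s] C(1) by (intro mult_mono) (simp_all add: N_nonneg)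
    then show ?thesis by (simp add: abs_mult mult_ac)
  qed
  have limQ: "AE s in ?M. (\<lambda>k. Q (z k s) (z k s') * \<psi> s) \<longlonglongrightarrow> Q (w s) (w s') * \<psi> s"
    if "s' \<in> I" "w s' \<in> X" "(\<lambda>k. N (\<lambda>x. z k s' x - w s' x)) \<longlonglongrightarrow> 0" for s'
    using AE_space[of ?M] wX z(4)
  proof eventually_elim
    case (elim s)
    then have "(\<lambda>k. Q (z k s) (z k s')) \<longlonglongrightarrow> Q (w s) (w s')"
      by (intro bounded_form_LIMSEQ[OF Q _ _ elim(2) that(2) elim(3) that(3) z(3)] z(2) that) simp_all
    then show ?case by (rule tendsto_mult_right)
  qed
  have inner: "integrable ?M (\<lambda>s. Q (w s) (w s') * \<psi> s) \<and> (\<lambda>k. F k s') \<longlonglongrightarrow> G s'"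
    if s': "s' \<in> I" "w s' \<in> X" "(\<lambda>k. N (\<lambda>x. z k s' x - w s' x)) \<longlonglongrightarrow> 0" for s'
  proof
    have m: "(\<lambda>s. Q (z k s) (z k s') * \<psi> s) \<in> borel_measurable ?M" for k
      using zmeas[of "\<lambda>y. Q y (z k s')" k] \<psi>(1) by (intro borel_measurable_times)
    have m': "(\<lambda>s. Q (w s) (w s') * \<psi> s) \<in> borel_measurable ?M"
      by (rule borel_measurable_AE_LIMSEQ_lebesgue_on[OF Im m limQ[OF s']])
    have b: "AE s in ?M. norm (Q (z k s) (z k s') * \<psi> s) \<le> 4 * C * c * N (w s') * N (w s)" for k
      using Qbound[OF _ s'(1)] by (intro AE_I2) simp
    have d: "integrable ?M (\<lambda>s. 4 * C * c * N (w s') * N (w s))"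
      using nint by simp
    show "integrable ?M (\<lambda>s. Q (w s) (w s') * \<psi> s)"
      by (rule integrable_dominated_convergence[OF m' m d limQ[OF s'] b])
    show "(\<lambda>k. F k s') \<longlonglongrightarrow> G s'"
      unfolding F_def G_def by (rule integral_dominated_convergence[OF m' m d limQ[OF s'] b])
  qed
  have good: "AE s' in ?M. integrable ?M (\<lambda>s. Q (w s) (w s') * \<psi> s) \<and> (\<lambda>k. F k s') \<longlonglongrightarrow> G s'"
    using AE_space[of ?M] wX z(4) by eventually_elim (use inner in simp)
  then show "AE s' in ?M. integrable ?M (\<lambda>s. Q (w s) (w s') * \<psi> s)"
    by eventually_elim simp
  have Fnonneg: "0 \<le> (\<integral>s'. F k s' * \<psi> s' \<partial>?M)" for k
  proof -
    obtain y where y: "y \<in> X" "\<And>v. v \<in> X \<Longrightarrow> (\<integral>t. Q (z k t) v * \<psi> t \<partial>?M) = Q y v"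
      "\<And>v. v \<in> X \<Longrightarrow> (\<integral>t. Q v (z k t) * \<psi> t \<partial>?M) = Q v y"
      using bounded_form_integral_simple[OF Q I z(1)[of k] _ \<psi>int] z(2)[of _ k] by blast
    have "(\<integral>s'. F k s' * \<psi> s' \<partial>?M) = (\<integral>s'. Q y (z k s') * \<psi> s' \<partial>?M)"
      by (rule Bochner_Integration.integral_cong) (auto simp: F_def y(2) z(2))
    also have "\<dots> = Q y y"
      by (rule y(3)[OF y(1)])
    finally show ?thesis using Q_pos[OF y(1)] by simp
  qed
  have Fmeas: "(\<lambda>s'. F k s' * \<psi> s') \<in> borel_measurable ?M" for k
    unfolding F_def using zmeas[of "\<lambda>y. \<integral>s. Q (z k s) y * \<psi> s \<partial>?M" k] \<psi>(1)
    by (intro borel_measurable_times)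
  have Flim: "AE s' in ?M. (\<lambda>k. F k s' * \<psi> s') \<longlonglongrightarrow> G s' * \<psi> s'"
    using good by eventually_elim (intro tendsto_mult_right, simp)
  define K where "K = 4 * C * c * (\<integral>s. N (w s) \<partial>?M) * c"
  have Fbound: "AE s' in ?M. norm (F k s' * \<psi> s') \<le> K * N (w s')" for k
  proof (rule AE_I2)
    fix s' assume "s' \<in> space ?M"
    then have s': "s' \<in> I" by simp
    have d: "integrable ?M (\<lambda>s. 4 * C * c * N (w s') * N (w s))"
      using nint by simp
    have "\<bar>F k s'\<bar> \<le> (\<integral>s. 4 * C * c * N (w s') * N (w s) \<partial>?M)"
    proof -
      have "integrable ?M (\<lambda>s. Q (z k s) (z k s') * \<psi> s)"
        by (rule Bochner_Integration.integrable_bound[OF d])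
          (use zmeas[of "\<lambda>y. Q y (z k s')" k] \<psi>(1) Qbound[OF _ s'] in
            \<open>auto intro!: AE_I2 borel_measurable_times order_trans[OF _ abs_ge_self]\<close>)
      moreover have "\<bar>F k s'\<bar> \<le> (\<integral>s. \<bar>Q (z k s) (z k s') * \<psi> s\<bar> \<partial>?M)"
        unfolding F_def by (rule integral_abs_bound)
      ultimately show ?thesis
        using d Qbound[OF _ s'] by (elim order_trans) (intro integral_mono, auto)
    qed
    then have "\<bar>F k s'\<bar> * \<bar>\<psi> s'\<bar> \<le> (\<integral>s. 4 * C * c * N (w s') * N (w s) \<partial>?M) * c"
      using \<psi>(2)[of s'] by (intro mult_mono) auto
    then show "norm (F k s' * \<psi> s') \<le> K * N (w s')"
      by (simp add: K_def abs_mult mult_ac)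
  qed
  have Gmeas: "(\<lambda>s'. G s' * \<psi> s') \<in> borel_measurable ?M"
    by (rule borel_measurable_AE_LIMSEQ_lebesgue_on[OF Im Fmeas Flim])
  have dom: "integrable ?M (\<lambda>s'. K * N (w s'))"
    using nint by simp
  have "(\<lambda>k. \<integral>s'. F k s' * \<psi> s' \<partial>?M) \<longlonglongrightarrow> (\<integral>s'. G s' * \<psi> s' \<partial>?M)"
    by (rule integral_dominated_convergence[OF Gmeas Fmeas dom Flim Fbound])
  then have "0 \<le> (\<integral>s'. G s' * \<psi> s' \<partial>?M)"
    using Fnonneg by (intro LIMSEQ_le_const) auto
  then show "0 \<le> (\<integral>s'. (\<integral>s. Q (w s) (w s') * \<psi> s \<partial>?M) * \<psi> s' \<partial>?M)"
    by (simp add: G_def)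
qed

text \<open>Used to pass from the flow to its difference from the fixed point. Subtracting
  \<open>p\<close> from the simple approximants keeps them simple, and the norm is measurable as the
  limit of their norms.\<close>

lemma bochner_L2_diff_const:
  fixes I :: "real set"
  assumes I: "I \<in> lmeasurable" and w: "bochner_L2 (lebesgue_on I) X N w" and p: "p \<in> X"
  shows "bochner_L2 (lebesgue_on I) X N (\<lambda>t x. w t x - p x)"
proof -
  let ?M = "lebesgue_on I"
  interpret finite_measure ?M
    using I by (rule finite_measure_lebesgue_on)
  obtain s where s: "\<And>k. simple_function ?M (s k)" "\<And>k. s k ` space ?M \<subseteq> X"
      "AE t in ?M. (\<lambda>k. N (\<lambda>x. s k t x - w t x)) \<longlonglongrightarrow> 0"
    and wX: "AE t in ?M. w t \<in> X" and sq: "integrable ?M (\<lambda>t. (N (w t))\<^sup>2)"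
    using w unfolding bochner_L2_def strongly_measurable_def by blast
  define s' where "s' k t x = s k t x - p x" for k t x
  have s'X: "s' k t \<in> X" if "t \<in> space ?M" for k t
    using s(2)[of k] that p unfolding s'_def[abs_def] by (intro diff_in) auto
  have s'simple: "simple_function ?M (s' k)" for k
    using simple_function_compose[OF s(1)[of k], of "\<lambda>u x. u x - p x"]
    by (simp add: comp_def s'_def[abs_def])
  have s'lim: "AE t in ?M. (\<lambda>k. N (\<lambda>x. s' k t x - (w t x - p x))) \<longlonglongrightarrow> 0"
    using s(3) by (simp add: s'_def)
  have w'X: "AE t in ?M. (\<lambda>x. w t x - p x) \<in> X"
    using wX by eventually_elim (simp add: diff_in p)
  have strong: "strongly_measurable ?M X N (\<lambda>t x. w t x - p x)"
    unfolding strongly_measurable_def using w'X s'X s'simple s'lim by blast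
  have Nlim: "AE t in ?M. (\<lambda>k. N (s' k t)) \<longlonglongrightarrow> N (\<lambda>x. w t x - p x)"
    using AE_space[of ?M] w'X s'lim
  proof eventually_elim
    case (elim t)
    have "\<bar>N (s' k t) - N (\<lambda>x. w t x - p x)\<bar> \<le> N (\<lambda>x. s' k t x - (w t x - p x))" for k
    proof -
      have "N (\<lambda>x. (w t x - p x) - s' k t x) = N (\<lambda>x. s' k t x - (w t x - p x))"
        using N_cmult[OF diff_in[OF s'X[OF elim(1)] elim(2)], of "-1" k] by simp
      then show ?thesis
        using N_le_diff[OF s'X[OF elim(1)] elim(2), of k] N_le_diff[OF elim(2) s'X[OF elim(1)], of k]
        by simp
    qed
    then have "(\<lambda>k. N (s' k t) - N (\<lambda>x. w t x - p x)) \<longlonglongrightarrow> 0"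
      by (intro Lim_null_comparison[OF _ elim(3)]) simp
    then show ?case by (simp add: LIM_zero_iff)
  qed
  have s'N: "(\<lambda>t. N (s' k t)) \<in> borel_measurable ?M" for k
    using simple_function_compose[OF s'simple[of k], of N]
    by (intro borel_measurable_simple_function) (simp add: comp_def)
  have nmeas: "(\<lambda>t. N (\<lambda>x. w t x - p x)) \<in> borel_measurable ?M"
    by (rule borel_measurable_AE_LIMSEQ_lebesgue_on[OF fmeasurableD[OF I] s'N Nlim])
  have "integrable ?M (\<lambda>t. (N (\<lambda>x. w t x - p x))\<^sup>2)"
  proof (rule Bochner_Integration.integrable_bound)
    show "integrable ?M (\<lambda>t. 2 * (N (w t))\<^sup>2 + 2 * (N p)\<^sup>2)"
      using sq by simp
    show "(\<lambda>t. (N (\<lambda>x. w t x - p x))\<^sup>2) \<in> borel_measurable ?M"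
      using nmeas by simp
    show "AE t in ?M. norm ((N (\<lambda>x. w t x - p x))\<^sup>2) \<le> norm (2 * (N (w t))\<^sup>2 + 2 * (N p)\<^sup>2)"
      using wX
    proof eventually_elim
      case (elim t)
      have "(N (\<lambda>x. w t x - p x))\<^sup>2 \<le> (N (w t) + N p)\<^sup>2"
        by (intro power_mono N_diff_le elim p N_nonneg)
      also have "\<dots> \<le> 2 * (N (w t))\<^sup>2 + 2 * (N p)\<^sup>2"
        using sum_squares_bound[of "N (w t)" "N p"] by (simp add: power2_sum)
      finally show ?case by simp
    qed
  qed
  with strong show ?thesis by (simp add: bochner_L2_def)
qed

end

lemma normed_function_space_H1:
  fixes S :: "(real^'n::finite) set"
  assumes S: "open S" "bounded S"
  shows "normed_function_space (H1 S) (H1_norm S)"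
proof
  have "has_weak_partial S i (\<lambda>x. 0) (\<lambda>x. 0)" for i
    by (simp add: has_weak_partial_def locally_integrable_def)
  moreover have "(\<lambda>x. 0) \<in> L2 S"
    by (simp add: L2_def)
  ultimately show "(\<lambda>x. 0) \<in> H1 S"
    unfolding H1_def by blast
qed (use S in \<open>auto intro: H1_add H1_cmult H1_norm_nonneg H1_norm_triangle H1_norm_cmult\<close>)

section \<open>Mollified energy\<close>

lemma bump_algebra_real_derivative:
  assumes "bump_algebra (f :: real \<Rightarrow> real)"
  obtains f' where "\<And>x. (f has_real_derivative f' x) (at x)" "continuous_on UNIV f'"
proof -
  obtain F where F: "\<And>x. (f has_derivative F x) (at x)" "\<And>h. bump_algebra (\<lambda>x. F x h)"
    using bump_algebra_derivative[OF assms] by blast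
  have Fh: "F x h = F x 1 * h" for x h
    using linear_cmul[OF has_derivative_linear[OF F(1)], of x h 1] by simp
  have "F x = (*) (F x 1)" for x
    by (rule ext, rule Fh)
  then have "(f has_real_derivative F x 1) (at x)" for x
    using F(1)[of x] unfolding has_field_derivative_def by metis
  moreover have "continuous_on UNIV (\<lambda>x. F x 1)"
    by (rule bump_algebra_continuous[OF F(2)])
  ultimately show thesis by (rule that)
qed

lemma test_function_ball_bump:
  assumes "e > 0" "cball c e \<subseteq> S"
  shows "test_function S (ball_bump c e)"
  using assms bump_algebra_smooth[OF ball_bump_bump_algebra[of c e]]
  by (simp add: test_function_def ball_bump_support)

text \<open>The weak formulation is stated with Lebesgue integrals over open intervals, whereas the
  Leibniz rule and Fubini for continuous functions concern gauge integrals over closed boxes. These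
  two facts connect them.\<close>

lemma
  fixes g :: "real \<Rightarrow> real"
  assumes "continuous_on {a..b} g"
  shows integrable_Ioo_continuous: "integrable (lebesgue_on {a<..<b}) g"
    and integral_Ioo_continuous: "integral\<^sup>L (lebesgue_on {a<..<b}) g = integral {a..b} g"
proof -
  have "set_integrable lebesgue {a..b} g"
    using absolutely_integrable_continuous_real[OF assms] .
  then have "set_integrable lebesgue {a<..<b} g"
    by (rule set_integrable_subset) auto
  then show int: "integrable (lebesgue_on {a<..<b}) g"
    by (simp add: set_integrable_def integrable_restrict_space)
  show "integral\<^sup>L (lebesgue_on {a<..<b}) g = integral {a..b} g"
    using lebesgue_integral_eq_integral[OF int] by (simp add: integral_open_interval_real)
qed

text \<open>The second equation exchanges the names of the two times. With a symmetric kernel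
  function it identifies the two terms produced by the product rule.\<close>

lemma integral_square_iterated:
  fixes A :: "real \<Rightarrow> real \<Rightarrow> real"
  assumes A: "continuous_on (cbox (a,a) (b,b)) (\<lambda>(x,y). A x y)"
  shows "integral (cbox (a,a) (b,b)) (\<lambda>(x,y). A x y) = integral {a..b} (\<lambda>y. integral {a..b} (\<lambda>x. A x y))"
    and "integral (cbox (a,a) (b,b)) (\<lambda>(x,y). A y x) = integral {a..b} (\<lambda>y. integral {a..b} (\<lambda>x. A x y))"
proof -
  show *: "integral (cbox (a,a) (b,b)) (\<lambda>(x,y). A x y) = integral {a..b} (\<lambda>y. integral {a..b} (\<lambda>x. A x y))"
    using integral_prod_continuous[OF A] integral_swap_continuous[OF A] by simp
  show "integral (cbox (a,a) (b,b)) (\<lambda>(x,y). A y x) = integral {a..b} (\<lambda>y. integral {a..b} (\<lambda>x. A x y))"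
    using integral_swap_2dim[OF A] * by simp
qed

text \<open>Here \<open>f x y\<close> stands for the inner product of the solution at the times x
  and y, so only scalar calculus remains. Differentiating the two kernels in \<open>t\<close> gives
  \<open>- 2 * J t\<close>; the hypothesis at the kernel centred at \<open>t\<close> bounds
  \<open>J t\<close> below by \<open>lam * \<Phi> t\<close>. The decay is then Gronwall's
  inequality.\<close>

lemma mollified_energy_decay_aux:
  fixes f :: "real \<Rightarrow> real \<Rightarrow> real"
  assumes cont: "continuous_on (cbox (0,0) (\<tau>,\<tau>)) (\<lambda>(x,y). f x y)"
    and sym: "\<And>x y. f x y = f y x"
    and ineq: "\<And>\<psi>. test_function {0<..<\<tau>} \<psi> \<Longrightarrow> (\<And>s. \<bar>\<psi> s\<bar> \<le> 1) \<Longrightarrow>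
       lam * integral {0..\<tau>} (\<lambda>y. integral {0..\<tau>} (\<lambda>x. f x y * \<psi> x) * \<psi> y)
       \<le> integral {0..\<tau>} (\<lambda>y. integral {0..\<tau>} (\<lambda>x. f x y * deriv \<psi> x) * \<psi> y)"
    and ab: "e > 0" "e < a" "a \<le> b" "b + e < \<tau>"
  defines "\<Phi> \<equiv> \<lambda>t. integral (cbox (0,0) (\<tau>,\<tau>)) (\<lambda>(x,y). f x y * (ball_bump t e x * ball_bump t e y))"
  shows "\<Phi> b \<le> exp (- (2 * lam * (b - a))) * \<Phi> a"
proof -
  let ?C = "cbox (0,0) (\<tau>,\<tau>) :: (real \<times> real) set"
  define k where "k = ball_bump (0::real) e"
  have bump: "ball_bump t e = (\<lambda>x. k (x - t))" for t
    by (simp add: k_def ball_bump_def fun_eq_iff)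
  obtain k' where k': "\<And>x. (k has_real_derivative k' x) (at x)" "continuous_on UNIV k'"
    using bump_algebra_real_derivative[OF ball_bump_bump_algebra[of "0::real" e]] unfolding k_def by blast
  have kc: "continuous_on UNIV k"
    using k'(1) by (meson DERIV_continuous_on has_field_derivative_at_within)
  have kshift: "((\<lambda>t. k (x - t)) has_real_derivative - k' (x - t)) (at t)" for x t
  proof -
    have "((\<lambda>t. x - t) has_real_derivative - 1) (at t)"
      by (auto intro!: derivative_eq_intros)
    from DERIV_chain2[OF k'(1) this] show ?thesis by simp
  qed
  have fc: "continuous_on (UNIV \<times> ?C) (\<lambda>z::real \<times> real \<times> real. f (fst (snd z)) (snd (snd z)))"
    using continuous_on_compose2[OF cont continuous_on_snd[OF continuous_on_id], of "UNIV \<times> ?C"]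
    by (auto simp: case_prod_beta)
  have ks: "continuous_on T (\<lambda>z. k (g z - h z))" "continuous_on T (\<lambda>z. k' (g z - h z))"
    if "continuous_on T g" "continuous_on T h" for T :: "'c::topological_space set" and g h
    using that by (auto intro!: continuous_on_compose2[OF kc] continuous_on_compose2[OF k'(2)] continuous_intros)
  have fC: "continuous_on ?C (\<lambda>z. f (fst z) (snd z))"
    using cont by (simp add: case_prod_beta)
  define G where "G t p = (case p of (x, y) \<Rightarrow>
      - (f x y * k' (x - t) * k (y - t)) + - (f x y * k (x - t) * k' (y - t)))" for t p
  have deriv: "(\<Phi> has_real_derivative integral ?C (G t)) (at t)" for t
    unfolding \<Phi>_def bump
  proof (rule leibniz_rule_field_derivative[where U = UNIV, simplified])
    fix t :: real and p :: "real \<times> real"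
    obtain x y where p: "p = (x, y)" by (cases p)
    have "((\<lambda>t. f x y * (k (x - t) * k (y - t))) has_real_derivative
        f x y * (- k' (x - t) * k (y - t) + - k' (y - t) * k (x - t))) (at t)"
      by (intro DERIV_cmult DERIV_mult kshift)
    then show "((\<lambda>t. case p of (x, y) \<Rightarrow> f x y * (k (x - t) * k (y - t))) has_real_derivative G t p) (at t)"
      by (simp add: p G_def algebra_simps)
  next
    fix t :: real
    show "(\<lambda>(x,y). f x y * (k (x - t) * k (y - t))) integrable_on ?C"
      unfolding case_prod_beta by (intro integrable_continuous continuous_intros fC ks)
  next
    show "continuous_on (UNIV \<times> ?C) (\<lambda>(t, p). G t p)"
      unfolding G_def case_prod_beta by (intro continuous_intros fc ks)
  qed
  \<comment> \<open>The term in which the derivative falls on the first kernel. Shifting the centre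
    \<open>t\<close> differentiates the kernel with the opposite sign, which is why \<open>J\<close>
    enters the derivative of the energy with a minus.\<close>
  define J where "J t = integral {0..\<tau>} (\<lambda>y. integral {0..\<tau>} (\<lambda>x. f x y * k' (x - t)) * k (y - t))" for t
  have Gint: "integral ?C (G t) = - 2 * J t" for t
  proof -
    have Ac: "continuous_on ?C (\<lambda>(x,y). f x y * k' (x - t) * k (y - t))"
      unfolding case_prod_beta by (intro continuous_intros fC ks)
    have Bc: "continuous_on ?C (\<lambda>(x,y). f x y * k (x - t) * k' (y - t))"
      unfolding case_prod_beta by (intro continuous_intros fC ks)
    have "integral {0..\<tau>} (\<lambda>y. integral {0..\<tau>} (\<lambda>x. f x y * k' (x - t) * k (y - t))) = J t"
      by (simp add: J_def)
    moreover have "(\<lambda>(x,y). f x y * k (x - t) * k' (y - t)) = (\<lambda>(x,y). f y x * k' (y - t) * k (x - t))"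
      by (auto simp: sym mult_ac)
    ultimately have "integral ?C (\<lambda>(x,y). f x y * k' (x - t) * k (y - t)) = J t"
      "integral ?C (\<lambda>(x,y). f x y * k (x - t) * k' (y - t)) = J t"
      using integral_square_iterated[OF Ac] by simp_all
    moreover have "integral ?C (G t) =
        - integral ?C (\<lambda>(x,y). f x y * k' (x - t) * k (y - t)) - integral ?C (\<lambda>(x,y). f x y * k (x - t) * k' (y - t))"
      using Henstock_Kurzweil_Integration.integral_diff[OF integrable_neg[OF integrable_continuous[OF Ac]]
          integrable_continuous[OF Bc]]
      by (simp add: G_def[abs_def] case_prod_unfold)
    ultimately show ?thesis
      by simp
  qed
  have J_ge: "lam * \<Phi> t \<le> J t" if "a \<le> t" "t \<le> b" for t
  proof -
    \<comment> \<open>The margins \<open>e < a\<close> and \<open>b + e < \<tau>\<close> keep the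
      kernel inside the open time interval, as a test function requires.\<close>
    have "cball t e \<subseteq> {0<..<\<tau>}"
      using ab that by (auto simp: cball_def dist_real_def)
    then have test: "test_function {0<..<\<tau>} (ball_bump t e)"
      by (rule test_function_ball_bump[OF ab(1)])
    have "((\<lambda>x. k (x - t)) has_real_derivative k' (x - t)) (at x)" for x
    proof -
      have "((\<lambda>x. x - t) has_real_derivative 1) (at x)"
        by (auto intro!: derivative_eq_intros)
      from DERIV_chain2[OF k'(1) this] show ?thesis by simp
    qed
    then have d: "deriv (\<lambda>x. k (x - t)) x = k' (x - t)" for x
      by (rule DERIV_imp_deriv)
    have Ac: "continuous_on ?C (\<lambda>(x,y). f x y * (k (x - t) * k (y - t)))"
      unfolding case_prod_beta by (intro continuous_intros fC ks)
    have "\<Phi> t = integral {0..\<tau>} (\<lambda>y. integral {0..\<tau>} (\<lambda>x. f x y * k (x - t)) * k (y - t))"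
      unfolding \<Phi>_def bump integral_square_iterated(1)[OF Ac]
      by (simp add: mult.assoc[symmetric])
    moreover have "\<bar>ball_bump t e s\<bar> \<le> 1" for s
      by (simp add: ball_bump_nonneg ball_bump_le)
    from ineq[OF test this]
    have "lam * integral {0..\<tau>} (\<lambda>y. integral {0..\<tau>} (\<lambda>x. f x y * k (x - t)) * k (y - t)) \<le> J t"
      by (simp add: J_def d bump)
    ultimately show ?thesis by simp
  qed
  \<comment> \<open>Gronwall by an integrating factor: the weighted energy has nonpositive
    derivative on the interval from \<open>a\<close> to \<open>b\<close>.\<close>
  have "exp (2 * lam * b) * \<Phi> b \<le> exp (2 * lam * a) * \<Phi> a"
  proof (rule DERIV_nonpos_imp_nonincreasing[OF ab(3)])
    fix t assume t: "a \<le> t" "t \<le> b"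
    have "((\<lambda>t. exp (2 * lam * t) * \<Phi> t) has_real_derivative
        exp (2 * lam * t) * (2 * lam * \<Phi> t - 2 * J t)) (at t)"
      by (auto intro!: derivative_eq_intros deriv simp: Gint algebra_simps)
    moreover have "exp (2 * lam * t) * (2 * lam * \<Phi> t - 2 * J t) \<le> 0"
      using J_ge[OF t] by (simp add: mult_le_0_iff)
    ultimately show "\<exists>y. ((\<lambda>t. exp (2 * lam * t) * \<Phi> t) has_real_derivative y) (at t) \<and> y \<le> 0"
      by blast
  qed
  then have "exp (- (2 * lam * b)) * (exp (2 * lam * b) * \<Phi> b) \<le> exp (- (2 * lam * b)) * (exp (2 * lam * a) * \<Phi> a)"
    by (rule mult_left_mono) simp
  moreover have "exp (- (2 * lam * b)) * (exp (2 * lam * b) * \<Phi> b) = \<Phi> b"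
    by (simp add: mult.assoc[symmetric] mult_exp_exp)
  moreover have "exp (- (2 * lam * b)) * exp (2 * lam * a) = exp (- (2 * lam * (b - a)))"
    by (simp add: mult_exp_exp right_diff_distrib)
  then have "exp (- (2 * lam * b)) * (exp (2 * lam * a) * \<Phi> a) = exp (- (2 * lam * (b - a))) * \<Phi> a"
    by (simp only: mult.assoc[symmetric])
  ultimately show ?thesis by simp
qed

text \<open>For a narrow kernel the mollified energy at \<open>t\<close> is \<open>f t t\<close>
  times the squared mass of the kernel, up to a relative error \<delta>. The squared mass is the
  same at \<open>a\<close> and at \<open>b\<close> and cancels.\<close>

lemma mollified_energy_decay:
  fixes f :: "real \<Rightarrow> real \<Rightarrow> real"
  assumes cont: "continuous_on (cbox (0,0) (\<tau>,\<tau>)) (\<lambda>(x,y). f x y)"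
    and sym: "\<And>x y. f x y = f y x"
    and ineq: "\<And>\<psi>. test_function {0<..<\<tau>} \<psi> \<Longrightarrow> (\<And>s. \<bar>\<psi> s\<bar> \<le> 1) \<Longrightarrow>
       lam * integral {0..\<tau>} (\<lambda>y. integral {0..\<tau>} (\<lambda>x. f x y * \<psi> x) * \<psi> y)
       \<le> integral {0..\<tau>} (\<lambda>y. integral {0..\<tau>} (\<lambda>x. f x y * deriv \<psi> x) * \<psi> y)"
    and ab: "0 < a" "a \<le> b" "b < \<tau>"
  shows "f b b \<le> exp (- (2 * lam * (b - a))) * f a a"
proof -
  let ?C = "cbox (0,0) (\<tau>,\<tau>) :: (real \<times> real) set"
  define E where "E = exp (- (2 * lam * (b - a)))"
  have "E > 0" by (simp add: E_def)
  have fC: "continuous_on ?C (\<lambda>z. f (fst z) (snd z))"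
    using cont by (simp add: case_prod_beta)
  \<comment> \<open>The error \<delta> is incurred once at \<open>b\<close> and once at
    \<open>a\<close>, there multiplied by the decay factor \<open>E\<close>.\<close>
  have "f b b \<le> E * f a a + (1 + E) * \<delta>" if "\<delta> > 0" for \<delta>
  proof -
    have near: "\<exists>d>0. \<forall>x\<in>{0..\<tau>}. \<forall>y\<in>{0..\<tau>}. \<bar>x - t\<bar> < d \<longrightarrow> \<bar>y - t\<bar> < d \<longrightarrow> \<bar>f x y - f t t\<bar> \<le> \<delta>"
      if t: "t \<in> {0..\<tau>}" for t
    proof -
      have "(t, t) \<in> ?C" using t by (simp add: cbox_Pair_eq)
      then obtain d where d: "d > 0" "\<And>z. z \<in> ?C \<Longrightarrow> dist z (t, t) < d \<Longrightarrow> dist (f (fst z) (snd z)) (f t t) < \<delta>"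
        using fC \<open>\<delta> > 0\<close> unfolding continuous_on_iff by fastforce
      have "\<bar>f x y - f t t\<bar> \<le> \<delta>" if "x \<in> {0..\<tau>}" "y \<in> {0..\<tau>}" "\<bar>x - t\<bar> < d / 2" "\<bar>y - t\<bar> < d / 2" for x y
      proof -
        have "dist (x, y) (t, t) \<le> dist x t + dist y t"
          unfolding dist_prod_def by (simp add: sqrt_sum_squares_le_sum)
        also have "\<dots> < d" using that by (simp add: dist_real_def)
        finally show ?thesis
          using d(2)[of "(x, y)"] that by (simp add: cbox_Pair_eq dist_real_def)
      qed
      with d(1) show ?thesis
        by (intro exI[of _ "d/2"]) auto
    qed
    obtain d1 where d1: "d1 > 0" "\<And>x y. x \<in> {0..\<tau>} \<Longrightarrow> y \<in> {0..\<tau>} \<Longrightarrow> \<bar>x - a\<bar> < d1 \<Longrightarrow> \<bar>y - a\<bar> < d1 \<Longrightarrow> \<bar>f x y - f a a\<bar> \<le> \<delta>"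
      using near[of a] ab by auto
    obtain d2 where d2: "d2 > 0" "\<And>x y. x \<in> {0..\<tau>} \<Longrightarrow> y \<in> {0..\<tau>} \<Longrightarrow> \<bar>x - b\<bar> < d2 \<Longrightarrow> \<bar>y - b\<bar> < d2 \<Longrightarrow> \<bar>f x y - f b b\<bar> \<le> \<delta>"
      using near[of b] ab by auto
    \<comment> \<open>Below \<open>d1\<close> and \<open>d2\<close> for continuity near the two
      diagonal points, below \<open>a\<close> and \<tau> - b for the support; halving makes all the
      inequalities strict.\<close>
    define e where "e = Min {d1, d2, a, \<tau> - b} / 2"
    have "0 < Min {d1, d2, a, \<tau> - b}" using d1 d2 ab by simp
    moreover have "Min {d1, d2, a, \<tau> - b} \<le> d1" "Min {d1, d2, a, \<tau> - b} \<le> d2"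
      "Min {d1, d2, a, \<tau> - b} \<le> a" "Min {d1, d2, a, \<tau> - b} \<le> \<tau> - b" by simp_all
    ultimately have e: "e > 0" "e < a" "b + e < \<tau>" "e < d1" "e < d2"
      unfolding e_def by linarith+
    have kc: "continuous_on T (ball_bump t e)" for t :: real and T
      by (rule bump_algebra_continuous[OF ball_bump_bump_algebra])
    define m where "m = (\<integral>x. ball_bump (0::real) e x \<partial>lebesgue)"
    have m: "integral {0..\<tau>} (ball_bump t e) = m" if "e < t" "t + e < \<tau>" for t
    proof -
      have "integral {0..\<tau>} (ball_bump t e) = integral\<^sup>L (lebesgue_on {0<..<\<tau>}) (ball_bump t e)"
        by (rule integral_Ioo_continuous[symmetric]) (rule kc)
      also have "\<dots> = integral\<^sup>L (lebesgue_on UNIV) (ball_bump t e)"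
      proof (rule integral_lebesgue_on_support_cong)
        have "ball_bump t e x = 0" if "x \<notin> {0<..<\<tau>}" for x
          using that \<open>e < t\<close> \<open>t + e < \<tau>\<close> by (auto simp: ball_bump_eq_0_iff[OF e(1)] dist_real_def)
        then show "(if x \<in> {0<..<\<tau>} then ball_bump t e x else 0) = (if x \<in> UNIV then ball_bump t e x else 0)" for x
          by simp
      qed auto
      also have "\<dots> = (\<integral>x. ball_bump 0 e (- t + x) \<partial>lebesgue)"
        by (simp add: lebesgue_on_UNIV_eq ball_bump_def[abs_def])
      also have "\<dots> = m"
        unfolding m_def using continuous_UNIV_measurable_lebesgue_on[OF kc, of UNIV 0]
        by (intro integral_lebesgue_translation) (simp add: lebesgue_on_UNIV_eq)
      finally show ?thesis .
    qed
    have "m > 0"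
    proof -
      have "0 \<le> integral {0..\<tau>} (ball_bump a e)"
        by (rule Henstock_Kurzweil_Integration.integral_nonneg[OF integrable_continuous_real[OF kc] ball_bump_nonneg])
      moreover have "integral {0..\<tau>} (ball_bump a e) \<noteq> 0"
      proof
        assume "integral {0..\<tau>} (ball_bump a e) = 0"
        then have "ball_bump a e a = 0"
          using integral_eq_0_iff[OF kc[of "{0..\<tau>}" a]] ab by (simp add: ball_bump_nonneg)
        then show False
          using ball_bump_eq_0_iff[OF e(1), of a a] e(1) by simp
      qed
      ultimately show ?thesis using m[of a] e ab by simp
    qed
    let ?w = "\<lambda>t (x, y). ball_bump t e x * ball_bump t e y"
    have wc: "continuous_on ?C (\<lambda>z. ball_bump t e (fst z) * ball_bump t e (snd z))" for t
      by (intro continuous_intros continuous_on_compose2[OF kc]) auto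
    have mass: "integral ?C (?w t) = m\<^sup>2" if "e < t" "t + e < \<tau>" for t
    proof -
      have "integral ?C (?w t) = integral {0..\<tau>} (\<lambda>y. integral {0..\<tau>} (\<lambda>x. ball_bump t e x * ball_bump t e y))"
        using wc[of t] by (intro integral_square_iterated(1)) (simp add: case_prod_beta)
      also have "\<dots> = m\<^sup>2"
        using m[OF that] by (simp add: power2_eq_square)
      finally show ?thesis .
    qed
    have cmass: "integral ?C (\<lambda>z. c * ?w t z) = c * m\<^sup>2" if "e < t" "t + e < \<tau>" for c t
      using mass[OF that] by (simp only: Henstock_Kurzweil_Integration.integral_mult_right)
    define \<Phi> where "\<Phi> t = integral ?C (\<lambda>(x,y). f x y * (ball_bump t e x * ball_bump t e y))" for t
    have fw: "(\<lambda>(x,y). f x y * (ball_bump t e x * ball_bump t e y)) integrable_on ?C" for t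
      unfolding case_prod_beta by (intro integrable_continuous continuous_on_mult fC wc)
    have cw: "(\<lambda>z. c * ?w t z) integrable_on ?C" for c t
      using wc[of t] by (intro integrable_continuous continuous_intros) (simp add: case_prod_beta)
    have close: "\<bar>f x y - f t t\<bar> * (ball_bump t e x * ball_bump t e y) \<le> \<delta> * (ball_bump t e x * ball_bump t e y)"
      if "(x, y) \<in> ?C" "t = a \<or> t = b" for x y t
    proof (cases "x \<in> ball t e \<and> y \<in> ball t e")
      case True
      then have "\<bar>f x y - f t t\<bar> \<le> \<delta>"
        using that d1(2)[of x y] d2(2)[of x y] e
        by (auto simp: cbox_Pair_eq dist_real_def abs_minus_commute)
      then show ?thesis
        by (intro mult_right_mono) (simp_all add: ball_bump_nonneg)
    next
      case False
      then have "ball_bump t e x = 0 \<or> ball_bump t e y = 0"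
        unfolding ball_bump_eq_0_iff[OF e(1)] by blast
      then show ?thesis by auto
    qed
    have "f b b * m\<^sup>2 - \<delta> * m\<^sup>2 \<le> \<Phi> b"
    proof -
      have "integral ?C (\<lambda>z. (f b b - \<delta>) * ?w b z) \<le> \<Phi> b"
        unfolding \<Phi>_def
      proof (rule integral_le[OF cw fw])
        fix z assume "z \<in> ?C"
        obtain x y where z: "z = (x, y)" by (cases z)
        have "(f b b - f x y) * (ball_bump b e x * ball_bump b e y) \<le> \<bar>f x y - f b b\<bar> * (ball_bump b e x * ball_bump b e y)"
          by (intro mult_right_mono) (simp_all add: ball_bump_nonneg)
        then show "(f b b - \<delta>) * ?w b z \<le> (case z of (x, y) \<Rightarrow> f x y * (ball_bump b e x * ball_bump b e y))"
          using close[of x y b] \<open>z \<in> ?C\<close> by (simp add: z left_diff_distrib)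
      qed
      then show ?thesis
        using cmass[of b "f b b - \<delta>"] e ab unfolding left_diff_distrib[of "f b b" \<delta> "m\<^sup>2"] by simp
    qed
    also have "\<Phi> b \<le> E * \<Phi> a"
      unfolding \<Phi>_def E_def
      by (rule mollified_energy_decay_aux[OF cont sym ineq e(1,2) ab(2) e(3)])
    also have "\<Phi> a \<le> f a a * m\<^sup>2 + \<delta> * m\<^sup>2"
    proof -
      have "\<Phi> a \<le> integral ?C (\<lambda>z. (f a a + \<delta>) * ?w a z)"
        unfolding \<Phi>_def
      proof (rule integral_le[OF fw cw])
        fix z assume "z \<in> ?C"
        obtain x y where z: "z = (x, y)" by (cases z)
        have "(f x y - f a a) * (ball_bump a e x * ball_bump a e y) \<le> \<bar>f x y - f a a\<bar> * (ball_bump a e x * ball_bump a e y)"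
          by (intro mult_right_mono) (simp_all add: ball_bump_nonneg)
        then show "(case z of (x, y) \<Rightarrow> f x y * (ball_bump a e x * ball_bump a e y)) \<le> (f a a + \<delta>) * ?w a z"
          using close[of x y a] \<open>z \<in> ?C\<close> by (simp add: z left_diff_distrib distrib_right)
      qed
      then show ?thesis
        using cmass[of a "f a a + \<delta>"] e ab unfolding distrib_right[of "f a a" \<delta> "m\<^sup>2"] by simp
    qed
    finally have "f b b * m\<^sup>2 - \<delta> * m\<^sup>2 \<le> E * (f a a * m\<^sup>2 + \<delta> * m\<^sup>2)"
      using \<open>E > 0\<close> by simp
    then have "f b b * m\<^sup>2 \<le> (E * f a a + (1 + E) * \<delta>) * m\<^sup>2"
      by (simp add: algebra_simps)
    then show ?thesis
      using \<open>m > 0\<close> by simp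
  qed
  note lim = this
  have "f b b \<le> E * f a a"
  proof (rule field_le_epsilon)
    fix \<eta> :: real assume "\<eta> > 0"
    then show "f b b \<le> E * f a a + \<eta>"
      using lim[of "\<eta> / (1 + E)"] \<open>E > 0\<close> by simp
  qed
  then show ?thesis by (simp add: E_def)
qed

section \<open>Decay of the flow\<close>

lemma normed_function_space_L2: "normed_function_space (L2 S) (L2_norm S)"
proof
  show "(\<lambda>x. 0) \<in> L2 S"
    by (simp add: L2_def)
qed (auto intro: L2_add L2_cmult L2_norm_nonneg L2_norm_triangle L2_norm_cmult)

text \<open>Continuity of the path in the L2 norm makes the pairing jointly continuous in the two
  times. That is what permits shrinking the kernel onto the diagonal.\<close>

lemma continuous_on_L2_inner:
  fixes v :: "'t::metric_space \<Rightarrow> real^'n::finite \<Rightarrow> real"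
  assumes v: "\<And>t. t \<in> T \<Longrightarrow> v t \<in> L2 S"
    and vc: "\<And>t. t \<in> T \<Longrightarrow> ((\<lambda>s. L2_norm S (\<lambda>x. v s x - v t x)) \<longlongrightarrow> 0) (at t within T)"
  shows "continuous_on (T \<times> T) (\<lambda>(s, s'). L2_inner S (v s) (v s'))"
proof -
  interpret normed_function_space "L2 S" "L2_norm S"
    by (rule normed_function_space_L2)
  define n where "n t s = L2_norm S (\<lambda>x. v s x - v t x)" for s t
  have n0: "n t t = 0" for t
    by (simp add: n_def N_zero)
  have nc: "continuous (at t within T) (n t)" if "t \<in> T" for t
    using vc[OF that] by (simp add: continuous_within n0) (simp add: n_def[abs_def])
  show ?thesis
    unfolding continuous_on
  proof clarify
    fix t t' assume t: "t \<in> T" "t' \<in> T"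
    let ?F = "at (t, t') within T \<times> T"
    have F: "\<forall>\<^sub>F p in ?F. fst p \<in> T \<and> snd p \<in> T"
      by (auto simp: eventually_at_filter intro!: always_eventually)
    have n1: "((\<lambda>p. n t (fst p)) \<longlongrightarrow> n t t) ?F"
      by (rule continuous_within_tendsto_compose[OF nc[OF t(1)]])
        (use F tendsto_fst[OF tendsto_ident_at, of "(t, t')" "T \<times> T"] in \<open>auto elim: eventually_mono\<close>)
    have n2: "((\<lambda>p. n t' (snd p)) \<longlongrightarrow> n t' t') ?F"
      by (rule continuous_within_tendsto_compose[OF nc[OF t(2)]])
        (use F tendsto_snd[OF tendsto_ident_at, of "(t, t')" "T \<times> T"] in \<open>auto elim: eventually_mono\<close>)
    have "((\<lambda>p. L2_inner S (v (fst p)) (v (snd p)) - L2_inner S (v t) (v t')) \<longlongrightarrow> 0) ?F"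
    proof (rule Lim_null_comparison)
      show "\<forall>\<^sub>F p in ?F. norm (L2_inner S (v (fst p)) (v (snd p)) - L2_inner S (v t) (v t')) \<le>
          n t (fst p) * (L2_norm S (v t') + n t' (snd p)) + L2_norm S (v t) * n t' (snd p)"
        using F
      proof eventually_elim
        case (elim p)
        then have p: "v (fst p) \<in> L2 S" "v (snd p) \<in> L2 S" and tt: "v t \<in> L2 S" "v t' \<in> L2 S"
          using v t by auto
        have "L2_inner S (v (fst p)) (v (snd p)) - L2_inner S (v t) (v t') =
            L2_inner S (\<lambda>x. v (fst p) x - v t x) (v (snd p)) + L2_inner S (v t) (\<lambda>x. v (snd p) x - v t' x)"
          using p tt by (simp add: L2_inner_diff_left L2_inner_diff_right)
        moreover have "\<bar>L2_inner S (\<lambda>x. v (fst p) x - v t x) (v (snd p))\<bar> \<le> n t (fst p) * L2_norm S (v (snd p))"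
          unfolding n_def by (intro L2_Cauchy_Schwarz L2_diff p tt)
        moreover have "n t (fst p) * L2_norm S (v (snd p)) \<le> n t (fst p) * (L2_norm S (v t') + n t' (snd p))"
          using N_le_diff[OF p(2) tt(2)] by (intro mult_left_mono) (simp_all add: n_def L2_norm_nonneg)
        moreover have "\<bar>L2_inner S (v t) (\<lambda>x. v (snd p) x - v t' x)\<bar> \<le> L2_norm S (v t) * n t' (snd p)"
          unfolding n_def by (intro L2_Cauchy_Schwarz L2_diff p tt)
        ultimately show ?case by simp
      qed
      have "((\<lambda>p. n t (fst p) * (L2_norm S (v t') + n t' (snd p)) + L2_norm S (v t) * n t' (snd p)) \<longlongrightarrow>
          n t t * (L2_norm S (v t') + n t' t') + L2_norm S (v t) * n t' t') ?F"
        by (intro tendsto_intros n1 n2)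
      then show "((\<lambda>p. n t (fst p) * (L2_norm S (v t') + n t' (snd p)) + L2_norm S (v t) * n t' (snd p)) \<longlongrightarrow> 0) ?F"
        by (simp add: n0)
    qed
    then show "((\<lambda>(s, s'). L2_inner S (v s) (v s')) \<longlongrightarrow> L2_inner S (v t) (v t')) ?F"
      by (simp add: LIM_zero_iff case_prod_beta')
  qed
qed

text \<open>Completeness supplies the measurability of \<open>g\<close>. Thus it applies to pairings
  such as \<open>V' t v * \<psi> t\<close>, whose measurability has not been established
  separately.\<close>

lemma integral_cong_AE_lebesgue_on:
  fixes f g :: "'a::euclidean_space \<Rightarrow> real"
  assumes "S \<in> sets lebesgue" "f \<in> borel_measurable (lebesgue_on S)"
    and "AE x in lebesgue_on S. f x = g x"
  shows "integral\<^sup>L (lebesgue_on S) f = integral\<^sup>L (lebesgue_on S) g"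
  by (rule integral_cong_AE[OF assms(2) borel_measurable_AE_lebesgue_on[OF assms] assms(3)])

text \<open>The weak equation for the difference from the fixed point, tested with a product of a
  function of time and a fixed \<open>v\<close>. The equation for \<open>P\<close> eliminates the
  reward, and the minus sign of the residual cancels the one from the weak time derivative.\<close>

lemma hjb_flow_tested:
  fixes S :: "(real^'n::finite) set"
  assumes S: "open S" "bounded S"
    and form: "bounded_form (H1 S) (H1_norm S) (hjb_form S \<gamma> b D)"
    and \<gamma>: "\<gamma> > 0"
    and fixed_point: "hjb_weak_solution S \<gamma> r b D P"
    and \<tau>: "\<tau> > 0"
    and V: "\<And>t. t \<ge> 0 \<Longrightarrow> V t \<in> L2 S"
      "\<And>t. t \<ge> 0 \<Longrightarrow> ((\<lambda>s. L2_norm S (\<lambda>x. V s x - V t x)) \<longlongrightarrow> 0) (at t within {0..})"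
    and VH1: "AE t in lebesgue_on {0<..<\<tau>}. V t \<in> H1 S"
    and weak: "has_weak_time_derivative S \<tau> V V'"
    and res: "AE t in lebesgue_on {0<..<\<tau>}. \<forall>v\<in>H1 S. V' t v = hjb_residual S \<gamma> r b D (V t) v"
    and \<psi>: "test_function {0<..<\<tau>} \<psi>"
    and v: "v \<in> H1 S"
    and int: "integrable (lebesgue_on {0<..<\<tau>}) (\<lambda>t. hjb_form S \<gamma> b D (\<lambda>x. V t x - P x) v * \<psi> t)"
  shows "(\<integral>t. hjb_form S \<gamma> b D (\<lambda>x. V t x - P x) v * \<psi> t \<partial>lebesgue_on {0<..<\<tau>}) =
    \<gamma> * integral {0..\<tau>} (\<lambda>t. L2_inner S (\<lambda>x. V t x - P x) v * deriv \<psi> t)"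
proof -
  let ?M = "lebesgue_on {0<..<\<tau>}" and ?B = "hjb_form S \<gamma> b D"
  interpret H1: normed_function_space "H1 S" "H1_norm S"
    by (rule normed_function_space_H1[OF S])
  have P: "P \<in> H1 S" "\<And>v. v \<in> H1 S \<Longrightarrow> ?B P v = L2_inner S r v"
    using fixed_point by (auto simp: hjb_weak_solution_def)
  have vL2: "v \<in> L2 S" and PL2: "P \<in> L2 S"
    using v P(1) by (auto intro: H1_L2)
  have "AE t in ?M. (- (1/\<gamma>)) * (?B (\<lambda>x. V t x - P x) v * \<psi> t) = V' t v * \<psi> t"
    using VH1 res
  proof eventually_elim
    case (elim t)
    then have "V' t v = - (1/\<gamma>) * (?B (V t) v - ?B P v)"
      using v P(2) by (simp add: hjb_residual_def)
    also have "\<dots> = - (1/\<gamma>) * ?B (\<lambda>x. V t x - P x) v"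
      using H1.bounded_form_diff_left[OF form elim(1) P(1) v] by simp
    finally show ?case by simp
  qed
  then have "(\<integral>t. (- (1/\<gamma>)) * (?B (\<lambda>x. V t x - P x) v * \<psi> t) \<partial>?M) = (\<integral>t. V' t v * \<psi> t \<partial>?M)"
    by (intro integral_cong_AE_lebesgue_on) (use int in auto)
  also have "\<dots> = - (\<integral>t. L2_inner S (V t) v * deriv \<psi> t \<partial>?M)"
    using weak \<psi> v by (simp add: has_weak_time_derivative_def)
  finally have 1: "(\<integral>t. ?B (\<lambda>x. V t x - P x) v * \<psi> t \<partial>?M) = \<gamma> * (\<integral>t. L2_inner S (V t) v * deriv \<psi> t \<partial>?M)"
    using \<gamma> by (simp add: field_simps)
  have \<psi>d: "(\<psi> has_real_derivative frechet_derivative \<psi> (at t) 1) (at t)" for t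
    using test_function_line_derivative[OF \<psi>, of 0 1 t] by simp
  then have deriv: "deriv \<psi> t = frechet_derivative \<psi> (at t) 1" for t
    by (rule DERIV_imp_deriv)
  have dc: "continuous_on T (deriv \<psi>)" for T
    unfolding deriv[abs_def]
    by (rule continuous_on_subset[OF test_function_derivative_continuous[OF \<psi>]]) auto
  have Vc: "continuous_on {0..\<tau>} (\<lambda>t. L2_inner S (V t) v)"
    unfolding continuous_on
  proof
    fix t assume t: "t \<in> {0..\<tau>}"
    have "((\<lambda>s. L2_inner S (V s) v - L2_inner S (V t) v) \<longlongrightarrow> 0) (at t within {0..})"
    proof (rule Lim_null_comparison)
      show "\<forall>\<^sub>F s in at t within {0..}. norm (L2_inner S (V s) v - L2_inner S (V t) v)
          \<le> L2_norm S (\<lambda>x. V s x - V t x) * L2_norm S v"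
        unfolding eventually_at_filter
      proof (intro always_eventually allI impI)
        fix s assume "s \<noteq> t" "s \<in> {0..}"
        then show "norm (L2_inner S (V s) v - L2_inner S (V t) v) \<le> L2_norm S (\<lambda>x. V s x - V t x) * L2_norm S v"
          using L2_Cauchy_Schwarz[OF L2_diff[OF V(1) V(1)] vL2, of s t] V(1)[of s] V(1)[of t] t vL2
          by (simp add: L2_inner_diff_left)
      qed
      show "((\<lambda>s. L2_norm S (\<lambda>x. V s x - V t x) * L2_norm S v) \<longlongrightarrow> 0) (at t within {0..})"
        using tendsto_mult_right[OF V(2), of t "L2_norm S v"] t by simp
    qed
    then have "((\<lambda>s. L2_inner S (V s) v) \<longlongrightarrow> L2_inner S (V t) v) (at t within {0..})"
      by (simp add: LIM_zero_iff)
    then show "((\<lambda>s. L2_inner S (V s) v) \<longlongrightarrow> L2_inner S (V t) v) (at t within {0..\<tau>})"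
      by (rule tendsto_within_subset) auto
  qed
  have "\<psi> t = 0" if "t \<notin> {0<..<\<tau>}" for t
    using \<psi> that by (intro test_function_eq_0) (unfold test_function_def, blast)
  then have supp: "\<psi> 0 = 0" "\<psi> \<tau> = 0"
    by simp_all
  \<comment> \<open>The derivative of a test function has integral zero, so the stationary
    \<open>P\<close> may be subtracted inside the inner product at no cost.\<close>
  have "(deriv \<psi> has_integral (\<psi> \<tau> - \<psi> 0)) {0..\<tau>}"
    using \<tau> \<psi>d by (intro fundamental_theorem_of_calculus)
      (auto simp: deriv has_real_derivative_iff_has_vector_derivative[symmetric] intro: has_field_derivative_at_within)
  then have d0: "(deriv \<psi> has_integral 0) {0..\<tau>}"
    by (simp add: supp)
  have "(\<integral>t. L2_inner S (V t) v * deriv \<psi> t \<partial>?M) = integral {0..\<tau>} (\<lambda>t. L2_inner S (V t) v * deriv \<psi> t)"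
    by (intro integral_Ioo_continuous continuous_on_mult Vc dc)
  also have "\<dots> = integral {0..\<tau>} (\<lambda>t. L2_inner S (V t) v * deriv \<psi> t) - L2_inner S P v * integral {0..\<tau>} (deriv \<psi>)"
    using integral_unique[OF d0] by simp
  also have "\<dots> = integral {0..\<tau>} (\<lambda>t. L2_inner S (V t) v * deriv \<psi> t - L2_inner S P v * deriv \<psi> t)"
  proof -
    have "(\<lambda>t. L2_inner S (V t) v * deriv \<psi> t) integrable_on {0..\<tau>}"
      "(\<lambda>t. L2_inner S P v * deriv \<psi> t) integrable_on {0..\<tau>}"
      by (intro integrable_continuous_real continuous_on_mult Vc dc continuous_on_const)+
    from Henstock_Kurzweil_Integration.integral_diff[OF this] show ?thesis
      by simp
  qed
  also have "\<dots> = integral {0..\<tau>} (\<lambda>t. L2_inner S (\<lambda>x. V t x - P x) v * deriv \<psi> t)"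
    using V(1) PL2 vL2
    by (intro Henstock_Kurzweil_Integration.integral_cong) (simp add: L2_inner_diff_left left_diff_distrib)
  finally show ?thesis
    using 1 by simp
qed

text \<open>Combines the tested equation with positivity of the shifted form \<open>Q\<close> to
  obtain the inequality needed by \<open>mollified_energy_decay\<close>, with rate
  \<open>c / \<gamma>\<close>.\<close>

lemma hjb_flow_decay:
  fixes S :: "(real^'n::finite) set"
  assumes S: "open S" "bounded S"
    and form: "bounded_form (H1 S) (H1_norm S) (hjb_form S \<gamma> b D)"
    and \<gamma>: "\<gamma> > 0"
    and c: "c > 0" "\<And>v. v \<in> H1 S \<Longrightarrow> c * (H1_norm S v)\<^sup>2 \<le> hjb_form S \<gamma> b D v v"
    and fixed_point: "hjb_weak_solution S \<gamma> r b D P"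
    and V0: "V0 \<in> L2 S"
    and flow: "hjb_flow S \<gamma> r b D V0 V"
    and t: "t \<ge> 0"
  shows "L2_norm S (\<lambda>x. V t x - P x) \<le> exp (- (c / \<gamma>) * t) * L2_norm S (\<lambda>x. V0 x - P x)"
proof -
  let ?B = "hjb_form S \<gamma> b D"
  interpret H1: normed_function_space "H1 S" "H1_norm S"
    by (rule normed_function_space_H1[OF S])
  have P: "P \<in> H1 S"
    using fixed_point by (auto simp: hjb_weak_solution_def)
  have PL2: "P \<in> L2 S"
    using P by (rule H1_L2)
  have V: "\<And>t. t \<ge> 0 \<Longrightarrow> V t \<in> L2 S"
      "\<And>t. t \<ge> 0 \<Longrightarrow> ((\<lambda>s. L2_norm S (\<lambda>x. V s x - V t x)) \<longlongrightarrow> 0) (at t within {0..})"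
    using flow by (auto simp: hjb_flow_def)
  define W where "W t x = V t x - P x" for t x
  define f where "f s s' = L2_inner S (W s) (W s')" for s s'
  have WL2: "W t \<in> L2 S" if "t \<ge> 0" for t
    unfolding W_def using V(1)[OF that] PL2 by (rule L2_diff)
  have fc: "continuous_on ({0..} \<times> {0..}) (\<lambda>(s, s'). f s s')"
    unfolding f_def by (rule continuous_on_L2_inner) (use WL2 V(2) in \<open>auto simp: W_def\<close>)
  \<comment> \<open>Nonnegative on the diagonal, by coercivity together with the L2 norm being at
    most the H1 norm. The subtracted term is what yields decay rather than mere
    monotonicity.\<close>
  define Q where "Q u v = ?B u v - c * L2_inner S u v" for u v
  have inner_form: "bounded_form (H1 S) (H1_norm S) (L2_inner S)"
    by (rule bounded_form_L2_inner[OF S])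
  have Q: "bounded_form (H1 S) (H1_norm S) Q"
    unfolding Q_def[abs_def] by (intro bounded_form_diff form bounded_form_cmult inner_form)
  have Q_pos: "0 \<le> Q u u" if "u \<in> H1 S" for u
  proof -
    have "c * (L2_norm S u)\<^sup>2 \<le> c * (H1_norm S u)\<^sup>2"
      using c(1) L2_norm_le_H1_norm by (intro mult_left_mono power_mono) (auto simp: L2_norm_nonneg)
    with c(2)[OF that] show ?thesis
      by (simp add: Q_def L2_norm_power2_inner)
  qed
  have decay: "f q q \<le> exp (- (2 * (c / \<gamma>) * (q - p))) * f p p" if pq: "0 < p" "p \<le> q" for p q
  proof -
    \<comment> \<open>The horizon must exceed \<open>q\<close>, leaving room for a kernel centred
      there.\<close>
    define \<tau> where "\<tau> = q + 1"
    have \<tau>: "\<tau> > 0" "q < \<tau>" using pq by (auto simp: \<tau>_def)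
    let ?M = "lebesgue_on {0<..<\<tau>}"
    have I: "{0<..<\<tau>} \<in> lmeasurable" by simp
    obtain V' where V': "bochner_L2 ?M (H1 S) (H1_norm S) V" "has_weak_time_derivative S \<tau> V V'"
      "AE t in ?M. \<forall>v\<in>H1 S. V' t v = hjb_residual S \<gamma> r b D (V t) v"
      using flow \<tau>(1) unfolding hjb_flow_def by blast
    have VH1: "AE t in ?M. V t \<in> H1 S"
      using V'(1) by (auto simp: bochner_L2_def strongly_measurable_def)
    have Wb: "bochner_L2 ?M (H1 S) (H1_norm S) W"
      unfolding W_def[abs_def] by (rule H1.bochner_L2_diff_const[OF I V'(1) P])
    have fc\<tau>: "continuous_on ({0..\<tau>} \<times> {0..\<tau>}) (\<lambda>(s, s'). f s s')"
      by (rule continuous_on_subset[OF fc]) auto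
    have cont: "continuous_on (cbox (0,0) (\<tau>,\<tau>)) (\<lambda>(s, s'). f s s')"
      using fc\<tau> by (simp add: cbox_Pair_eq)
    have fs: "continuous_on {0..\<tau>} (\<lambda>s. f s s')" if "s' \<in> {0..\<tau>}" for s'
    proof -
      have "continuous_on {0..\<tau>} (\<lambda>s. case (s, s') of (s, s') \<Rightarrow> f s s')"
        by (rule continuous_on_compose2[OF fc\<tau>]) (use that in \<open>auto intro!: continuous_intros\<close>)
      then show ?thesis by simp
    qed
    show ?thesis
    proof (rule mollified_energy_decay[OF cont _ _ pq \<tau>(2)])
      show "f x y = f y x" for x y
        by (simp add: f_def L2_inner_commute)
      fix \<psi> assume \<psi>: "test_function {0<..<\<tau>} \<psi>" "\<And>s. \<bar>\<psi> s\<bar> \<le> 1"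
      have \<psi>c: "continuous_on T \<psi>" for T
        by (rule continuous_on_subset[OF test_function_continuous[OF \<psi>(1)]]) simp
      have \<psi>d: "(\<psi> has_real_derivative frechet_derivative \<psi> (at t) 1) (at t)" for t
        using test_function_line_derivative[OF \<psi>(1), of 0 1 t] by simp
      have dc: "continuous_on T (deriv \<psi>)" for T
        unfolding DERIV_imp_deriv[OF \<psi>d, abs_def]
        by (rule continuous_on_subset[OF test_function_derivative_continuous[OF \<psi>(1)]]) auto
      have \<psi>m: "\<psi> \<in> borel_measurable ?M"
        by (intro continuous_imp_measurable_on_sets_lebesgue \<psi>c) simp
      have par: "continuous_on {0..\<tau>} (\<lambda>y. integral {0..\<tau>} (\<lambda>x. f x y * h x))"
        if h: "continuous_on {0..\<tau>} h" for h
      proof -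
        have "continuous_on ({0..\<tau>} \<times> cbox 0 \<tau>) (\<lambda>(y, x). f x y * h x)"
        proof -
          have "continuous_on ({0..\<tau>} \<times> cbox 0 \<tau>) (\<lambda>z. case (snd z, fst z) of (s, s') \<Rightarrow> f s s')"
            by (rule continuous_on_compose2[OF fc\<tau>]) (auto intro!: continuous_intros)
          moreover have "continuous_on ({0..\<tau>} \<times> cbox 0 \<tau>) (\<lambda>z. h (snd z))"
            by (rule continuous_on_compose2[OF h continuous_on_snd[OF continuous_on_id]]) auto
          ultimately show ?thesis
            unfolding case_prod_unfold fst_conv snd_conv by (rule continuous_on_mult)
        qed
        from integral_continuous_on_param[OF this] show ?thesis by simp
      qed
      define G where "G y = integral {0..\<tau>} (\<lambda>x. f x y * deriv \<psi> x)" for y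
      define H where "H y = integral {0..\<tau>} (\<lambda>x. f x y * \<psi> x)" for y
      have GH: "continuous_on {0..\<tau>} G" "continuous_on {0..\<tau>} H"
        unfolding G_def[abs_def] H_def[abs_def] by (intro par dc \<psi>c)+
      have nonneg: "AE y in ?M. integrable ?M (\<lambda>x. Q (W x) (W y) * \<psi> x)"
        "0 \<le> (\<integral>y. (\<integral>x. Q (W x) (W y) * \<psi> x \<partial>?M) * \<psi> y \<partial>?M)"
        by (rule H1.bounded_form_double_integral_nonneg[OF Q _ I Wb \<psi>m \<psi>(2)], erule Q_pos)+
      have WH1: "AE y in ?M. W y \<in> H1 S"
        using Wb by (auto simp: bochner_L2_def strongly_measurable_def)
      \<comment> \<open>\<open>W y\<close> is an admissible test vector, with integrable inner
        integrand, only for almost every \<open>y\<close>. For those \<open>y\<close> the equation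
        turns the inner integral of \<open>?B\<close> into \<open>\<gamma> * G y\<close>.\<close>
      have "AE y in ?M. (\<gamma> * G y - c * H y) * \<psi> y = (\<integral>x. Q (W x) (W y) * \<psi> x \<partial>?M) * \<psi> y"
        using nonneg(1) WH1 AE_space[of ?M]
      proof eventually_elim
        case (elim y)
        then have y: "y \<in> {0..\<tau>}" by simp
        have fint: "integrable ?M (\<lambda>x. f x y * \<psi> x)"
          by (intro integrable_Ioo_continuous continuous_on_mult fs y \<psi>c)
        have B_eq: "?B (W x) (W y) * \<psi> x = Q (W x) (W y) * \<psi> x + c * (f x y * \<psi> x)" for x
          by (simp add: Q_def f_def algebra_simps)
        have Bint: "integrable ?M (\<lambda>x. ?B (W x) (W y) * \<psi> x)"
          unfolding B_eq using elim(1) fint by simp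
        have "(\<integral>x. ?B (W x) (W y) * \<psi> x \<partial>?M) = \<gamma> * G y"
          using hjb_flow_tested[OF S form \<gamma> fixed_point \<tau>(1) V VH1 V'(2,3) \<psi>(1) elim(2)] Bint
          by (simp add: G_def f_def W_def[abs_def])
        moreover have "(\<integral>x. f x y * \<psi> x \<partial>?M) = H y"
          unfolding H_def by (intro integral_Ioo_continuous continuous_on_mult fs y \<psi>c)
        ultimately have "\<gamma> * G y = (\<integral>x. Q (W x) (W y) * \<psi> x \<partial>?M) + c * H y"
          unfolding B_eq using elim(1) fint by simp
        then show ?case by simp
      qed
      moreover have GHc: "continuous_on {0..\<tau>} (\<lambda>y. (\<gamma> * G y - c * H y) * \<psi> y)"
        by (intro continuous_intros GH \<psi>c)
      ultimately have "(\<integral>y. (\<gamma> * G y - c * H y) * \<psi> y \<partial>?M) = (\<integral>y. (\<integral>x. Q (W x) (W y) * \<psi> x \<partial>?M) * \<psi> y \<partial>?M)"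
        using integrable_Ioo_continuous[OF GHc] by (intro integral_cong_AE_lebesgue_on) auto
      with nonneg(2) have "0 \<le> (\<integral>y. (\<gamma> * G y - c * H y) * \<psi> y \<partial>?M)"
        by simp
      also have "\<dots> = integral {0..\<tau>} (\<lambda>y. (\<gamma> * G y - c * H y) * \<psi> y)"
        by (rule integral_Ioo_continuous[OF GHc])
      also have "\<dots> = \<gamma> * integral {0..\<tau>} (\<lambda>y. G y * \<psi> y) - c * integral {0..\<tau>} (\<lambda>y. H y * \<psi> y)"
      proof -
        have "(\<lambda>y. \<gamma> * (G y * \<psi> y)) integrable_on {0..\<tau>}" "(\<lambda>y. c * (H y * \<psi> y)) integrable_on {0..\<tau>}"
          by (intro integrable_continuous_real continuous_on_mult continuous_on_const GH \<psi>c)+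
        from Henstock_Kurzweil_Integration.integral_diff[OF this] show ?thesis
          by (simp add: left_diff_distrib mult.assoc)
      qed
      finally show "c / \<gamma> * integral {0..\<tau>} (\<lambda>y. integral {0..\<tau>} (\<lambda>x. f x y * \<psi> x) * \<psi> y)
          \<le> integral {0..\<tau>} (\<lambda>y. integral {0..\<tau>} (\<lambda>x. f x y * deriv \<psi> x) * \<psi> y)"
        using \<gamma> by (simp add: G_def H_def field_simps)
    qed
  qed
  have diag: "continuous_on {0..} (\<lambda>p. f p p)"
  proof -
    have "continuous_on {0..} (\<lambda>p. case (p, p) of (s, s') \<Rightarrow> f s s')"
      by (rule continuous_on_compose2[OF fc]) (auto intro!: continuous_intros)
    then show ?thesis by simp
  qed
  \<comment> \<open>Kernels must be supported in positive times, so decay is first known only from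
    positive starting times \<open>p\<close>. The case starting at 0 follows as \<open>p\<close>
    tends to 0, by continuity of the energy.\<close>
  have main: "f t t \<le> exp (- (2 * (c / \<gamma>) * (t - 0))) * f 0 0"
  proof (cases "t = 0")
    case False
    then have "t > 0" using t by simp
    have "((\<lambda>p. f p p) \<longlongrightarrow> f 0 0) (at 0 within {0..})"
      using diag by (simp add: continuous_on)
    then have "((\<lambda>p. f p p) \<longlongrightarrow> f 0 0) (at_right 0)"
      by (rule tendsto_within_subset) auto
    then have lim: "((\<lambda>p. exp (- (2 * (c / \<gamma>) * (t - p))) * f p p) \<longlongrightarrow> exp (- (2 * (c / \<gamma>) * (t - 0))) * f 0 0) (at_right 0)"
      by (intro tendsto_intros)
    show ?thesis
    proof (rule tendsto_lowerbound[OF lim])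
      show "\<forall>\<^sub>F p in at_right 0. f t t \<le> exp (- (2 * (c / \<gamma>) * (t - p))) * f p p"
        unfolding eventually_at_right_field
      proof (intro exI[of _ t] conjI allI impI)
        show "f t t \<le> exp (- (2 * (c / \<gamma>) * (t - p))) * f p p" if "0 < p" "p < t" for p
          by (rule decay) (use that in simp_all)
      qed (use \<open>t > 0\<close> in simp)
    qed simp
  qed simp
  have W0: "L2_norm S (W 0) = L2_norm S (\<lambda>x. V0 x - P x)"
  proof (rule L2_norm_cong_AE)
    have "AE x in lebesgue_on S. V 0 x = V0 x"
      using flow by (simp add: hjb_flow_def)
    then show "AE x in lebesgue_on S. W 0 x = V0 x - P x"
      by eventually_elim (simp add: W_def)
  qed (use S WL2 in auto)
  \<comment> \<open>The diagonal value \<open>f t t\<close> is the squared norm, so the rate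
    \<open>2 * (c / \<gamma>)\<close> for \<open>f\<close> is halved for the norm.\<close>
  have "(L2_norm S (W t))\<^sup>2 \<le> (exp (- (c / \<gamma>) * t) * L2_norm S (W 0))\<^sup>2"
    using main by (simp add: f_def L2_norm_power2_inner[symmetric] power_mult_distrib exp_double[symmetric] mult_ac)
  then have "L2_norm S (W t) \<le> exp (- (c / \<gamma>) * t) * L2_norm S (W 0)"
    by (rule power2_le_imp_le) (simp add: L2_norm_nonneg)
  then show ?thesis
    unfolding W0 by (simp add: W_def[abs_def])
qed

theorem proposition2:
  fixes S :: "(real^'n::finite) set"
    and A :: "'a measure"
    and \<pi> :: "real^'n \<Rightarrow> 'a measure"
    and \<mu> :: "real^'n \<Rightarrow> 'a \<Rightarrow> real^'n"
    and \<sigma> :: "real^'n \<Rightarrow> 'a \<Rightarrow> real^'m::finite^'n"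
    and \<rho> :: "real^'n \<Rightarrow> 'a \<Rightarrow> real"
    and \<gamma> :: real
    and V\<^sub>\<pi> :: "real^'n \<Rightarrow> real"
  defines "r \<equiv> avg_reward \<pi> \<rho>"
    and "b \<equiv> avg_drift \<pi> \<mu>"
    and "D \<equiv> avg_diffusion \<pi> \<sigma>"
  assumes policy: "\<And>s. s \<in> closure S \<Longrightarrow> prob_space (\<pi> s) \<and> sets (\<pi> s) = sets A"
    and expectations_exist: "\<And>s. s \<in> closure S \<Longrightarrow>
           integrable (\<pi> s) (\<rho> s) \<and> integrable (\<pi> s) (\<mu> s) \<and>
           integrable (\<pi> s) (\<lambda>a. \<sigma> s a ** transpose (\<sigma> s a))"
    and domain: "bounded S" "connected S" "open S" "smooth_boundary S"
    and bounded_coeffs: "bounded (r ` closure S)" "bounded (b ` closure S)" "bounded (D ` closure S)"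
    and lipschitz_coeffs: "\<exists>L. L-lipschitz_on (closure S) r" "\<exists>L. L-lipschitz_on (closure S) b"
          "\<exists>L. L-lipschitz_on (closure S) D"
    and symmetric: "\<And>s. s \<in> closure S \<Longrightarrow> transpose (D s) = D s"
    and elliptic: "\<exists>\<alpha>>0. \<forall>s\<in>closure S. \<forall>\<xi>. \<alpha> * (norm \<xi>)\<^sup>2 \<le> \<xi> \<bullet> (D s *v \<xi>)"
    and discount: "\<gamma> > 0"
    and coercive: "coercive_on_H1 S (hjb_form S \<gamma> b D)"
    and fixed_point: "hjb_weak_solution S \<gamma> r b D V\<^sub>\<pi>"
  shows "\<exists>lam>0. \<forall>V0\<in>L2 S. \<forall>V. hjb_flow S \<gamma> r b D V0 V \<longrightarrow>
           (\<forall>t\<ge>0. L2_norm S (\<lambda>x. V t x - V\<^sub>\<pi> x)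
                   \<le> exp (- lam * t) * L2_norm S (\<lambda>x. V0 x - V\<^sub>\<pi> x))"
proof -
  have S: "open S" "bounded S"
    by (rule domain)+
  obtain L L' where "L-lipschitz_on (closure S) b" "L'-lipschitz_on (closure S) D"
    using lipschitz_coeffs by blast
  then have "L-lipschitz_on S b" "L'-lipschitz_on S D"
    by (auto intro: lipschitz_on_subset[OF _ closure_subset])
  note form = bounded_form_hjb_form[OF S this, of \<gamma>]
  obtain c where c: "c > 0" "\<And>v. v \<in> H1 S \<Longrightarrow> c * (H1_norm S v)\<^sup>2 \<le> hjb_form S \<gamma> b D v v"
    using coercive unfolding coercive_on_H1_def by blast
  show ?thesis
  \<comment> \<open>The coercivity constant and the discount rate determine the witness, which is
    thus the same for all initial values and solutions.\<close>
  proof (intro exI[of _ "c / \<gamma>"] conjI ballI allI impI)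
    show "c / \<gamma> > 0"
      using c(1) discount by simp
    fix V0 V t
    assume "V0 \<in> L2 S" "hjb_flow S \<gamma> r b D V0 V" "t \<ge> (0::real)"
    from hjb_flow_decay[OF S form discount c fixed_point this]
    show "L2_norm S (\<lambda>x. V t x - V\<^sub>\<pi> x) \<le> exp (- (c / \<gamma>) * t) * L2_norm S (\<lambda>x. V0 x - V\<^sub>\<pi> x)" .
  qed
qed

end
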